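(* In the setting of the context, with $0<T<\infty$ almost surely under $\mathcal{P}(dN|\rho,\eta)$: (i) Let $\theta>0$ with $E[T^{-\theta}|\rho,\eta]<\infty$. Then $$\tilde{\mathcal{P}}(dN|\rho,\eta,\theta)=\int_0^\infty\mathcal{P}(dN|e^{-vh}\rho,\eta)\,\pi_\theta(dv|\rho,\eta);$$ that is, given $V=v$, $N$ is a Poisson random measure with intensity $e^{-vh(s)}\rho(ds|y)\eta(dy)$, and $V$ has density $\pi_\theta(dv|\rho,\eta)$ on $(0,\infty)$. Equivalently, the Laplace functional of $N$ under $\tilde{\mathcal{P}}(dN|\rho,\eta,\theta)$ is $\int_0^\infty\mathcal{L}_N(f|e^{-vh}\rho,\eta)\,\pi_\theta(dv|\rho,\eta)$. (ii) For each integer $n\ge1$, $$\mathcal{P}(dN|\rho,\eta)=\sum_{\mathbf{p}}\int\mathcal{P}(dN,d\mathbf{J},d\mathbf{Y}^*|e^{-vh}\rho,\eta)\,\pi_{n,0}(dv,\mathbf{p}|\rho,\eta),$$ the integral being over $(\mathbf{J},\mathbf{Y}^*,v)\in\mathcal{S}^{n(\mathbf{p})}\times\mathcal{Y}^{n(\mathbf{p})}\times(0,\infty)$. That is, $N\sim\mathcal{P}(dN|\rho,\eta)$ can be represented in distribution as $N^*+\sum_{j=1}^{n(\mathbf{p})}\delta_{(J_{j,n},Y_j^* )}$, where $(V,\mathbf{p})$ has law $\pi_{n,0}(dv,\mathbf{p}|\rho,\eta)$ and, given $(V,\mathbf{p})$ with $V=v$, $N^*$ is independent of $(\mathbf{J},\mathbf{Y}^*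 )$, $N^*\sim\mathcal{P}(dN|e^{-vh}\rho,\eta)$ and $(\mathbf{J},\mathbf{Y}^* )\sim\Pr(d\mathbf{J},d\mathbf{Y}^*|e^{-vh}\rho,\eta)$. (iii) Let $n\ge1$ be an integer and $\theta$ real with $\theta+n>0$, $E[T^{-\theta}|\rho,\eta]<\infty$ and $E[T^{-(\theta+n)}|\rho,\eta]<\infty$. Then $$\tilde{\mathcal{P}}(dN|\rho,\eta,\theta)=\sum_{\mathbf{p}}\int\mathcal{P}(dN,d\mathbf{J},d\mathbf{Y}^*|e^{-vh}\rho,\eta)\,\pi_{\theta+n,\theta}(dv,\mathbf{p}|\rho,\eta);$$ that is, $N\sim\tilde{\mathcal{P}}(dN|\rho,\eta,\theta)$ has the representation of (ii) except that $(V,\mathbf{p})$ has law $\pi_{\theta+n,\theta}(dv,\mathbf{p}|\rho,\eta)$.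
   Context: $\mathcal{S},\mathcal{Y}$ are Polish spaces; $\eta$ is a $\sigma$-finite non-atomic measure on $\mathcal{Y}$; $\rho(ds|y)$ is a measurable kernel of ($\sigma$-finite) measures on $\mathcal{S}$; $h:\mathcal{S}\to(0,\infty)$ is measurable. $\mathcal{P}(dN|\rho,\eta)$ is the law of a Poisson random measure on $\mathcal{S}\times\mathcal{Y}$ with intensity $\rho(ds|y)\eta(dy)$; $\mathcal{L}_N(f|\rho,\eta)=E[e^{-N(f)}|\rho,\eta]$; $E[\cdot|\rho,\eta]$ is expectation under $\mathcal{P}(dN|\rho,\eta)$. $\mu(dy)=\int_{\mathcal{S}}h(s)N(ds,dy)$ and $T=\mu(\mathcal{Y})$, a.s. finite. $\tilde{\mathcal{P}}(dN|\rho,\eta,\theta)=T^{-\theta}\mathcal{P}(dN|\rho,\eta)/E[T^{-\theta}|\rho,\eta]$. $e^{-vh}\rho$ is the kernel $e^{-vh(s)}\rho(ds|y)$. $\kappa_m(e^{-vh}\rho|y)=\int h(s)^me^{-vh(s)}\rho(ds|y)$, $\kappa_m(e^{-vh}\Omega)=\int_{\mathcal{Y}}\kappa_m(e^{-vh}\rho|y)\eta(dy)$. Partitions $\mathbf{p}=\{C_1,\dots,C_{n(\mathbf{p})}\}$ of $\{1,\dots,n\}$ have cell sizes $e_{j,n}=|C_j|$. $\pi_\theta(dv|\rho,\eta)=\frac{v^{\theta-1}E[e^{-vT}|\rho,\eta]dv}{\Gamma(\theta)E[T^{-\theta}|\rho,\eta]}$ on $(0,\infty)$, and $$\pi_{\theta+n,\theta}(dv,\mathbf{p}|\rho,\eta)=\frac{\big[\prod_{j=1}^{n(\mathbf{p})}\kappa_{e_{j,n}}(e^{-vh}\Omega)\big]v^{\theta+n-1}E[e^{-vT}|\rho,\eta]dv}{\Gamma(\theta+n)E[T^{-\theta}|\rho,\eta]},$$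 with $\pi_{n,0}$ the case $\theta=0$ (a probability distribution of $(V,\mathbf{p})$). Given $\mathbf{p}$, $\Pr(d\mathbf{J},d\mathbf{Y}^*|e^{-vh}\rho,\eta)$ is the law making the pairs $(J_{j,n},Y_j^* )$, $j=1,\dots,n(\mathbf{p})$, independent with joint law $\frac{h(s)^{e_{j,n}}e^{-vh(s)}\rho(ds|y)\eta(dy)}{\kappa_{e_{j,n}}(e^{-vh}\Omega)}$. $\mathcal{P}(dN,d\mathbf{J},d\mathbf{Y}^*|e^{-vh}\rho,\eta)$ is (given $\mathbf{p}$) the joint law of $N=N^*+\sum_j\delta_{(J_{j,n},Y_j^* )}$, $\mathbf{J}$, $\mathbf{Y}^*$, where $N^*\sim\mathcal{P}(dN|e^{-vh}\rho,\eta)$ is independent of $(\mathbf{J},\mathbf{Y}^* )\sim\Pr(d\mathbf{J},d\mathbf{Y}^*|e^{-vh}\rho,\eta)$. *)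

theory Defs
  imports "HOL-Probability.Probability"
begin

text \<open>Laws of random measures live on the space of all measures on \<open>M\<close>, with the \<open>\<sigma>\<close>-algebra
  generated by the evaluations \<open>N \<mapsto> N(A)\<close>; this is the construction of \<^const>\<open>subprob_algebra\<close>
  without the bound on the total mass.\<close>

definition measure_algebra :: "'c measure \<Rightarrow> 'c measure measure" where
  "measure_algebra M =
     (SUP A \<in> sets M. vimage_algebra {N. sets N = sets M} (\<lambda>N. emeasure N A) borel)"

text \<open>Written out instead of using \<^const>\<open>poisson_pmf\<close>, whose facts require a strictly positive rate.\<close>

definition has_poisson_count :: "'c measure measure \<Rightarrow> 'c set \<Rightarrow> ennreal \<Rightarrow> bool" where
  "has_poisson_count P A r \<longleftrightarrow>
     (if r = \<infinity> then AE N in P. emeasure N A = \<infinity>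
      else \<forall>k::nat. measure P {N \<in> space P. emeasure N A = of_nat k}
             = exp (- enn2real r) * enn2real r ^ k / fact k)"

definition poisson_random_measure_law :: "'c measure \<Rightarrow> 'c measure measure \<Rightarrow> bool" where
  "poisson_random_measure_law \<nu> P \<longleftrightarrow>
     sets P = sets (measure_algebra \<nu>) \<and>
     prob_space P \<and>
     (\<forall>A\<in>sets \<nu>. has_poisson_count P A (emeasure \<nu> A)) \<and>
     (\<forall>(k::nat) A. A ` {..<k} \<subseteq> sets \<nu> \<and> disjoint_family_on A {..<k} \<longrightarrow>
        prob_space.indep_vars P (\<lambda>_. borel) (\<lambda>i N. emeasure N (A i)) {..<k})"

definition non_atomic :: "'b measure \<Rightarrow> bool" where
  "non_atomic \<eta> \<longleftrightarrow>
     (\<forall>A\<in>sets \<eta>. 0 < emeasure \<eta> A \<longrightarrow>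
        (\<exists>B\<in>sets \<eta>. B \<subseteq> A \<and> 0 < emeasure \<eta> B \<and> emeasure \<eta> B < emeasure \<eta> A))"

definition sigma_finite_kernel :: "('b::topological_space \<Rightarrow> 'a::topological_space measure) \<Rightarrow> bool" where
  "sigma_finite_kernel \<rho> \<longleftrightarrow>
     (\<forall>y. sets (\<rho> y) = sets borel \<and> sigma_finite_measure (\<rho> y)) \<and>
     (\<forall>A\<in>sets borel. (\<lambda>y. emeasure (\<rho> y) A) \<in> borel_measurable borel)"

text \<open>The measure \<open>\<rho>(ds|y) \<eta>(dy)\<close>.  If the set function below were not countably additive,
  \<^const>\<open>measure_of\<close> would give the null measure; this is excluded whenever the Poisson random
  measure with this intensity satisfies \<open>0 < T < \<infinity>\<close>.\<close>

definition intensity ::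
  "('b::topological_space \<Rightarrow> 'a::topological_space measure) \<Rightarrow> 'b measure \<Rightarrow> ('a \<times> 'b) measure" where
  "intensity \<rho> \<eta> = measure_of UNIV (sets (borel \<Otimes>\<^sub>M borel))
     (\<lambda>A. \<integral>\<^sup>+ y. emeasure (\<rho> y) {s. (s, y) \<in> A} \<partial>\<eta>)"

text \<open>\<open>\<P>(dN|\<rho>,\<eta>)\<close>; such a law is unique when it exists.\<close>

definition prm ::
  "('b::topological_space \<Rightarrow> 'a::topological_space measure) \<Rightarrow> 'b measure \<Rightarrow> ('a \<times> 'b) measure measure" where
  "prm \<rho> \<eta> = (THE P. poisson_random_measure_law (intensity \<rho> \<eta>) P)"

text \<open>\<open>e\<^sup>-\<^sup>x\<close> for \<open>x \<in> [0,\<infinity>]\<close>.\<close>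

definition exp_neg :: "ennreal \<Rightarrow> ennreal" where
  "exp_neg x = (if x = \<infinity> then 0 else ennreal (exp (- enn2real x)))"

definition laplace_functional ::
  "('c \<Rightarrow> ennreal) \<Rightarrow> 'c measure measure \<Rightarrow> ennreal" where
  "laplace_functional f P = (\<integral>\<^sup>+ N. exp_neg (\<integral>\<^sup>+ x. f x \<partial>N) \<partial>P)"

definition mu :: "('a \<Rightarrow> real) \<Rightarrow> ('a \<times> 'b::topological_space) measure \<Rightarrow> 'b measure" where
  "mu h N = distr (density N (\<lambda>(s, y). ennreal (h s))) borel snd"

definition Tmass :: "('a \<Rightarrow> real) \<Rightarrow> ('a \<times> 'b::topological_space) measure \<Rightarrow> ennreal" where
  "Tmass h N = emeasure (mu h N) UNIV"

text \<open>\<open>T\<^sup>-\<^sup>\<theta>\<close> for real \<open>\<theta>\<close> of either sign; only meaningful for \<open>0 < T < \<infinity>\<close>.\<close>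

definition T_neg_powr ::
  "('a \<Rightarrow> real) \<Rightarrow> real \<Rightarrow> ('a \<times> 'b::topological_space) measure \<Rightarrow> ennreal" where
  "T_neg_powr h \<theta> N = ennreal (enn2real (Tmass h N) powr (- \<theta>))"

definition E_T_neg_powr ::
  "('a::topological_space \<Rightarrow> real) \<Rightarrow> ('b::topological_space \<Rightarrow> 'a measure) \<Rightarrow> 'b measure \<Rightarrow> real \<Rightarrow> ennreal" where
  "E_T_neg_powr h \<rho> \<eta> \<theta> = (\<integral>\<^sup>+ N. T_neg_powr h \<theta> N \<partial>prm \<rho> \<eta>)"

definition E_exp_T ::
  "('a::topological_space \<Rightarrow> real) \<Rightarrow> ('b::topological_space \<Rightarrow> 'a measure) \<Rightarrow> 'b measure \<Rightarrow> real \<Rightarrow> ennreal" where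
  "E_exp_T h \<rho> \<eta> v = (\<integral>\<^sup>+ N. exp_neg (ennreal v * Tmass h N) \<partial>prm \<rho> \<eta>)"

definition prm_T ::
  "('a::topological_space \<Rightarrow> real) \<Rightarrow> ('b::topological_space \<Rightarrow> 'a measure) \<Rightarrow> 'b measure \<Rightarrow> real
     \<Rightarrow> ('a \<times> 'b) measure measure" where
  "prm_T h \<rho> \<eta> \<theta> =
     density (prm \<rho> \<eta>) (\<lambda>N. T_neg_powr h \<theta> N / E_T_neg_powr h \<rho> \<eta> \<theta>)"

text \<open>The kernel \<open>e\<^sup>-\<^sup>v\<^sup>h \<rho>\<close>.\<close>

definition tilt :: "('a \<Rightarrow> real) \<Rightarrow> real \<Rightarrow> ('b \<Rightarrow> 'a measure) \<Rightarrow> 'b \<Rightarrow> 'a measure" where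
  "tilt h v \<rho> y = density (\<rho> y) (\<lambda>s. ennreal (exp (- v * h s)))"

text \<open>\<open>kappa h m (tilt h v \<rho>) y\<close> is \<open>\<kappa>\<^sub>m(e\<^sup>-\<^sup>v\<^sup>h \<rho>|y)\<close>, and similarly for \<open>kappa_Omega\<close>.\<close>

definition kappa :: "('a \<Rightarrow> real) \<Rightarrow> nat \<Rightarrow> ('b \<Rightarrow> 'a measure) \<Rightarrow> 'b \<Rightarrow> ennreal" where
  "kappa h m \<rho> y = (\<integral>\<^sup>+ s. ennreal (h s ^ m) \<partial>\<rho> y)"

definition kappa_Omega :: "('a \<Rightarrow> real) \<Rightarrow> nat \<Rightarrow> ('b \<Rightarrow> 'a measure) \<Rightarrow> 'b measure \<Rightarrow> ennreal" where
  "kappa_Omega h m \<rho> \<eta> = (\<integral>\<^sup>+ y. kappa h m \<rho> y \<partial>\<eta>)"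

definition pi_mix ::
  "('a::topological_space \<Rightarrow> real) \<Rightarrow> ('b::topological_space \<Rightarrow> 'a measure) \<Rightarrow> 'b measure \<Rightarrow> real \<Rightarrow> real measure" where
  "pi_mix h \<rho> \<eta> \<theta> =
     density (restrict_space lborel {0<..})
       (\<lambda>v. ennreal (v powr (\<theta> - 1)) * E_exp_T h \<rho> \<eta> v
              / (ennreal (Gamma \<theta>) * E_T_neg_powr h \<rho> \<eta> \<theta>))"

text \<open>\<open>\<pi>\<^bsub>\<theta>+n,\<theta>\<^esub>(dv,\<p>|\<rho>,\<eta>)\<close>, a measure on \<open>(0,\<infinity>)\<close> times the partitions of \<open>{1..n}\<close>.\<close>

definition pi_part ::
  "('a::topological_space \<Rightarrow> real) \<Rightarrow> ('b::topological_space \<Rightarrow> 'a measure) \<Rightarrow> 'b measure \<Rightarrow> nat \<Rightarrow> real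
     \<Rightarrow> (real \<times> nat set set) measure" where
  "pi_part h \<rho> \<eta> n \<theta> =
     density (restrict_space lborel {0<..} \<Otimes>\<^sub>M count_space {p. partition_on {1..n} p})
       (\<lambda>(v, p). (\<Prod>C\<in>p. kappa_Omega h (card C) (tilt h v \<rho>) \<eta>)
              * ennreal (v powr (\<theta> + real n - 1)) * E_exp_T h \<rho> \<eta> v
              / (ennreal (Gamma (\<theta> + real n)) * E_T_neg_powr h \<rho> \<eta> \<theta>))"

text \<open>The law of one pair \<open>(J,Y\<^sup>*)\<close> attached to a cell of size \<open>e\<close>, and the law of all the pairs.
  Pairs are indexed by the cells of \<open>p\<close> themselves, so that no enumeration of the cells is chosen.
  Both are to be used with \<open>tilt h v \<rho>\<close> in place of \<open>\<rho>\<close>, which supplies the factor \<open>e\<^sup>-\<^sup>v\<^sup>h\<close>.\<close>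

definition pair_law ::
  "('a::topological_space \<Rightarrow> real) \<Rightarrow> nat \<Rightarrow> ('b::topological_space \<Rightarrow> 'a measure) \<Rightarrow> 'b measure
     \<Rightarrow> ('a \<times> 'b) measure" where
  "pair_law h e \<rho> \<eta> =
     density (intensity \<rho> \<eta>) (\<lambda>(s, y). ennreal (h s ^ e) / kappa_Omega h e \<rho> \<eta>)"

definition pairs_law ::
  "('a::topological_space \<Rightarrow> real) \<Rightarrow> ('b::topological_space \<Rightarrow> 'a measure) \<Rightarrow> 'b measure \<Rightarrow> nat set set
     \<Rightarrow> (nat set \<Rightarrow> 'a \<times> 'b) measure" where
  "pairs_law h \<rho> \<eta> p = PiM p (\<lambda>C. pair_law h (card C) \<rho> \<eta>)"

text \<open>\<open>N + \<Sum>\<^bsub>C\<in>p\<^esub> \<delta>\<^bsub>z C\<^esub>\<close>.\<close>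

definition add_points :: "'c measure \<Rightarrow> 'i set \<Rightarrow> ('i \<Rightarrow> 'c) \<Rightarrow> 'c measure" where
  "add_points N p z =
     measure_of (space N) (sets N) (\<lambda>A. emeasure N A + (\<Sum>C\<in>p. indicator A (z C)))"

text \<open>\<open>\<P>(dN,d\<J>,d\<Y>\<^sup>*|\<rho>,\<eta>)\<close> given \<open>p\<close>, again to be used with \<open>tilt h v \<rho>\<close>.\<close>

definition joint_law ::
  "('a::topological_space \<Rightarrow> real) \<Rightarrow> ('b::topological_space \<Rightarrow> 'a measure) \<Rightarrow> 'b measure \<Rightarrow> nat set set
     \<Rightarrow> (('a \<times> 'b) measure \<times> (nat set \<Rightarrow> 'a \<times> 'b)) measure" where
  "joint_law h \<rho> \<eta> p =
     distr (prm \<rho> \<eta> \<Otimes>\<^sub>M pairs_law h \<rho> \<eta> p)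
       (measure_algebra (borel \<Otimes>\<^sub>M borel) \<Otimes>\<^sub>M PiM p (\<lambda>_. borel \<Otimes>\<^sub>M borel))
       (\<lambda>(N, z). (add_points N p z, z))"

definition N_law ::
  "('a::topological_space \<Rightarrow> real) \<Rightarrow> ('b::topological_space \<Rightarrow> 'a measure) \<Rightarrow> 'b measure \<Rightarrow> nat set set
     \<Rightarrow> ('a \<times> 'b) measure measure" where
  "N_law h \<rho> \<eta> p = distr (joint_law h \<rho> \<eta> p) (measure_algebra (borel \<Otimes>\<^sub>M borel)) fst"

end

theory Submission
  imports Defs
begin

text \<open>A Poisson random measure with \<open>\<sigma>\<close>-finite intensity \<open>\<nu>\<close> is characterised, among random
  measures whose counts are integers on sets of finite intensity and infinite on the others, by the Mecke formula
  \<open>E[N(f) G(N)] = \<integral> f(z) E[G(N + \<delta>\<^sub>z)] \<nu>(dz)\<close>. As \<open>T\<close> is additive under adding a point, the formula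
  survives the change of measure \<open>e\<^sup>-\<^sup>v\<^sup>T / E[e\<^sup>-\<^sup>v\<^sup>T]\<close> with \<open>\<nu>\<close> replaced by \<open>e\<^sup>-\<^sup>v\<^sup>h \<nu>\<close>, so the tilted law
  is again Poisson. Iterating it with \<open>f = h\<close> expands \<open>E[T\<^sup>n e\<^sup>-\<^sup>v\<^sup>T G(N)]\<close> into a sum over the partitions of
  \<open>{1..n}\<close>: each further factor \<open>T\<close> either opens a new cell or enlarges an existing one. All three claims
  then follow by integrating against \<open>v\<close> and using
  \<open>\<integral> v\<^bsup>\<theta>+n-1\<^esup> T\<^sup>n e\<^sup>-\<^sup>v\<^sup>T dv = \<Gamma>(\<theta>+n) T\<^sup>-\<^sup>\<theta>\<close>.\<close>

subsection \<open>The space of measures\<close>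

text \<open>\<open>prm\<close> is a definite description, so nothing is known about the Poisson law
  of the tilted intensity until some law with that intensity has been exhibited and uniqueness has
  been shown. The density \<open>e^{-vT} / E[e^{-vT}]\<close> exhibits one. The Mecke formula is the
  working characterisation because it is linear in the law and passes through a change of density,
  whereas independence of counts does not visibly do so. Three obstacles shape the rest.
  Independence is available for disjoint sets only, so laws are compared after refining all sets to
  atoms. Neither \<sigma>-finiteness of the intensity nor measurability of sections under the kernel
  is given beforehand: both are extracted from \<open>T < \<infinity>\<close> through the sets
  \<open>{h > \<epsilon>}\<close>, while \<open>T > 0\<close> excludes the null intensity. Mixing
  over \<open>v\<close> needs measurability in \<open>v\<close> of laws built from densities,
  products and images; they are rewritten as densities against measures that do not depend on
  \<open>v\<close>. Until the last subsection the space is arbitrary and \<open>h\<close> is a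
  positive function on it. Claim (ii) is the case \<open>\<theta> = 0\<close> of the identity behind
  (iii).\<close>

lemma sets_Collect_mem:
  assumes "f \<in> measurable K L" "U \<in> sets L"
  shows "{x\<in>space K. f x \<in> U} \<in> sets K"
proof -
  have "{x\<in>space K. f x \<in> U} = f -` U \<inter> space K" by auto
  with measurable_sets[OF assms] show ?thesis by simp
qed

lemma space_measure_algebra: "space (measure_algebra M) = {N. sets N = sets M}"
  unfolding measure_algebra_def by (subst space_Sup_eq_UN) auto

lemma measure_algebra_cong: "sets M = sets M' \<Longrightarrow> measure_algebra M = measure_algebra M'"
  by (simp add: measure_algebra_def)

lemma sets_measure_algebra:
  "sets (measure_algebra M) = sigma_sets {N. sets N = sets M}
     {(\<lambda>N. emeasure N A) -` U \<inter> {N. sets N = sets M} |A U. A \<in> sets M \<and> U \<in> sets borel}"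
  (is "_ = sigma_sets ?\<Omega> ?G")
proof -
  have "sets (measure_algebra M) =
      sigma_sets ?\<Omega> (\<Union>A\<in>sets M. sets (vimage_algebra ?\<Omega> (\<lambda>N. emeasure N A) borel))"
    unfolding measure_algebra_def by (subst sets_Sup_eq[where X="?\<Omega>"]) auto
  also have "(\<Union>A\<in>sets M. sets (vimage_algebra ?\<Omega> (\<lambda>N. emeasure N A) borel)) = ?G"
    by (subst sets_vimage_algebra2) auto
  finally show ?thesis .
qed

lemma measurable_emeasure_measure_algebra [measurable]:
  assumes "A \<in> sets M"
  shows "(\<lambda>N. emeasure N A) \<in> borel_measurable (measure_algebra M)"
  unfolding measure_algebra_def
  by (rule measurable_SUP1[OF assms]) (auto intro: measurable_vimage_algebra1)

text \<open>The \<sigma>-algebra is initial for the evaluations, so a random measure is measurable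
  as soon as its mass of each set is.\<close>

lemma measurable_measure_algebraI:
  assumes "\<And>a. a \<in> space K \<Longrightarrow> sets (f a) = sets M"
    and "\<And>A. A \<in> sets M \<Longrightarrow> (\<lambda>a. emeasure (f a) A) \<in> borel_measurable K"
  shows "f \<in> measurable K (measure_algebra M)"
  unfolding measure_algebra_def using assms
  by (intro measurable_SUP2) (auto intro: measurable_vimage_algebra2)

text \<open>Induction over nonnegative measurable functions, starting from the evaluations. Each
  case restricts to \<open>N\<close> in the space, because only there do \<open>N\<close> and
  \<open>M\<close> have the same measurable functions.\<close>

lemma borel_measurable_nn_integral_measure_algebra:
  fixes f :: "'c \<Rightarrow> ennreal"
  assumes "f \<in> borel_measurable M"
  shows "(\<lambda>N. \<integral>\<^sup>+x. f x \<partial>N) \<in> borel_measurable (measure_algebra M)"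
  using assms
proof induct
  case (cong f g)
  have "(\<lambda>N. \<integral>\<^sup>+x. f x \<partial>N) \<in> borel_measurable (measure_algebra M) \<longleftrightarrow>
      (\<lambda>N. \<integral>\<^sup>+x. g x \<partial>N) \<in> borel_measurable (measure_algebra M)"
    using cong(3)
    by (intro measurable_cong nn_integral_cong)
       (auto simp: space_measure_algebra dest: sets_eq_imp_space_eq)
  then show ?case using cong by simp
next
  case (set A)
  have "(\<lambda>N. \<integral>\<^sup>+x. indicator A x \<partial>N) \<in> borel_measurable (measure_algebra M) \<longleftrightarrow>
      (\<lambda>N. emeasure N A) \<in> borel_measurable (measure_algebra M)"
    using set by (intro measurable_cong nn_integral_indicator) (auto simp: space_measure_algebra)
  then show ?case using set by simp
next
  case (mult u c)
  have "(\<lambda>N. \<integral>\<^sup>+x. c * u x \<partial>N) \<in> borel_measurable (measure_algebra M) \<longleftrightarrow>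
      (\<lambda>N. c * \<integral>\<^sup>+x. u x \<partial>N) \<in> borel_measurable (measure_algebra M)"
    using mult by (intro measurable_cong nn_integral_cmult)
      (auto simp: space_measure_algebra cong: measurable_cong_sets)
  then show ?case using mult by simp
next
  case (add u v)
  have "(\<lambda>N. \<integral>\<^sup>+x. v x + u x \<partial>N) \<in> borel_measurable (measure_algebra M) \<longleftrightarrow>
      (\<lambda>N. (\<integral>\<^sup>+x. v x \<partial>N) + (\<integral>\<^sup>+x. u x \<partial>N)) \<in> borel_measurable (measure_algebra M)"
    using add by (intro measurable_cong nn_integral_add)
      (auto simp: space_measure_algebra cong: measurable_cong_sets)
  then show ?case using add by simp
next
  case (seq U)
  have "(\<lambda>N. \<integral>\<^sup>+x. (SUP i. U i) x \<partial>N) \<in> borel_measurable (measure_algebra M) \<longleftrightarrow>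
      (\<lambda>N. SUP i. \<integral>\<^sup>+x. U i x \<partial>N) \<in> borel_measurable (measure_algebra M)"
    unfolding SUP_apply using seq
    by (intro measurable_cong nn_integral_monotone_convergence_SUP)
      (auto simp: space_measure_algebra cong: measurable_cong_sets)
  then show ?case using seq by simp
qed

text \<open>Passing to the atoms generated by finitely many sets, \<open>B0\<close> among them, makes the sets disjoint
  and \<open>B0\<close> a union of some of them.\<close>

lemma measure_algebra_eqI:
  assumes P: "sets P = sets (measure_algebra M)" "emeasure P (space P) \<noteq> \<infinity>"
    and Q: "sets Q = sets (measure_algebra M)"
    and B0: "B0 \<in> sets M"
    and eq: "\<And>(k::nat) A I H. 0 < k \<Longrightarrow> A ` {..<k} \<subseteq> sets M \<Longrightarrow> disjoint_family_on A {..<k} \<Longrightarrow>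
        I \<subseteq> {..<k} \<Longrightarrow> B0 = (\<Union>i\<in>I. A i) \<Longrightarrow>
        H \<in> sets (PiM {..<k} (\<lambda>_. borel :: ennreal measure)) \<Longrightarrow>
        emeasure P {N\<in>space P. (\<lambda>i\<in>{..<k}. emeasure N (A i)) \<in> H} =
        emeasure Q {N\<in>space P. (\<lambda>i\<in>{..<k}. emeasure N (A i)) \<in> H}"
  shows "P = Q"
proof -
  define \<Omega> where "\<Omega> = {N. sets N = sets M}"
  define cyl where "cyl F U = {N\<in>\<Omega>. \<forall>B\<in>F. emeasure N B \<in> U B}" for F and U :: "'a set \<Rightarrow> ennreal set"
  \<comment> \<open>The finite-dimensional cylinders are the generating \<pi>-system. Unlike the
    events in \<open>eq\<close>, they allow overlapping sets.\<close>
  define E where "E = {cyl F U |F U. finite F \<and> F \<subseteq> sets M \<and> (\<forall>B. U B \<in> sets borel)}"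
  have sp: "space P = \<Omega>"
    using sets_eq_imp_space_eq[OF P(1)] by (simp add: space_measure_algebra \<Omega>_def)
  have cyl_sets: "cyl F U \<in> sets (measure_algebra M)"
    if "finite F" "F \<subseteq> sets M" "\<And>B. U B \<in> sets borel" for F U
  proof -
    have "cyl F U = {N\<in>space (measure_algebra M). \<forall>B\<in>F. emeasure N B \<in> U B}"
      by (simp add: cyl_def \<Omega>_def space_measure_algebra)
    also have "\<dots> \<in> sets (measure_algebra M)"
      using that by (intro sets.sets_Collect_finite_All sets_Collect_mem[where L=borel]
          measurable_emeasure_measure_algebra) auto
    finally show ?thesis .
  qed
  have gen: "sets (measure_algebra M) = sigma_sets \<Omega> E"
  proof (rule antisym)
    show "sets (measure_algebra M) \<subseteq> sigma_sets \<Omega> E"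
      unfolding sets_measure_algebra \<Omega>_def[symmetric]
    proof (rule sigma_sets_mono, safe)
      fix A :: "'a set" and U :: "ennreal set" assume "A \<in> sets M" "U \<in> sets borel"
      then have "cyl {A} (\<lambda>_. U) \<in> E" by (auto simp: E_def)
      also have "cyl {A} (\<lambda>_. U) = (\<lambda>N. emeasure N A) -` U \<inter> \<Omega>"
        by (auto simp: cyl_def)
      finally show "(\<lambda>N. emeasure N A) -` U \<inter> \<Omega> \<in> sigma_sets \<Omega> E" by auto
    qed
    have "E \<subseteq> sets (measure_algebra M)"
      using cyl_sets by (auto simp: E_def)
    then show "sigma_sets \<Omega> E \<subseteq> sets (measure_algebra M)"
      using sets.sigma_sets_subset[of E "measure_algebra M"]
      by (simp add: space_measure_algebra \<Omega>_def)
  qed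
  have eqE: "emeasure P (cyl F U) = emeasure Q (cyl F U)"
    if F: "finite F" "F \<subseteq> sets M" "\<And>B. U B \<in> sets borel" for F U
  proof -
    \<comment> \<open>\<open>B0\<close> joins the family even when the cylinder does not mention it,
      so that the atoms refine it as well.\<close>
    define F' where "F' = insert B0 F"
    have F': "finite F'" "F' \<subseteq> sets M" using F B0 by (auto simp: F'_def)
    \<comment> \<open>One atom for each subset of \<open>F'\<close>: the points that lie in exactly
      the members of that subset. Some atoms may be empty, which does no harm.\<close>
    define k where "k = card (Pow F')"
    have "k > 0" unfolding k_def using F'(1) by (subst card_gt_0_iff) auto
    obtain g where g: "bij_betw g {..<k} (Pow F')"
      using ex_bij_betw_nat_finite[of "Pow F'"] F'(1) by (auto simp: k_def atLeast0LessThan)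
    define A where "A j = {x\<in>space M. \<forall>B\<in>F'. x \<in> B \<longleftrightarrow> B \<in> g j}" for j
    have A_sets: "A j \<in> sets M" for j
    proof -
      have "{x\<in>space M. x \<in> B} \<in> sets M" if "B \<in> F'" for B
        using F' that sets.sets_into_space[of B M] by (auto simp: Int_absorb1 Int_def[symmetric])
      then show ?thesis
        unfolding A_def using F' by (intro sets.sets_Collect_finite_All) auto
    qed
    have dis: "disjoint_family_on A {..<k}"
      unfolding disjoint_family_on_def
    proof (intro ballI impI)
      fix i j assume ij: "i \<in> {..<k}" "j \<in> {..<k}" "i \<noteq> j"
      then have "g i \<noteq> g j" using g by (auto simp: bij_betw_def inj_on_def)
      moreover have "g i \<subseteq> F'" "g j \<subseteq> F'" using g ij by (auto simp: bij_betw_def)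
      ultimately show "A i \<inter> A j = {}" by (auto simp: A_def)
    qed
    define J where "J B = {j\<in>{..<k}. B \<in> g j}" for B
    have B_UN: "B = (\<Union>j\<in>J B. A j)" if "B \<in> F'" for B
    proof (intro equalityI subsetI)
      fix x assume x: "x \<in> B"
      have "x \<in> space M" using F' that x sets.sets_into_space by blast
      have "{B'\<in>F'. x \<in> B'} \<in> g ` {..<k}" using g by (auto simp: bij_betw_def)
      then obtain j where j: "j < k" "g j = {B'\<in>F'. x \<in> B'}" by auto
      then show "x \<in> (\<Union>j\<in>J B. A j)"
        using \<open>x \<in> space M\<close> x that by (intro UN_I[of j]) (auto simp: J_def A_def)
    qed (use that in \<open>auto simp: J_def A_def\<close>)
    have N_sum: "emeasure N B = (\<Sum>j\<in>J B. emeasure N (A j))" if "N \<in> \<Omega>" "B \<in> F'" for N B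
    proof -
      have "emeasure N B = emeasure N (\<Union>j\<in>J B. A j)" using B_UN[OF that(2)] by simp
      also have "\<dots> = (\<Sum>j\<in>J B. emeasure N (A j))"
        using that A_sets dis
        by (intro sum_emeasure[symmetric]) (auto simp: \<Omega>_def J_def disjoint_family_on_def)
      finally show ?thesis .
    qed
    \<comment> \<open>The mass of \<open>B\<close> is the sum of the masses of its atoms, so the
      cylinder is the preimage of a measurable set of vectors of atom masses.\<close>
    define H where "H = {x\<in>space (PiM {..<k} (\<lambda>_. borel :: ennreal measure)). \<forall>B\<in>F. (\<Sum>j\<in>J B. x j) \<in> U B}"
    have H: "H \<in> sets (PiM {..<k} (\<lambda>_. borel))"
      unfolding H_def using F
      by (intro sets.sets_Collect_finite_All sets_Collect_mem[where L=borel] borel_measurable_sum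
          measurable_component_singleton) (auto simp: J_def)
    have cyl_eq: "cyl F U = {N\<in>space P. (\<lambda>i\<in>{..<k}. emeasure N (A i)) \<in> H}"
      unfolding cyl_def sp
    proof (rule Collect_cong, rule conj_cong[OF refl])
      fix N assume N: "N \<in> \<Omega>"
      have "(\<Sum>j\<in>J B. (\<lambda>i\<in>{..<k}. emeasure N (A i)) j) = emeasure N B" if "B \<in> F" for B
        using that by (subst N_sum[OF N]) (auto simp: F'_def J_def intro: sum.cong)
      then show "(\<forall>B\<in>F. emeasure N B \<in> U B) \<longleftrightarrow> (\<lambda>i\<in>{..<k}. emeasure N (A i)) \<in> H"
        by (auto simp: H_def space_PiM)
    qed
    show ?thesis unfolding cyl_eq
      by (rule eq[OF \<open>k > 0\<close> _ dis _ _ H, where I="J B0"])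
         (use A_sets B_UN[of B0] in \<open>auto simp: J_def F'_def\<close>)
  qed
  show "P = Q"
  proof (rule measure_eqI_generator_eq[where E=E and \<Omega>=\<Omega> and A="\<lambda>_. \<Omega>"])
    show "Int_stable E"
    proof (rule Int_stableI)
      fix a b assume "a \<in> E" "b \<in> E"
      then obtain F U F' U' where a: "a = cyl F U" "finite F" "F \<subseteq> sets M" "\<forall>B. U B \<in> sets borel"
        and b: "b = cyl F' U'" "finite F'" "F' \<subseteq> sets M" "\<forall>B. U' B \<in> sets borel"
        by (auto simp: E_def)
      let ?U = "\<lambda>B. (if B \<in> F then U B else UNIV) \<inter> (if B \<in> F' then U' B else UNIV)"
      have "a \<inter> b = cyl (F \<union> F') ?U" by (auto simp: a b cyl_def)
      then show "a \<inter> b \<in> E" unfolding E_def using a b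
        by (intro CollectI exI[of _ "F \<union> F'"] exI[of _ ?U]) auto
    qed
    show "E \<subseteq> Pow \<Omega>" by (auto simp: E_def cyl_def)
    show "emeasure P X = emeasure Q X" if "X \<in> E" for X
      using that eqE by (auto simp: E_def)
    \<comment> \<open>The cylinder without constraints is the whole space, so finiteness of
      \<open>P\<close> alone supplies the exhausting sequence.\<close>
    have "cyl {} (\<lambda>_. UNIV) \<in> E"
      unfolding E_def by (intro CollectI exI[of _ "{}"] exI[of _ "\<lambda>_. UNIV"]) auto
    then show "range (\<lambda>_::nat. \<Omega>) \<subseteq> E" by (auto simp: cyl_def)
  qed (use P Q gen sp in auto)
qed

section \<open>Adding finitely many atoms to a measure\<close>

lemma sets_add_points [simp, measurable_cong]: "sets (add_points N p z) = sets N"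
  by (simp add: add_points_def)

lemma emeasure_add_points:
  assumes "finite p" "A \<in> sets N"
  shows "emeasure (add_points N p z) A = emeasure N A + (\<Sum>C\<in>p. indicator A (z C))"
  unfolding add_points_def
proof (rule emeasure_measure_of_sigma[OF _ _ _ assms(2)])
  show "sigma_algebra (space N) (sets N)" ..
  show "positive (sets N) (\<lambda>A. emeasure N A + (\<Sum>C\<in>p. indicator A (z C)))"
    by (simp add: positive_def)
  show "countably_additive (sets N) (\<lambda>A. emeasure N A + (\<Sum>C\<in>p. indicator A (z C)))"
  proof (rule countably_additiveI)
    fix F :: "nat \<Rightarrow> _" assume F: "range F \<subseteq> sets N" "disjoint_family F"
    have "(\<Sum>i. emeasure N (F i) + (\<Sum>C\<in>p. indicator (F i) (z C))) =
        (\<Sum>i. emeasure N (F i)) + (\<Sum>C\<in>p. \<Sum>i. indicator (F i) (z C))"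
      by (subst suminf_add[symmetric]) (auto simp: suminf_sum)
    also have "\<dots> = emeasure N (\<Union>(range F)) + (\<Sum>C\<in>p. indicator (\<Union>(range F)) (z C))"
      using F by (simp add: suminf_emeasure suminf_indicator)
    finally show "(\<Sum>i. emeasure N (F i) + (\<Sum>C\<in>p. indicator (F i) (z C))) = \<dots>" .
  qed
qed

text \<open>Induction over the integrand. The atoms must lie in the space, since the congruence case
  compares integrands only there.\<close>

lemma nn_integral_add_points:
  assumes "finite p" "f \<in> borel_measurable N" "\<And>C. C \<in> p \<Longrightarrow> z C \<in> space N"
  shows "(\<integral>\<^sup>+x. f x \<partial>add_points N p z) = (\<integral>\<^sup>+x. f x \<partial>N) + (\<Sum>C\<in>p. f (z C))"
  using assms(2)
proof induct
  case (cong f g)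
  have "(\<integral>\<^sup>+x. f x \<partial>add_points N p z) = (\<integral>\<^sup>+x. g x \<partial>add_points N p z)"
    using cong(3) by (intro nn_integral_cong) (simp add: add_points_def)
  moreover have "(\<integral>\<^sup>+x. f x \<partial>N) = (\<integral>\<^sup>+x. g x \<partial>N)"
    using cong(3) by (intro nn_integral_cong) simp
  moreover have "(\<Sum>C\<in>p. f (z C)) = (\<Sum>C\<in>p. g (z C))"
    using cong(3) assms(3) by (intro sum.cong) auto
  ultimately show ?case using cong(4) by simp
next
  case (set A)
  then show ?case using assms(1) by (simp add: emeasure_add_points)
next
  case (mult u c)
  then show ?case
    by (simp add: nn_integral_cmult distrib_left sum_distrib_left cong: measurable_cong_sets)
next
  case (add u v)
  then show ?case
    by (simp add: nn_integral_add sum.distrib add_ac cong: measurable_cong_sets)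
next
  case (seq U)
  have "(\<integral>\<^sup>+x. (SUP i. U i) x \<partial>add_points N p z) = (SUP i. \<integral>\<^sup>+x. U i x \<partial>add_points N p z)"
    unfolding SUP_apply using seq
    by (intro nn_integral_monotone_convergence_SUP) (auto cong: measurable_cong_sets)
  also have "\<dots> = (SUP i. (\<integral>\<^sup>+x. U i x \<partial>N) + (\<Sum>C\<in>p. U i (z C)))"
    using seq by simp
  also have "\<dots> = (SUP i. \<integral>\<^sup>+x. U i x \<partial>N) + (SUP i. \<Sum>C\<in>p. U i (z C))"
    using seq(4) by (intro ennreal_SUP_add)
      (auto simp: incseq_def le_fun_def intro!: nn_integral_mono sum_mono)
  also have "(SUP i. \<Sum>C\<in>p. U i (z C)) = (\<Sum>C\<in>p. SUP i. U i (z C))"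
    using seq(4) by (intro ennreal_SUP_sum) (auto simp: incseq_def le_fun_def)
  also have "(SUP i. \<integral>\<^sup>+x. U i x \<partial>N) = (\<integral>\<^sup>+x. (SUP i. U i x) \<partial>N)"
    using seq by (intro nn_integral_monotone_convergence_SUP[symmetric]) auto
  finally show ?case by (simp add: SUP_apply image_comp)
qed

lemma add_points_empty [simp]: "add_points N {} z = N"
  by (rule measure_eqI) (auto simp: emeasure_add_points)

text \<open>Base measure and atoms may depend jointly on the parameter, as happens when
  \<open>N\<close> and the points are integrated over a product space.\<close>

lemma measurable_add_points [measurable]:
  assumes p: "finite p" and f: "f \<in> measurable K (measure_algebra M)"
    and z: "\<And>C. C \<in> p \<Longrightarrow> (\<lambda>a. z a C) \<in> measurable K M"
  shows "(\<lambda>a. add_points (f a) p (z a)) \<in> measurable K (measure_algebra M)"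
proof (rule measurable_measure_algebraI)
  have sf: "sets (f a) = sets M" if "a \<in> space K" for a
    using measurable_space[OF f that] by (simp add: space_measure_algebra)
  then show "sets (add_points (f a) p (z a)) = sets M" if "a \<in> space K" for a
    using that by simp
  fix A assume A: "A \<in> sets M"
  have "(\<lambda>a. emeasure (f a) A + (\<Sum>C\<in>p. indicator A (z a C))) \<in> borel_measurable K"
    using measurable_compose[OF f measurable_emeasure_measure_algebra[OF A]]
      measurable_compose[OF z borel_measurable_indicator[OF A]]
    by (intro borel_measurable_add borel_measurable_sum) auto
  also have "?this \<longleftrightarrow> (\<lambda>a. emeasure (add_points (f a) p (z a)) A) \<in> borel_measurable K"
    using p A sf by (intro measurable_cong) (simp add: emeasure_add_points)
  finally show "(\<lambda>a. emeasure (add_points (f a) p (z a)) A) \<in> borel_measurable K" .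
qed

subsection \<open>Poisson random measures and the Mecke formula\<close>

text \<open>Rates and values are extended reals: rate \<open>\<infinity>\<close> gives the point
  mass at \<open>\<infinity>\<close>, and rate 0 the point mass at 0 because
  \<open>0 ^ 0 = 1\<close>.\<close>

definition poisson_law :: "ennreal \<Rightarrow> ennreal measure" where
  "poisson_law r =
     (if r = \<infinity> then return borel \<infinity>
      else distr (density (count_space UNIV)
                   (\<lambda>k::nat. ennreal (exp (- enn2real r) * enn2real r ^ k / fact k))) borel of_nat)"

lemma sets_poisson_law [simp, measurable_cong]: "sets (poisson_law r) = sets borel"
  by (simp add: poisson_law_def)

lemma nn_integral_poisson_law:
  assumes "r \<noteq> \<infinity>" and [measurable]: "f \<in> borel_measurable borel"
  shows "(\<integral>\<^sup>+x. f x \<partial>poisson_law r) =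
    (\<Sum>k. ennreal (exp (- enn2real r) * enn2real r ^ k / fact k) * f (of_nat k))"
  using assms(1) unfolding poisson_law_def
  by (simp add: nn_integral_distr nn_integral_density nn_integral_count_space_nat)

lemma poisson_weights_sums: "(\<lambda>k. exp (- x) * x ^ k / fact k) sums (1::real)"
proof -
  have "(\<lambda>k. exp (- x) * (x ^ k /\<^sub>R fact k)) sums (exp (- x) * exp x)"
    by (intro sums_mult exp_converges)
  then show ?thesis by (simp add: exp_minus divide_inverse mult_ac)
qed

lemma suminf_poisson_weights:
  assumes "0 \<le> (x::real)"
  shows "(\<Sum>k. ennreal (exp (- x) * x ^ k / fact k)) = 1"
  using poisson_weights_sums[of x] assms
  by (subst suminf_ennreal2) (auto simp: sums_iff)

lemma prob_space_poisson_law: "prob_space (poisson_law r)"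
proof (cases "r = \<infinity>")
  case True
  then show ?thesis by (simp add: poisson_law_def prob_space_return)
next
  case False
  have "emeasure (poisson_law r) (space (poisson_law r)) = (\<integral>\<^sup>+x. 1 \<partial>poisson_law r)"
    by simp
  also have "\<dots> = 1"
    using False suminf_poisson_weights[OF enn2real_nonneg, of r]
    by (subst nn_integral_poisson_law) simp_all
  finally show ?thesis by (rule prob_spaceI)
qed

text \<open>The weights satisfy \<open>(k + 1) w (k + 1) = r w k\<close>. This is the Stein-Chen
  identity, in other words the Mecke formula for a single count.\<close>

lemma nn_integral_poisson_law_shift:
  assumes "r \<noteq> \<infinity>" and f[measurable]: "f \<in> borel_measurable borel"
  shows "(\<integral>\<^sup>+x. x * f x \<partial>poisson_law r) = r * (\<integral>\<^sup>+x. f (x + 1) \<partial>poisson_law r)"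
proof -
  define w where "w k = exp (- enn2real r) * enn2real r ^ k / fact k" for k
  have r: "r = ennreal (enn2real r)" using assms(1) by (simp add: less_top)
  have w_Suc: "ennreal (w (Suc k)) * of_nat (Suc k) = r * ennreal (w k)" for k
  proof -
    have "w (Suc k) * real (Suc k) = enn2real r * w k"
      by (simp add: w_def field_simps del: of_nat_Suc)
    then have "ennreal (w (Suc k)) * of_nat (Suc k) = ennreal (enn2real r) * ennreal (w k)"
      by (simp add: ennreal_of_nat_eq_real_of_nat ennreal_mult[symmetric] w_def del: of_nat_Suc)
    then show ?thesis by (simp only: r[symmetric])
  qed
  have "(\<integral>\<^sup>+x. x * f x \<partial>poisson_law r) = (\<Sum>k. ennreal (w k) * (of_nat k * f (of_nat k)))"
    using assms(1) by (subst nn_integral_poisson_law) (auto simp: w_def)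
  \<comment> \<open>The term \<open>k = 0\<close> carries the factor 0 and drops out.\<close>
  also have "\<dots> = (\<Sum>k. ennreal (w (Suc k)) * (of_nat (Suc k) * f (of_nat (Suc k))))"
    by (subst suminf_offset[where i=1]) (simp_all del: of_nat_Suc)
  also have "\<dots> = (\<Sum>k. r * (ennreal (w k) * f (of_nat k + 1)))"
    by (simp add: mult.assoc[symmetric] w_Suc del: of_nat_Suc) (simp add: add.commute)
  also have "\<dots> = r * (\<Sum>k. ennreal (w k) * f (of_nat k + 1))"
    by simp
  also have "(\<Sum>k. ennreal (w k) * f (of_nat k + 1)) = (\<integral>\<^sup>+x. f (x + 1) \<partial>poisson_law r)"
    using assms(1) by (subst nn_integral_poisson_law) (auto simp: w_def)
  finally show ?thesis .
qed

lemma measurable_fun_upd_increment: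
  assumes "i \<in> J"
  shows "(\<lambda>x. x(i := x i + 1)) \<in>
    measurable (PiM J (\<lambda>_. borel)) (PiM J (\<lambda>_. borel :: ennreal measure))"
proof -
  have "(\<lambda>x. \<lambda>j\<in>J. if j = i then x j + 1 else x j) \<in>
      measurable (PiM J (\<lambda>_. borel)) (PiM J (\<lambda>_. borel :: ennreal measure))"
    by (intro measurable_restrict) auto
  then show ?thesis
    by (rule measurable_cong[THEN iffD1, rotated])
       (use assms in \<open>auto simp: space_PiM PiE_def extensional_def\<close>)
qed

text \<open>Fubini isolates coordinate \<open>i\<close>, to which the one-dimensional identity
  applies; the other rates may be infinite.\<close>

lemma nn_integral_PiM_poisson_law_shift:
  fixes r :: "'i \<Rightarrow> ennreal"
  assumes J: "finite J" "i \<in> J" and r: "r i \<noteq> \<infinity>"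
    and f[measurable]: "f \<in> borel_measurable (PiM J (\<lambda>_. borel))"
  shows "(\<integral>\<^sup>+x. x i * f x \<partial>PiM J (\<lambda>j. poisson_law (r j))) =
    r i * (\<integral>\<^sup>+x. f (x(i := x i + 1)) \<partial>PiM J (\<lambda>j. poisson_law (r j)))"
proof -
  interpret product_sigma_finite "\<lambda>j. poisson_law (r j)"
    by (rule product_sigma_finite.intro) (rule prob_space_imp_sigma_finite[OF prob_space_poisson_law])
  define K where "K = J - {i}"
  have K: "finite K" "i \<notin> K" "J = insert i K" using J by (auto simp: K_def)
  have f'[measurable]: "f \<in> borel_measurable (PiM (insert i K) (\<lambda>_. borel))"
    using f K(3) by simp
  have [measurable]: "(\<lambda>x. f (x(i := x i + 1))) \<in> borel_measurable (PiM (insert i K) (\<lambda>j. poisson_law (r j)))"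
    using measurable_compose[OF measurable_fun_upd_increment[of i "insert i K"] f'] by measurable
  have f2: "(\<lambda>x. f (y(i := x))) \<in> borel_measurable borel" if "y \<in> space (PiM K (\<lambda>_. borel))" for y
    using that by measurable
  have "(\<integral>\<^sup>+x. x i * f x \<partial>PiM J (\<lambda>j. poisson_law (r j))) =
      (\<integral>\<^sup>+y. \<integral>\<^sup>+x. x * f (y(i := x)) \<partial>poisson_law (r i) \<partial>PiM K (\<lambda>j. poisson_law (r j)))"
    unfolding K(3) using K(1,2) by (subst product_nn_integral_insert) auto
  also have "\<dots> = (\<integral>\<^sup>+y. r i * \<integral>\<^sup>+x. f (y(i := x + 1)) \<partial>poisson_law (r i) \<partial>PiM K (\<lambda>j. poisson_law (r j)))"
    using r by (intro nn_integral_cong nn_integral_poisson_law_shift f2)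
      (auto simp: space_PiM dest: sets_eq_imp_space_eq[OF sets_poisson_law, THEN eqset_imp_iff, THEN iffD1])
  also have "\<dots> = r i * (\<integral>\<^sup>+y. \<integral>\<^sup>+x. f (y(i := x + 1)) \<partial>poisson_law (r i) \<partial>PiM K (\<lambda>j. poisson_law (r j)))"
    by (rule nn_integral_cmult) measurable
  also have "(\<integral>\<^sup>+y. \<integral>\<^sup>+x. f (y(i := x + 1)) \<partial>poisson_law (r i) \<partial>PiM K (\<lambda>j. poisson_law (r j))) =
      (\<integral>\<^sup>+x. f (x(i := x i + 1)) \<partial>PiM J (\<lambda>j. poisson_law (r j)))"
    unfolding K(3) using K(1,2) by (subst product_nn_integral_insert) auto
  finally show ?thesis .
qed

text \<open>A Poisson count is defined through the probabilities of single integers. As these sum to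
  1, no mass is left for any other value.\<close>

lemma has_poisson_countD_AE:
  assumes "prob_space P" and [measurable]: "(\<lambda>N. emeasure N A) \<in> borel_measurable P"
    and "has_poisson_count P A r" "r \<noteq> \<infinity>"
  shows "AE N in P. \<exists>k. emeasure N A = of_nat k"
proof -
  interpret prob_space P by fact
  let ?E = "\<lambda>k. {N\<in>space P. emeasure N A = of_nat k}"
  have "emeasure P (\<Union>k. ?E k) = (\<Sum>k. emeasure P (?E k))"
    by (intro suminf_emeasure[symmetric]) (auto simp: disjoint_family_on_def)
  also have "\<dots> = (\<Sum>k. ennreal (exp (- enn2real r) * enn2real r ^ k / fact k))"
    using assms(3,4) by (simp add: has_poisson_count_def emeasure_eq_measure)
  also have "\<dots> = 1" by (rule suminf_poisson_weights) simp
  finally have "prob (\<Union>k. ?E k) = 1" by (simp add: emeasure_eq_measure)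
  then have "AE N in P. N \<in> (\<Union>k. ?E k)" by (subst (asm) prob_eq_1) auto
  then show ?thesis by auto
qed

text \<open>Turns the prescribed point probabilities into an identity of laws, the form to which
  product measures and the shift identity apply.\<close>

lemma distr_has_poisson_count:
  assumes "prob_space P" and [measurable]: "(\<lambda>N. emeasure N A) \<in> borel_measurable P"
    and "has_poisson_count P A r"
  shows "distr P borel (\<lambda>N. emeasure N A) = poisson_law r"
proof (cases "r = \<infinity>")
  case True
  interpret prob_space P by fact
  have "AE N in P. emeasure N A = \<infinity>" using assms(3) True by (simp add: has_poisson_count_def)
  then have "distr P borel (\<lambda>N. emeasure N A) = distr P borel (\<lambda>N. \<infinity>)"
    by (intro distr_cong_AE) auto
  then show ?thesis using True by (simp add: poisson_law_def distr_const)
next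
  case False
  interpret prob_space P by fact
  show ?thesis
  proof (rule measure_eqI)
    fix U assume "U \<in> sets (distr P borel (\<lambda>N. emeasure N A))"
    then have U[measurable]: "U \<in> sets borel" by simp
    let ?E = "\<lambda>k. {N\<in>space P. emeasure N A = of_nat k}"
    let ?F = "\<lambda>k. {N\<in>space P. emeasure N A = of_nat k \<and> of_nat k \<in> U}"
    have "emeasure (distr P borel (\<lambda>N. emeasure N A)) U = emeasure P {N\<in>space P. emeasure N A \<in> U}"
      by (subst emeasure_distr) (auto intro!: arg_cong[where f="emeasure P"])
    also have "\<dots> = emeasure P (\<Union>k. ?F k)"
      using has_poisson_countD_AE[OF assms False]
      by (intro emeasure_eq_AE) (auto elim!: eventually_mono)
    also have "\<dots> = (\<Sum>k. emeasure P (?F k))"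
      by (intro suminf_emeasure[symmetric]) (auto simp: disjoint_family_on_def)
    also have "\<dots> = (\<Sum>k. emeasure P (?E k) * indicator U (of_nat k))"
      by (intro suminf_cong) (auto simp: indicator_def)
    also have "\<dots> = (\<Sum>k. ennreal (exp (- enn2real r) * enn2real r ^ k / fact k) * indicator U (of_nat k))"
      using assms(3) False by (simp add: has_poisson_count_def emeasure_eq_measure)
    also have "\<dots> = (\<integral>\<^sup>+x. indicator U x \<partial>poisson_law r)"
      using False by (subst nn_integral_poisson_law) auto
    also have "\<dots> = emeasure (poisson_law r) U" by simp
    finally show "emeasure (distr P borel (\<lambda>N. emeasure N A)) U = emeasure (poisson_law r) U" .
  qed simp
qed

section \<open>Joint laws of disjoint counts, and uniqueness\<close>

context
  fixes \<nu> :: "'c measure" and P :: "'c measure measure"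
  assumes prm: "poisson_random_measure_law \<nu> P"
begin

lemma prm_law_sets: "sets P = sets (measure_algebra \<nu>)"
  and prm_law_prob_space: "prob_space P"
  and prm_law_count: "A \<in> sets \<nu> \<Longrightarrow> has_poisson_count P A (emeasure \<nu> A)"
  using prm by (auto simp: poisson_random_measure_law_def)

lemma prm_law_space: "space P = {N. sets N = sets \<nu>}"
  using sets_eq_imp_space_eq[OF prm_law_sets] by (simp add: space_measure_algebra)

lemma prm_law_measurable_emeasure: "A \<in> sets \<nu> \<Longrightarrow> (\<lambda>N. emeasure N A) \<in> borel_measurable P"
  by (subst measurable_cong_sets[OF prm_law_sets refl]) (rule measurable_emeasure_measure_algebra)

text \<open>Independence combined with the marginals. \<open>0 < k\<close> is there because the
  product characterisation of independence asks for a nonempty index set.\<close>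

lemma prm_law_distr_counts:
  fixes A :: "nat \<Rightarrow> 'c set"
  assumes "0 < k" "A ` {..<k} \<subseteq> sets \<nu>" "disjoint_family_on A {..<k}"
  shows "distr P (PiM {..<k} (\<lambda>_. borel)) (\<lambda>N. \<lambda>i\<in>{..<k}. emeasure N (A i)) =
    PiM {..<k} (\<lambda>i. poisson_law (emeasure \<nu> (A i)))"
proof -
  interpret prob_space P by (rule prm_law_prob_space)
  have "indep_vars (\<lambda>_. borel) (\<lambda>i N. emeasure N (A i)) {..<k}"
    using prm assms by (auto simp: poisson_random_measure_law_def)
  then have "distr P (PiM {..<k} (\<lambda>_. borel)) (\<lambda>N. \<lambda>i\<in>{..<k}. emeasure N (A i)) =
      PiM {..<k} (\<lambda>i. distr P borel (\<lambda>N. emeasure N (A i)))"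
    using assms by (subst (asm) indep_vars_iff_distr_eq_PiM')
      (auto intro!: prm_law_measurable_emeasure)
  also have "\<dots> = PiM {..<k} (\<lambda>i. poisson_law (emeasure \<nu> (A i)))"
    using assms by (intro PiM_cong refl distr_has_poisson_count prm_law_count
        prm_law_prob_space prm_law_measurable_emeasure) auto
  finally show ?thesis .
qed

lemma nn_integral_prm_law_counts:
  fixes A :: "nat \<Rightarrow> 'c set"
  assumes "0 < k" "A ` {..<k} \<subseteq> sets \<nu>" "disjoint_family_on A {..<k}"
    and f[measurable]: "f \<in> borel_measurable (PiM {..<k} (\<lambda>_. borel))"
  shows "(\<integral>\<^sup>+N. f (\<lambda>i\<in>{..<k}. emeasure N (A i)) \<partial>P) =
    (\<integral>\<^sup>+x. f x \<partial>PiM {..<k} (\<lambda>i. poisson_law (emeasure \<nu> (A i))))"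
  unfolding prm_law_distr_counts[OF assms(1-3), symmetric] using assms(2)
  by (subst nn_integral_distr)
     (auto intro!: measurable_restrict prm_law_measurable_emeasure)

end

text \<open>Both laws give the counts of disjoint sets the same product of Poisson laws. There is no
  distinguished set to refine, hence the empty set for \<open>B0\<close>.\<close>

lemma prm_law_unique:
  assumes P: "poisson_random_measure_law \<nu> P" and Q: "poisson_random_measure_law \<nu> Q"
  shows "P = Q"
proof (rule measure_algebra_eqI[where M=\<nu> and ?B0.0="{}"])
  interpret P: prob_space P by (rule prm_law_prob_space[OF P])
  show "emeasure P (space P) \<noteq> \<infinity>" by simp
  fix k :: nat and A I H
  assume A: "0 < k" "A ` {..<k} \<subseteq> sets \<nu>" "disjoint_family_on A {..<k}"
    and H: "H \<in> sets (PiM {..<k} (\<lambda>_. borel :: ennreal measure))"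
  have "emeasure R {N\<in>space P. (\<lambda>i\<in>{..<k}. emeasure N (A i)) \<in> H} =
      emeasure (PiM {..<k} (\<lambda>i. poisson_law (emeasure \<nu> (A i)))) H"
    if R: "poisson_random_measure_law \<nu> R" for R
  proof -
    have "space P = space R" using prm_law_space P R by metis
    moreover have "(\<lambda>N. \<lambda>i\<in>{..<k}. emeasure N (A i)) \<in> measurable R (PiM {..<k} (\<lambda>_. borel))"
      using A by (auto intro!: measurable_restrict prm_law_measurable_emeasure[OF R])
    ultimately show ?thesis
      unfolding prm_law_distr_counts[OF R A, symmetric] using H
      by (subst emeasure_distr) (auto intro!: arg_cong[where f="emeasure R"])
  qed
  then show "emeasure P {N\<in>space P. (\<lambda>i\<in>{..<k}. emeasure N (A i)) \<in> H} =
      emeasure Q {N\<in>space P. (\<lambda>i\<in>{..<k}. emeasure N (A i)) \<in> H}"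
    using P Q by simp
qed (use P Q in \<open>auto simp: poisson_random_measure_law_def\<close>)

text \<open>Uniqueness resolves the definite description: to identify \<open>prm\<close> it is
  enough to exhibit one law with the defining properties.\<close>

lemma prm_eqI: "poisson_random_measure_law (intensity \<rho> \<eta>) P \<Longrightarrow> prm \<rho> \<eta> = P"
  unfolding prm_def by (rule the_equality) (auto intro: prm_law_unique)

section \<open>The Mecke formula for a Poisson random measure\<close>

abbreviation add_point :: "'c measure \<Rightarrow> 'c \<Rightarrow> 'c measure" where
  "add_point N z \<equiv> add_points N {()} (\<lambda>_. z)"

text \<open>The Mecke equation for product functionals \<open>f x * G N\<close>. These suffice both
  for the iteration and for the converse, and avoid functionals of a point and a measure
  jointly.\<close>

definition mecke :: "'c measure \<Rightarrow> 'c measure measure \<Rightarrow> bool" where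
  "mecke \<nu> P \<longleftrightarrow> (\<forall>f\<in>borel_measurable \<nu>. \<forall>G\<in>borel_measurable (measure_algebra \<nu>).
     (\<integral>\<^sup>+N. (\<integral>\<^sup>+x. f x \<partial>N) * G N \<partial>P) = (\<integral>\<^sup>+z. f z * (\<integral>\<^sup>+N. G (add_point N z) \<partial>P) \<partial>\<nu>))"

text \<open>As functionals of \<open>G\<close> the two sides are integrals against
  \<open>Q1\<close>, the law \<open>P\<close> weighted by \<open>N(B)\<close>, and
  \<open>Q2\<close>, the image of \<open>N + \<delta>_z\<close> where \<open>z\<close> follows
  \<open>\<nu>\<close> restricted to \<open>B\<close> and is independent of \<open>N\<close>. Since
  \<open>Q1\<close> has the finite mass \<open>\<nu>(B)\<close>, it is enough to compare the two on
  count vectors of disjoint sets that refine \<open>B\<close>.\<close>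

lemma prm_law_mecke_set:
  assumes prm: "poisson_random_measure_law \<nu> P" and B[measurable]: "B \<in> sets \<nu>"
    and fin: "emeasure \<nu> B \<noteq> \<infinity>" and G: "G \<in> borel_measurable (measure_algebra \<nu>)"
  shows "(\<integral>\<^sup>+N. emeasure N B * G N \<partial>P) =
    (\<integral>\<^sup>+z. indicator B z * (\<integral>\<^sup>+N. G (add_point N z) \<partial>P) \<partial>\<nu>)"
proof -
  interpret P: prob_space P by (rule prm_law_prob_space[OF prm])
  note [measurable_cong] = prm_law_sets[OF prm]
  note [measurable] = prm_law_measurable_emeasure[OF prm] G
  define Q1 where "Q1 = density P (\<lambda>N. emeasure N B)"
  define \<nu>B where "\<nu>B = density \<nu> (indicator B)"
  have [measurable_cong]: "sets \<nu>B = sets \<nu>" by (simp add: \<nu>B_def)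
  define Q2 where "Q2 = distr (\<nu>B \<Otimes>\<^sub>M P) (measure_algebra \<nu>) (\<lambda>(z, N). add_point N z)"
  have [measurable]: "(\<lambda>(z, N). add_point N z) \<in> measurable (\<nu> \<Otimes>\<^sub>M P) (measure_algebra \<nu>)"
    by measurable
  have Q2: "(\<integral>\<^sup>+N. g N \<partial>Q2) = (\<integral>\<^sup>+z. indicator B z * (\<integral>\<^sup>+N. g (add_point N z) \<partial>P) \<partial>\<nu>)"
    if [measurable]: "g \<in> borel_measurable (measure_algebra \<nu>)" for g
  proof -
    have "(\<integral>\<^sup>+N. g N \<partial>Q2) = (\<integral>\<^sup>+x. g (case x of (z, N) \<Rightarrow> add_point N z) \<partial>(\<nu>B \<Otimes>\<^sub>M P))"
      unfolding Q2_def by (subst nn_integral_distr) auto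
    also have "\<dots> = (\<integral>\<^sup>+z. (\<integral>\<^sup>+N. g (add_point N z) \<partial>P) \<partial>\<nu>B)"
      by (subst P.nn_integral_fst[symmetric]) auto
    also have "\<dots> = (\<integral>\<^sup>+z. indicator B z * (\<integral>\<^sup>+N. g (add_point N z) \<partial>P) \<partial>\<nu>)"
      unfolding \<nu>B_def by (subst nn_integral_density) auto
    finally show ?thesis .
  qed
  have "Q1 = Q2"
  proof (rule measure_algebra_eqI[OF _ _ _ B])
    show "sets Q1 = sets (measure_algebra \<nu>)" by (simp add: Q1_def prm_law_sets[OF prm])
    show "sets Q2 = sets (measure_algebra \<nu>)" by (simp add: Q2_def)
    have "emeasure Q1 (space Q1) = (\<integral>\<^sup>+N. emeasure N B \<partial>P)"
      by (simp add: Q1_def emeasure_density cong: nn_integral_cong)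
    also have "\<dots> = (\<integral>\<^sup>+x. x * 1 \<partial>distr P borel (\<lambda>N. emeasure N B))"
      by (subst nn_integral_distr) auto
    also have "\<dots> = (\<integral>\<^sup>+x. x * 1 \<partial>poisson_law (emeasure \<nu> B))"
      by (subst distr_has_poisson_count[OF P.prob_space_axioms _ prm_law_count[OF prm B]]) auto
    also have "\<dots> = emeasure \<nu> B"
      using fin prob_space.emeasure_space_1[OF prob_space_poisson_law]
      by (subst nn_integral_poisson_law_shift) auto
    finally show "emeasure Q1 (space Q1) \<noteq> \<infinity>" using fin by simp
  next
    fix k :: nat and A I H
    assume A: "0 < k" "A ` {..<k} \<subseteq> sets \<nu>" "disjoint_family_on A {..<k}"
      and I: "I \<subseteq> {..<k}" "B = (\<Union>i\<in>I. A i)"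
      and H[measurable]: "H \<in> sets (PiM {..<k} (\<lambda>_. borel :: ennreal measure))"
    let ?X = "\<lambda>N. \<lambda>i\<in>{..<k}. emeasure N (A i)"
    let ?\<Pi> = "PiM {..<k} (\<lambda>i. poisson_law (emeasure \<nu> (A i)))"
    have [simp]: "finite I" using I finite_subset by blast
    have [measurable]: "A i \<in> sets \<nu>" if "i \<in> {..<k}" for i using A that by auto
    have [measurable]: "?X \<in> measurable (measure_algebra \<nu>) (PiM {..<k} (\<lambda>_. borel))"
      by (intro measurable_restrict) simp
    have dI: "disjoint_family_on A I" using A(3) I by (auto simp: disjoint_family_on_def)
    let ?S = "{N\<in>space P. ?X N \<in> H}"
    have sp: "space Q1 = space P" by (simp add: Q1_def)
    have S: "?S \<in> sets (measure_algebra \<nu>)"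
      using sets_eq_imp_space_eq[OF prm_law_sets[OF prm]] by simp
    have indS: "indicator ?S N = indicator H (?X N)" if "N \<in> space P" for N
      using that by (simp add: indicator_def)
    have Nsum: "emeasure N B = (\<Sum>i\<in>I. emeasure N (A i))" if "N \<in> space P" for N
      unfolding I(2) using that A I dI
      by (intro sum_emeasure[symmetric]) (auto simp: prm_law_space[OF prm])
    \<comment> \<open>The shift identity needs a finite rate for each atom of
      \<open>B\<close>.\<close>
    have finA: "emeasure \<nu> (A i) \<noteq> \<infinity>" if "i \<in> I" for i
    proof -
      have "emeasure \<nu> (A i) \<le> emeasure \<nu> B" using that B by (intro emeasure_mono) (auto simp: I(2))
      then show ?thesis using fin by (auto simp: top_unique)
    qed
    have "emeasure Q1 ?S = (\<integral>\<^sup>+N. emeasure N B * indicator ?S N \<partial>P)"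
      unfolding Q1_def using S by (subst emeasure_density) (auto simp: prm_law_sets[OF prm])
    also have "\<dots> = (\<integral>\<^sup>+N. (\<Sum>i\<in>I. ?X N i * indicator H (?X N)) \<partial>P)"
    proof (rule nn_integral_cong)
      fix N assume N: "N \<in> space P"
      show "emeasure N B * indicator ?S N = (\<Sum>i\<in>I. ?X N i * indicator H (?X N))"
        unfolding Nsum[OF N] indS[OF N] sum_distrib_right using I by (intro sum.cong) auto
    qed
    also have "\<dots> = (\<Sum>i\<in>I. \<integral>\<^sup>+N. ?X N i * indicator H (?X N) \<partial>P)"
      using I by (intro nn_integral_sum) auto
    also have "\<dots> = (\<Sum>i\<in>I. \<integral>\<^sup>+x. x i * indicator H x \<partial>?\<Pi>)"
      using I by (intro sum.cong refl nn_integral_prm_law_counts[OF prm A, where f="\<lambda>x. x _ * indicator H x"]) auto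
    \<comment> \<open>\<open>N(B)\<close> has been split into the counts \<open>x i\<close> of its
      atoms; each of them is removed by the shift identity in its own coordinate.\<close>
    also have "\<dots> = (\<Sum>i\<in>I. emeasure \<nu> (A i) * \<integral>\<^sup>+x. indicator H (x(i := x i + 1)) \<partial>?\<Pi>)"
      using I finA by (intro sum.cong refl nn_integral_PiM_poisson_law_shift) auto
    also have "\<dots> = (\<Sum>i\<in>I. \<integral>\<^sup>+z. indicator (A i) z * (\<integral>\<^sup>+N. indicator ?S (add_point N z) \<partial>P) \<partial>\<nu>)"
    proof (rule sum.cong[OF refl])
      fix i assume i: "i \<in> I"
      then have ik: "i < k" using I by auto
      note [measurable] = measurable_fun_upd_increment[of i "{..<k}"]
      have "emeasure \<nu> (A i) * (\<integral>\<^sup>+x. indicator H (x(i := x i + 1)) \<partial>?\<Pi>) =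
          (\<integral>\<^sup>+z. indicator (A i) z * (\<integral>\<^sup>+x. indicator H (x(i := x i + 1)) \<partial>?\<Pi>) \<partial>\<nu>)"
        using ik by (subst nn_integral_multc) auto
      also have "\<dots> = (\<integral>\<^sup>+z. indicator (A i) z * (\<integral>\<^sup>+N. indicator ?S (add_point N z) \<partial>P) \<partial>\<nu>)"
      proof (rule nn_integral_cong)
        fix z assume "z \<in> space \<nu>"
        show "indicator (A i) z * (\<integral>\<^sup>+x. indicator H (x(i := x i + 1)) \<partial>?\<Pi>) =
            indicator (A i) z * (\<integral>\<^sup>+N. indicator ?S (add_point N z) \<partial>P)"
        proof (cases "z \<in> A i")
          case True
          have "(\<integral>\<^sup>+x. indicator H (x(i := x i + 1)) \<partial>?\<Pi>) = (\<integral>\<^sup>+N. indicator H ((?X N)(i := ?X N i + 1)) \<partial>P)"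
            using ik measurable_compose[OF measurable_fun_upd_increment borel_measurable_indicator[OF H]]
            by (intro nn_integral_prm_law_counts[OF prm A, symmetric, where f="\<lambda>x. indicator H (x(i := x i + 1))"]) auto
          also have "\<dots> = (\<integral>\<^sup>+N. indicator ?S (add_point N z) \<partial>P)"
          proof (rule nn_integral_cong)
            fix N assume N: "N \<in> space P"
            then have aN: "add_point N z \<in> space P" by (simp add: prm_law_space[OF prm])
            \<comment> \<open>By disjointness a point \<open>z\<close> of \<open>A i\<close> raises
              coordinate \<open>i\<close> by one and no other: shifting the Poisson vector amounts
              to adding a point.\<close>
            have "?X (add_point N z) = (?X N)(i := ?X N i + 1)"
            proof (rule ext)
              fix j
              have "z \<notin> A j" if "j < k" "j \<noteq> i"
                using disjoint_family_onD[OF A(3), of j i] that ik True by auto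
              then show "?X (add_point N z) j = ((?X N)(i := ?X N i + 1)) j"
                using N A(2) True ik
                by (auto simp: prm_law_space[OF prm] emeasure_add_points indicator_def)
            qed
            then show "indicator H ((?X N)(i := ?X N i + 1)) = indicator ?S (add_point N z)"
              using aN by (simp add: indicator_def)
          qed
          finally show ?thesis by simp
        qed simp
      qed
      finally show "emeasure \<nu> (A i) * (\<integral>\<^sup>+x. indicator H (x(i := x i + 1)) \<partial>?\<Pi>) =
          (\<integral>\<^sup>+z. indicator (A i) z * (\<integral>\<^sup>+N. indicator ?S (add_point N z) \<partial>P) \<partial>\<nu>)" .
    qed
    also have "\<dots> = (\<integral>\<^sup>+z. (\<Sum>i\<in>I. indicator (A i) z * (\<integral>\<^sup>+N. indicator ?S (add_point N z) \<partial>P)) \<partial>\<nu>)"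
      using I S by (intro nn_integral_sum[symmetric]) auto
    also have "\<dots> = (\<integral>\<^sup>+z. indicator B z * (\<integral>\<^sup>+N. indicator ?S (add_point N z) \<partial>P) \<partial>\<nu>)"
      using dI by (simp add: I(2) indicator_UN_disjoint sum_distrib_right)
    also have "\<dots> = (\<integral>\<^sup>+N. indicator ?S N \<partial>Q2)"
      using S by (subst Q2) auto
    also have "\<dots> = emeasure Q2 ?S"
      using S by (simp add: Q2_def)
    finally show "emeasure Q1 {N\<in>space Q1. ?X N \<in> H} = emeasure Q2 {N\<in>space Q1. ?X N \<in> H}"
      unfolding sp .
  qed
  have "(\<integral>\<^sup>+N. emeasure N B * G N \<partial>P) = (\<integral>\<^sup>+N. G N \<partial>Q1)"
    unfolding Q1_def by (subst nn_integral_density) auto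
  also have "\<dots> = (\<integral>\<^sup>+z. indicator B z * (\<integral>\<^sup>+N. G (add_point N z) \<partial>P) \<partial>\<nu>)"
    unfolding \<open>Q1 = Q2\<close> by (rule Q2[OF G])
  finally show ?thesis .
qed

text \<open>A disjoint exhaustion by sets of finite intensity extends the formula to every
  \<open>B\<close>, including those of infinite intensity; monotone approximation then reaches every
  \<open>f\<close>.\<close>

lemma prm_law_mecke:
  assumes prm: "poisson_random_measure_law \<nu> P" and "sigma_finite_measure \<nu>"
  shows "mecke \<nu> P"
  unfolding mecke_def
proof (intro ballI)
  interpret \<nu>: sigma_finite_measure \<nu> by fact
  interpret P: prob_space P by (rule prm_law_prob_space[OF prm])
  note [measurable_cong] = prm_law_sets[OF prm]
  note [measurable] = prm_law_measurable_emeasure[OF prm]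
  note space_P = prm_law_space[OF prm]
  fix f :: "'a \<Rightarrow> ennreal" and G :: "'a measure \<Rightarrow> ennreal"
  assume f: "f \<in> borel_measurable \<nu>" and G[measurable]: "G \<in> borel_measurable (measure_algebra \<nu>)"
  define g where "g z = (\<integral>\<^sup>+N. G (add_point N z) \<partial>P)" for z
  have g[measurable]: "g \<in> borel_measurable \<nu>" unfolding g_def by measurable
  have nn_meas: "(\<lambda>N. \<integral>\<^sup>+x. u x \<partial>N) \<in> borel_measurable P" if "u \<in> borel_measurable \<nu>" for u
    by (subst measurable_cong_sets[OF prm_law_sets[OF prm] refl])
       (rule borel_measurable_nn_integral_measure_algebra[OF that])
  have u_meas: "u \<in> borel_measurable N" if "u \<in> borel_measurable \<nu>" "N \<in> space P"
    for u :: "'a \<Rightarrow> ennreal" and N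
    using that by (simp add: space_P cong: measurable_cong_sets)
  have set_case: "(\<integral>\<^sup>+N. emeasure N B * G N \<partial>P) = (\<integral>\<^sup>+z. indicator B z * g z \<partial>\<nu>)"
    if B[measurable]: "B \<in> sets \<nu>" for B
  proof -
    obtain D :: "nat \<Rightarrow> _" where D: "range D \<subseteq> sets \<nu>" "(\<Union>i. D i) = space \<nu>"
        "\<And>i. emeasure \<nu> (D i) \<noteq> \<infinity>" "disjoint_family D"
      using \<nu>.sigma_finite_disjoint by metis
    have [measurable]: "D i \<in> sets \<nu>" for i using D by auto
    have B_eq: "B = (\<Union>i. B \<inter> D i)" using D(2) sets.sets_into_space[OF B] by blast
    have dis: "disjoint_family (\<lambda>i. B \<inter> D i)" using D(4) by (auto simp: disjoint_family_on_def)
    have fin: "emeasure \<nu> (B \<inter> D i) \<noteq> \<infinity>" for i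
      using emeasure_mono[of "B \<inter> D i" "D i" \<nu>] D(3)[of i] by (auto simp: top_unique)
    have "(\<integral>\<^sup>+N. emeasure N B * G N \<partial>P) = (\<integral>\<^sup>+N. (\<Sum>i. emeasure N (B \<inter> D i) * G N) \<partial>P)"
    proof (rule nn_integral_cong)
      fix N assume "N \<in> space P"
      then have sN: "sets N = sets \<nu>" by (simp add: space_P)
      have "range (\<lambda>i. B \<inter> D i) \<subseteq> sets N" unfolding sN using B D(1) by blast
      from suminf_emeasure[OF this dis]
      have "emeasure N B = (\<Sum>i. emeasure N (B \<inter> D i))" by (simp only: B_eq[symmetric])
      then show "emeasure N B * G N = (\<Sum>i. emeasure N (B \<inter> D i) * G N)" by simp
    qed
    also have "\<dots> = (\<Sum>i. \<integral>\<^sup>+N. emeasure N (B \<inter> D i) * G N \<partial>P)"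
      by (intro nn_integral_suminf) auto
    also have "\<dots> = (\<Sum>i. \<integral>\<^sup>+z. indicator (B \<inter> D i) z * g z \<partial>\<nu>)"
      unfolding g_def by (intro suminf_cong prm_law_mecke_set[OF prm] fin) auto
    also have "\<dots> = (\<integral>\<^sup>+z. (\<Sum>i. indicator (B \<inter> D i) z * g z) \<partial>\<nu>)"
      by (intro nn_integral_suminf[symmetric]) auto
    also have "\<dots> = (\<integral>\<^sup>+z. indicator B z * g z \<partial>\<nu>)"
    proof (rule nn_integral_cong)
      fix z
      have "(\<Sum>i. indicator (B \<inter> D i) z * g z) = (\<Sum>i. indicator (B \<inter> D i) z) * g z" by simp
      also have "(\<Sum>i. indicator (B \<inter> D i) z) = (indicator B z :: ennreal)"
        using suminf_indicator[OF dis, of z] by (simp only: B_eq[symmetric])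
      finally show "(\<Sum>i. indicator (B \<inter> D i) z * g z) = indicator B z * g z" .
    qed
    finally show ?thesis .
  qed
  have GP: "(\<lambda>N. (\<integral>\<^sup>+x. u x \<partial>N) * G N) \<in> borel_measurable P" if "u \<in> borel_measurable \<nu>" for u
    using nn_meas[OF that] by measurable
  show "(\<integral>\<^sup>+N. (\<integral>\<^sup>+x. f x \<partial>N) * G N \<partial>P) = (\<integral>\<^sup>+z. f z * (\<integral>\<^sup>+N. G (add_point N z) \<partial>P) \<partial>\<nu>)"
    unfolding g_def[symmetric] using f
  proof induct
    case (cong u v)
    have "(\<integral>\<^sup>+x. u x \<partial>N) = (\<integral>\<^sup>+x. v x \<partial>N)" if "N \<in> space P" for N
      using cong(3) that by (intro nn_integral_cong) (auto simp: space_P dest: sets_eq_imp_space_eq)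
    with cong show ?case by (simp cong: nn_integral_cong)
  next
    case (set B)
    have "(\<integral>\<^sup>+N. (\<integral>\<^sup>+x. indicator B x \<partial>N) * G N \<partial>P) = (\<integral>\<^sup>+N. emeasure N B * G N \<partial>P)"
      using set by (intro nn_integral_cong) (simp add: space_P)
    with set_case[OF set(1)] show ?case by simp
  next
    case (mult u c)
    then show ?case
      by (simp add: nn_integral_cmult u_meas GP mult.assoc cong: nn_integral_cong)
  next
    case (add u v)
    then show ?case
      by (simp add: nn_integral_add u_meas GP distrib_right cong: nn_integral_cong)
  next
    case (seq U)
    have inc: "incseq (\<lambda>i. U i x)" for x using seq(4) by (auto simp: incseq_def le_fun_def)
    have "(\<integral>\<^sup>+N. (\<integral>\<^sup>+x. (SUP i. U i) x \<partial>N) * G N \<partial>P) =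
        (\<integral>\<^sup>+N. (SUP i. (\<integral>\<^sup>+x. U i x \<partial>N) * G N) \<partial>P)"
    proof (rule nn_integral_cong)
      fix N assume "N \<in> space P"
      then show "(\<integral>\<^sup>+x. (SUP i. U i) x \<partial>N) * G N = (SUP i. (\<integral>\<^sup>+x. U i x \<partial>N) * G N)"
        unfolding SUP_apply using seq
        by (subst nn_integral_monotone_convergence_SUP) (auto simp: u_meas SUP_mult_right_ennreal)
    qed
    also have "\<dots> = (SUP i. \<integral>\<^sup>+N. (\<integral>\<^sup>+x. U i x \<partial>N) * G N \<partial>P)"
      using seq nn_meas inc by (intro nn_integral_monotone_convergence_SUP)
        (auto simp: incseq_def le_fun_def intro!: mult_right_mono nn_integral_mono)
    also have "\<dots> = (SUP i. \<integral>\<^sup>+z. U i z * g z \<partial>\<nu>)" using seq by simp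
    also have "\<dots> = (\<integral>\<^sup>+z. (SUP i. U i z * g z) \<partial>\<nu>)"
      using seq inc by (intro nn_integral_monotone_convergence_SUP[symmetric])
        (auto simp: incseq_def le_fun_def intro!: mult_right_mono)
    also have "\<dots> = (\<integral>\<^sup>+z. (SUP i. U i) z * g z \<partial>\<nu>)"
      by (simp add: SUP_mult_right_ennreal SUP_apply image_comp)
    finally show ?case .
  qed
qed

section \<open>Recovering the Poisson law from the Mecke formula\<close>

lemma sets_Collect_emeasure:
  assumes "sets Q = sets (measure_algebra \<nu>)" "A \<in> sets \<nu>" "U \<in> sets borel"
  shows "{N\<in>space Q. emeasure N A \<in> U} \<in> sets Q"
  using assms by (intro sets_Collect_mem[where L=borel])
    (auto simp: measurable_cong_sets[OF assms(1) refl] intro: measurable_emeasure_measure_algebra)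

text \<open>The identity \<open>k Q(N(A) = k, E) = \<nu>(A) Q(N(A) = k - 1, E)\<close> comes from the Mecke formula
  with \<open>f = 1\<^sub>A\<close>, and it forces the Poisson weights.\<close>

lemma mecke_count_inter:
  assumes "prob_space Q" and sets_Q: "sets Q = sets (measure_algebra \<nu>)" and mecke: "mecke \<nu> Q"
    and A[measurable]: "A \<in> sets \<nu>" and fin: "emeasure \<nu> A \<noteq> \<infinity>"
    and count: "AE N in Q. \<exists>k. emeasure N A = of_nat k"
    and E[measurable]: "E \<in> sets Q"
    and inv: "\<And>N z. N \<in> space Q \<Longrightarrow> z \<in> A \<Longrightarrow> add_point N z \<in> E \<longleftrightarrow> N \<in> E"
  shows "measure Q ({N\<in>space Q. emeasure N A = of_nat k} \<inter> E) =
    exp (- measure \<nu> A) * measure \<nu> A ^ k / fact k * measure Q E"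
proof -
  interpret prob_space Q by fact
  note [measurable_cong] = sets_Q
  have space_Q: "space Q = {N. sets N = sets \<nu>}"
    using sets_eq_imp_space_eq[OF sets_Q] by (simp add: space_measure_algebra)
  let ?r = "measure \<nu> A"
  let ?S = "\<lambda>k. {N\<in>space Q. emeasure N A = of_nat k} \<inter> E"
  have S[measurable]: "?S k \<in> sets Q" for k
    using sets_Collect_emeasure[OF sets_Q A, of "{of_nat k}"] by auto
  have rec: "real (Suc k) * prob (?S (Suc k)) = ?r * prob (?S k)" for k
  proof -
    have mS: "indicator (?S (Suc k)) \<in> borel_measurable (measure_algebra \<nu>)"
      using S[of "Suc k"] sets_Q by (intro borel_measurable_indicator) simp
    have "ennreal (real (Suc k) * prob (?S (Suc k))) = of_nat (Suc k) * emeasure Q (?S (Suc k))"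
      by (simp add: emeasure_eq_measure ennreal_mult ennreal_of_nat_eq_real_of_nat del: of_nat_Suc)
    also have "\<dots> = (\<integral>\<^sup>+N. of_nat (Suc k) * indicator (?S (Suc k)) N \<partial>Q)"
      by (subst nn_integral_cmult_indicator) auto
    also have "\<dots> = (\<integral>\<^sup>+N. (\<integral>\<^sup>+x. indicator A x \<partial>N) * indicator (?S (Suc k)) N \<partial>Q)"
    proof (rule nn_integral_cong)
      fix N assume "N \<in> space Q"
      then have "(\<integral>\<^sup>+x. indicator A x \<partial>N) = emeasure N A" by (simp add: space_Q)
      then show "of_nat (Suc k) * indicator (?S (Suc k)) N =
          (\<integral>\<^sup>+x. indicator A x \<partial>N) * indicator (?S (Suc k)) N"
        by (cases "N \<in> ?S (Suc k)") auto
    qed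
    also have "\<dots> = (\<integral>\<^sup>+z. indicator A z * (\<integral>\<^sup>+N. indicator (?S (Suc k)) (add_point N z) \<partial>Q) \<partial>\<nu>)"
      using mecke mS A unfolding mecke_def by (intro mecke[unfolded mecke_def, rule_format]) auto
    also have "\<dots> = (\<integral>\<^sup>+z. indicator A z * emeasure Q (?S k) \<partial>\<nu>)"
    proof (rule nn_integral_cong)
      fix z
      have "(\<integral>\<^sup>+N. indicator (?S (Suc k)) (add_point N z) \<partial>Q) = (\<integral>\<^sup>+N. indicator (?S k) N \<partial>Q)" if z: "z \<in> A"
      proof (rule nn_integral_cong)
        fix N assume N: "N \<in> space Q"
        \<comment> \<open>A point added inside \<open>A\<close> raises its count by one and, by
          \<open>inv\<close>, does not affect membership in \<open>E\<close>; so slice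
          \<open>k + 1\<close> is pulled back to slice \<open>k\<close>.\<close>
        have "emeasure (add_point N z) A = of_nat (Suc k) \<longleftrightarrow> emeasure N A = of_nat k"
          using N z
          by (simp add: space_Q emeasure_add_points add.commute[of 1])
        then show "indicator (?S (Suc k)) (add_point N z) = (indicator (?S k) N :: ennreal)"
          using N inv[OF N z] by (simp add: space_Q indicator_def)
      qed
      then show "indicator A z * (\<integral>\<^sup>+N. indicator (?S (Suc k)) (add_point N z) \<partial>Q) =
          indicator A z * emeasure Q (?S k)"
        by (cases "z \<in> A") auto
    qed
    also have "\<dots> = emeasure \<nu> A * emeasure Q (?S k)"
      by (subst nn_integral_multc) auto
    also have "\<dots> = ennreal (?r * prob (?S k))"
      using fin by (simp add: emeasure_eq_measure emeasure_eq_ennreal_measure ennreal_mult)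
    finally show ?thesis by (subst (asm) ennreal_inj) auto
  qed
  have S_eq: "prob (?S k) = ?r ^ k / fact k * prob (?S 0)" for k
  proof (induct k)
    case (Suc k)
    have "prob (?S (Suc k)) = ?r * prob (?S k) / real (Suc k)"
      using rec[of k] by (simp add: field_simps del: of_nat_Suc)
    then show ?case unfolding Suc by (simp add: field_simps)
  qed simp
  \<comment> \<open>Counts are almost surely integers, so the slices exhaust \<open>E\<close>.
    Summing \<open>r^k / k!\<close> determines slice 0 and thereby the normalising factor
    \<open>exp (- r)\<close>.\<close>
  have "prob E = prob (\<Union>k. ?S k)"
    using count by (intro measure_eq_AE) (auto elim!: eventually_mono dest: sets.sets_into_space[OF E, THEN subsetD])
  moreover have "(\<lambda>k. prob (?S k)) sums prob (\<Union>k. ?S k)"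
    by (intro finite_measure_UNION) (auto simp: disjoint_family_on_def)
  ultimately have "(\<lambda>k. ?r ^ k / fact k * prob (?S 0)) sums prob E"
    unfolding S_eq[symmetric] by simp
  moreover have "(\<lambda>k. ?r ^ k / fact k * prob (?S 0)) sums (exp ?r * prob (?S 0))"
    using exp_converges[of ?r] by (intro sums_mult2) (simp add: divide_inverse mult.commute)
  ultimately have "prob E = exp ?r * prob (?S 0)" by (rule sums_unique2)
  then have "prob (?S 0) = exp (- ?r) * prob E" by (simp add: exp_minus)
  then show ?thesis by (simp add: S_eq[of k])
qed

text \<open>Within every event insensitive to points of \<open>A\<close>, the count of
  \<open>A\<close> has the same Poisson weights, hence the event \<open>U\<close> contributes a
  factor \<open>c\<close> common to all such events. Taking the whole space as the event identifies
  \<open>c\<close>. For infinite intensity the count is almost surely constant and independence is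
  immediate.\<close>

lemma mecke_event_indep:
  assumes Q: "prob_space Q" and sets_Q: "sets Q = sets (measure_algebra \<nu>)" and mecke: "mecke \<nu> Q"
    and A[measurable]: "A \<in> sets \<nu>"
    and count: "emeasure \<nu> A \<noteq> \<infinity> \<Longrightarrow> AE N in Q. \<exists>k. emeasure N A = of_nat k"
    and inf: "emeasure \<nu> A = \<infinity> \<Longrightarrow> AE N in Q. emeasure N A = \<infinity>"
    and E[measurable]: "E \<in> sets Q"
    and inv: "\<And>N z. N \<in> space Q \<Longrightarrow> z \<in> A \<Longrightarrow> add_point N z \<in> E \<longleftrightarrow> N \<in> E"
    and U: "U \<in> sets borel"
  shows "measure Q ({N\<in>space Q. emeasure N A \<in> U} \<inter> E) =
    measure Q {N\<in>space Q. emeasure N A \<in> U} * measure Q E"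
proof (cases "emeasure \<nu> A = \<infinity>")
  case True
  interpret prob_space Q by fact
  have [measurable]: "{N\<in>space Q. emeasure N A \<in> U} \<in> sets Q"
    by (rule sets_Collect_emeasure[OF sets_Q A U])
  show ?thesis
  proof (cases "\<infinity> \<in> U")
    case U: True
    have "prob ({N\<in>space Q. emeasure N A \<in> U} \<inter> E) = prob E"
      using inf[OF True] U by (intro measure_eq_AE) (auto elim!: eventually_mono dest: sets.sets_into_space[OF E, THEN subsetD])
    moreover have "prob {N\<in>space Q. emeasure N A \<in> U} = prob (space Q)"
      using inf[OF True] U by (intro measure_eq_AE) (auto elim!: eventually_mono)
    ultimately show ?thesis by (simp add: prob_space)
  next
    case U: False
    have "prob ({N\<in>space Q. emeasure N A \<in> U} \<inter> E) = prob {}"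
      using inf[OF True] U by (intro measure_eq_AE) (auto elim!: eventually_mono)
    moreover have "prob {N\<in>space Q. emeasure N A \<in> U} = prob {}"
      using inf[OF True] U by (intro measure_eq_AE) (auto elim!: eventually_mono)
    ultimately show ?thesis by simp
  qed
next
  case False
  interpret prob_space Q by fact
  have mU: "{N\<in>space Q. emeasure N A \<in> U} \<in> sets Q"
    by (rule sets_Collect_emeasure[OF sets_Q A U])
  define w where "w k = exp (- measure \<nu> A) * measure \<nu> A ^ k / fact k" for k
  define c where "c = (\<Sum>k. w k * indicator U (of_nat k :: ennreal))"
  have *: "prob ({N\<in>space Q. emeasure N A \<in> U} \<inter> F) = c * prob F"
    if F[measurable]: "F \<in> sets Q" and F_inv: "\<And>N z. N \<in> space Q \<Longrightarrow> z \<in> A \<Longrightarrow> add_point N z \<in> F \<longleftrightarrow> N \<in> F" for F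
  proof -
    let ?F = "\<lambda>k. {N\<in>space Q. emeasure N A = of_nat k} \<inter> F \<inter> {N. of_nat k \<in> U}"
    have mk: "{N\<in>space Q. emeasure N A = of_nat k} \<in> sets Q" for k
      using sets_Collect_emeasure[OF sets_Q A, of "{of_nat k}"] by auto
    have mF: "?F k \<in> sets Q" for k
      using mk[of k] by (cases "of_nat k \<in> U") auto
    have pF: "prob (?F k) = w k * indicator U (of_nat k :: ennreal) * prob F" for k
      using mecke_count_inter[OF Q sets_Q mecke A False count[OF False] F F_inv, of k]
      by (cases "(of_nat k :: ennreal) \<in> U") (auto simp: w_def)
    have "prob ({N\<in>space Q. emeasure N A \<in> U} \<inter> F) = prob (\<Union>k. ?F k)"
      using count[OF False] mU mF by (intro measure_eq_AE) (auto elim!: eventually_mono)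
    moreover have "(\<lambda>k. prob (?F k)) sums prob (\<Union>k. ?F k)"
      using mF by (intro finite_measure_UNION) (auto simp: disjoint_family_on_def)
    ultimately have "(\<lambda>k. w k * indicator U (of_nat k :: ennreal) * prob F) sums prob ({N\<in>space Q. emeasure N A \<in> U} \<inter> F)"
      unfolding pF by simp
    moreover have "summable (\<lambda>k. w k * indicator U (of_nat k :: ennreal))"
    proof (rule summable_comparison_test)
      show "summable w"
        using poisson_weights_sums[of "measure \<nu> A"] unfolding w_def sums_iff by simp
      show "\<exists>N. \<forall>n\<ge>N. norm (w n * indicator U (of_nat n :: ennreal)) \<le> w n"
        by (auto simp: w_def indicator_def)
    qed
    then have "(\<lambda>k. w k * indicator U (of_nat k :: ennreal) * prob F) sums (c * prob F)"
      unfolding c_def by (intro sums_mult2 summable_sums)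
    ultimately show ?thesis by (rule sums_unique2)
  qed
  have space_inv: "add_point N z \<in> space Q \<longleftrightarrow> N \<in> space Q" for N z
    using sets_eq_imp_space_eq[OF sets_Q] by (simp add: space_measure_algebra)
  have "{N\<in>space Q. emeasure N A \<in> U} \<inter> space Q = {N\<in>space Q. emeasure N A \<in> U}" by auto
  with *[of "space Q"] have "prob {N\<in>space Q. emeasure N A \<in> U} = c"
    by (simp add: prob_space space_inv)
  with *[OF E inv] show ?thesis by simp
qed

text \<open>The law of a single count comes from the event \<open>space Q\<close>. For independence,
  an event about the counts of other sets \<open>A j\<close> ignores points added in the disjoint
  set \<open>A i\<close>, so the sets can be split off one at a time.\<close>

lemma prm_law_of_mecke:
  assumes Q: "prob_space Q" and sets_Q: "sets Q = sets (measure_algebra \<nu>)" and mecke: "mecke \<nu> Q"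
    and count: "\<And>A. A \<in> sets \<nu> \<Longrightarrow> emeasure \<nu> A \<noteq> \<infinity> \<Longrightarrow> AE N in Q. \<exists>k. emeasure N A = of_nat k"
    and inf: "\<And>A. A \<in> sets \<nu> \<Longrightarrow> emeasure \<nu> A = \<infinity> \<Longrightarrow> AE N in Q. emeasure N A = \<infinity>"
  shows "poisson_random_measure_law \<nu> Q"
  unfolding poisson_random_measure_law_def
proof (intro conjI allI ballI impI)
  interpret prob_space Q by fact
  have space_Q: "space Q = {N. sets N = sets \<nu>}"
    using sets_eq_imp_space_eq[OF sets_Q] by (simp add: space_measure_algebra)
  show "sets Q = sets (measure_algebra \<nu>)" "prob_space Q" by fact+
  show "has_poisson_count Q A (emeasure \<nu> A)" if A: "A \<in> sets \<nu>" for A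
  proof (cases "emeasure \<nu> A = \<infinity>")
    case False
    have "prob {N\<in>space Q. emeasure N A = of_nat k} = exp (- measure \<nu> A) * measure \<nu> A ^ k / fact k" for k
    proof -
      have "{N\<in>space Q. emeasure N A = of_nat k} \<inter> space Q = {N\<in>space Q. emeasure N A = of_nat k}" by auto
      then show ?thesis
        using mecke_count_inter[OF Q sets_Q mecke A False count[OF A False] sets.top, of k]
        by (simp add: space_Q prob_space[unfolded space_Q])
    qed
    then show ?thesis using False by (simp add: has_poisson_count_def measure_def)
  qed (use inf[OF A] in \<open>simp add: has_poisson_count_def\<close>)
  fix k :: nat and A :: "nat \<Rightarrow> _" assume kA: "A ` {..<k} \<subseteq> sets \<nu> \<and> disjoint_family_on A {..<k}"
  have prod: "prob {N\<in>space Q. \<forall>j\<in>J. emeasure N (A j) \<in> U j} = (\<Prod>j\<in>J. prob {N\<in>space Q. emeasure N (A j) \<in> U j})"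
    if "finite J" "J \<subseteq> {..<k}" "\<And>j. j \<in> J \<Longrightarrow> U j \<in> sets borel" for J U
    using that
  proof (induct J)
    case empty
    then show ?case by (simp add: prob_space)
  next
    case (insert i J)
    let ?E = "{N\<in>space Q. \<forall>j\<in>J. emeasure N (A j) \<in> U j}"
    have Ai: "A i \<in> sets \<nu>" using insert kA by auto
    have E: "?E \<in> sets Q"
      using insert kA by (intro sets.sets_Collect_finite_All sets_Collect_emeasure[OF sets_Q]) auto
    have inv: "add_point N z \<in> ?E \<longleftrightarrow> N \<in> ?E" if "N \<in> space Q" "z \<in> A i" for N z
    proof -
      have "emeasure (add_point N z) (A j) = emeasure N (A j)" if "j \<in> J" for j
      proof -
        have "j < k" "i < k" "j \<noteq> i" using insert that by auto
        then have "z \<notin> A j" "A j \<in> sets N"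
          using kA \<open>z \<in> A i\<close> \<open>N \<in> space Q\<close> disjoint_family_onD[of A "{..<k}" j i] by (auto simp: space_Q)
        then show ?thesis by (simp add: emeasure_add_points)
      qed
      then show ?thesis using that by (simp add: space_Q)
    qed
    have "{N\<in>space Q. \<forall>j\<in>insert i J. emeasure N (A j) \<in> U j} = {N\<in>space Q. emeasure N (A i) \<in> U i} \<inter> ?E"
      by auto
    also have "prob \<dots> = prob {N\<in>space Q. emeasure N (A i) \<in> U i} * prob ?E"
      using insert by (intro mecke_event_indep[OF Q sets_Q mecke Ai count[OF Ai] inf[OF Ai] E inv]) auto
    also have "prob ?E = (\<Prod>j\<in>J. prob {N\<in>space Q. emeasure N (A j) \<in> U j})"
      using insert by simp
    finally show ?case using insert by simp
  qed
  show "indep_vars (\<lambda>_. borel) (\<lambda>i N. emeasure N (A i)) {..<k}"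
    unfolding indep_vars_def2
  proof (intro conjI ballI)
    show rv: "random_variable borel (\<lambda>N. emeasure N (A i))" if "i \<in> {..<k}" for i
      using that kA by (subst measurable_cong_sets[OF sets_Q refl]) (auto intro: measurable_emeasure_measure_algebra)
    show "indep_sets (\<lambda>i. {(\<lambda>N. emeasure N (A i)) -` U \<inter> space Q |U. U \<in> sets borel}) {..<k}"
    proof (rule indep_setsI)
      show "{(\<lambda>N. emeasure N (A i)) -` U \<inter> space Q |U. U \<in> sets borel} \<subseteq> events" if "i \<in> {..<k}" for i
        using measurable_sets[OF rv[OF that]] by auto
      fix X J assume J: "J \<noteq> {}" "J \<subseteq> {..<k}" "finite J"
        and "\<forall>j\<in>J. X j \<in> {(\<lambda>N. emeasure N (A j)) -` U \<inter> space Q |U. U \<in> sets borel}"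
      then have "\<forall>j\<in>J. \<exists>U. U \<in> sets borel \<and> X j = {N\<in>space Q. emeasure N (A j) \<in> U}"
        by (auto simp: vimage_def Int_def conj_commute)
      then obtain U where U: "\<And>j. j \<in> J \<Longrightarrow> U j \<in> sets borel"
        "\<And>j. j \<in> J \<Longrightarrow> X j = {N\<in>space Q. emeasure N (A j) \<in> U j}"
        by metis
      have "(\<Inter>j\<in>J. X j) = {N\<in>space Q. \<forall>j\<in>J. emeasure N (A j) \<in> U j}"
        using J U(2) by auto
      then show "prob (\<Inter>j\<in>J. X j) = (\<Prod>j\<in>J. prob (X j))"
        using prod[OF J(3,2) U(1)] U(2) by simp
    qed
  qed
qed

subsection \<open>Exponential tilting\<close>

text \<open>Deleting \<open>a\<close> leaves a partition \<open>p\<close> of \<open>A\<close>. Each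
  \<open>p\<close> arises from exactly one partition in which \<open>{a}\<close> is a cell and, for
  each of its cells \<open>C\<close>, from exactly one in which \<open>a\<close> has joined
  \<open>C\<close>.\<close>

lemma sum_partition_on_insert:
  fixes \<Phi> :: "'a set set \<Rightarrow> 'b::comm_monoid_add"
  assumes A: "finite A" "a \<notin> A"
  shows "(\<Sum>q\<in>{q. partition_on (insert a A) q}. \<Phi> q) =
    (\<Sum>p\<in>{p. partition_on A p}. \<Phi> (insert {a} p) + (\<Sum>C\<in>p. \<Phi> (insert (insert a C) (p - {C}))))"
proof -
  let ?Q = "{q. partition_on (insert a A) q}" and ?P = "{p. partition_on A p}"
  let ?Q1 = "{q\<in>?Q. {a} \<in> q}" and ?Q2 = "{q\<in>?Q. {a} \<notin> q}"
  have finQ: "finite ?Q" and finP: "finite ?P"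
    using A by (auto intro: finitely_many_partition_on)
  have fin: "finite p" if "p \<in> ?P" for p using finite_elements[OF A(1)] that by auto
  have "(\<Sum>q\<in>?Q. \<Phi> q) = (\<Sum>q\<in>?Q1 \<union> ?Q2. \<Phi> q)" by (intro sum.cong) auto
  also have "\<dots> = (\<Sum>q\<in>?Q1. \<Phi> q) + (\<Sum>q\<in>?Q2. \<Phi> q)"
    using finQ by (intro sum.union_disjoint) auto
  also have "(\<Sum>q\<in>?Q1. \<Phi> q) = (\<Sum>p\<in>?P. \<Phi> (insert {a} p))"
  proof (rule sum.reindex_bij_witness[where i="insert {a}" and j="\<lambda>q. q - {{a}}"])
    fix p assume p: "p \<in> ?P"
    then have "\<Union>p = A" by (auto simp: partition_on_def)
    then have d: "disjnt {a} (\<Union>p)" using A by (auto simp: disjnt_def)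
    then show "insert {a} p - {{a}} = p" by (auto simp: disjnt_def)
    have "insert a A - {a} = A" using A by auto
    then show "insert {a} p \<in> ?Q1" using p by (simp add: partition_on_insert[OF d])
  next
    fix q assume q: "q \<in> ?Q1"
    then show "insert {a} (q - {{a}}) = q" by auto
    have "disjoint q" "{a} \<in> q" using q by (auto simp: partition_on_def)
    then have "disjnt {a} D" if "D \<in> q - {{a}}" for D
      using that by (intro pairwiseD[of disjnt q]) auto
    then have d: "disjnt {a} (\<Union>(q - {{a}}))" by (auto simp: disjnt_def)
    have "partition_on (insert a A) (insert {a} (q - {{a}}))"
      using q by (simp add: insert_absorb)
    moreover have "insert a A - {a} = A" using A by auto
    ultimately show "q - {{a}} \<in> ?P" unfolding partition_on_insert[OF d] by simp
  qed (auto simp: insert_absorb)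
  also have "(\<Sum>q\<in>?Q2. \<Phi> q) = (\<Sum>(p, C)\<in>Sigma ?P (\<lambda>p. p). \<Phi> (insert (insert a C) (p - {C})))"
  proof -
    define blk where "blk q = \<Union>{D\<in>q. a \<in> D}" for q :: "'a set set"
    have blk: "blk q = D" if "disjoint q" "D \<in> q" "a \<in> D" for q D
      using that by (auto simp: blk_def pairwise_def disjnt_iff)
    show ?thesis
    proof (rule sum.reindex_bij_witness[where j="\<lambda>q. (insert (blk q - {a}) (q - {blk q}), blk q - {a})"
          and i="\<lambda>(p, C). insert (insert a C) (p - {C})"])
      fix q assume q: "q \<in> ?Q2"
      then have part: "\<Union>q = insert a A" "disjoint q" "{} \<notin> q" "{a} \<notin> q" by (auto simp: partition_on_def)
      then obtain D where D: "D \<in> q" "a \<in> D" by (metis UnionE insertI1)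
      have bD: "blk q = D" using blk[OF part(2) D] .
      have dD: "disjnt (D - {a}) (\<Union>(q - {D}))" "disjnt D (\<Union>(q - {D}))"
        using part D by (auto simp: pairwise_def disjnt_iff)
      have "D \<noteq> {a}" using part D by auto
      then have ne: "D - {a} \<noteq> {}" using D by blast
      \<comment> \<open>The shortened cell must differ from all others, or inserting it into the set
        of cells would merge the two and \<open>q\<close> could not be recovered.\<close>
      have Dn: "D - {a} \<notin> q - {D}" using dD(1) ne unfolding disjnt_iff by blast
      have q': "partition_on (insert a A) (insert D (q - {D}))"
        using q D by (simp add: insert_absorb)
      have AD: "A - (D - {a}) = insert a A - D" using A D by auto
      have DA: "D \<subseteq> insert a A" using part D by auto
      have "partition_on A (insert (D - {a}) (q - {D}))"
        using q' ne DA unfolding partition_on_insert[OF dD(1)] partition_on_insert[OF dD(2)] AD by auto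
      then show "(insert (blk q - {a}) (q - {blk q}), blk q - {a}) \<in> Sigma ?P (\<lambda>p. p)"
        by (simp add: bD)
      show eq: "(case (insert (blk q - {a}) (q - {blk q}), blk q - {a}) of (p, C) \<Rightarrow> insert (insert a C) (p - {C})) = q"
        using D Dn by (auto simp: bD insert_absorb)
      then show "(case (insert (blk q - {a}) (q - {blk q}), blk q - {a}) of (p, C) \<Rightarrow> \<Phi> (insert (insert a C) (p - {C}))) = \<Phi> q"
        by simp
    next
      fix pC assume "pC \<in> Sigma ?P (\<lambda>p. p)"
      then obtain p C where pC: "pC = (p, C)" "partition_on A p" "C \<in> p" by auto
      have part: "\<Union>p = A" "disjoint p" "{} \<notin> p" using pC by (auto simp: partition_on_def)
      have "a \<notin> C" using part pC A by auto
      have nq: "insert a C \<notin> p - {C}" using part A by blast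
      have dC: "disjnt C (\<Union>(p - {C}))" using part pC by (auto simp: pairwise_def disjnt_iff)
      have daC: "disjnt (insert a C) (\<Union>(p - {C}))"
        using dC part A by (auto simp: disjnt_iff)
      have "partition_on A (insert C (p - {C}))" using pC by (simp add: insert_absorb)
      then have part': "partition_on (insert a A) (insert (insert a C) (p - {C}))"
        using A unfolding partition_on_insert[OF dC] partition_on_insert[OF daC] by auto
      have nC: "C \<noteq> {}" using part pC by auto
      have "{a} \<notin> insert (insert a C) (p - {C})"
        using nC \<open>a \<notin> C\<close> part A by blast
      then show "(case pC of (p, C) \<Rightarrow> insert (insert a C) (p - {C})) \<in> ?Q2"
        using part' pC by simp
      have "blk (insert (insert a C) (p - {C})) = insert a C"
        by (rule blk) (use part' in \<open>auto simp: partition_on_def\<close>)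
      moreover have "insert a C - {a} = C" using \<open>a \<notin> C\<close> by auto
      moreover have "insert (insert a C) (p - {C}) - {insert a C} = p - {C}" using nq by auto
      ultimately show "(insert (blk (case pC of (p, C) \<Rightarrow> insert (insert a C) (p - {C})) - {a})
             ((case pC of (p, C) \<Rightarrow> insert (insert a C) (p - {C})) - {blk (case pC of (p, C) \<Rightarrow> insert (insert a C) (p - {C}))}),
            blk (case pC of (p, C) \<Rightarrow> insert (insert a C) (p - {C})) - {a}) = pC"
        using pC by (simp add: insert_absorb)
    qed
  qed
  also have "\<dots> = (\<Sum>p\<in>?P. \<Sum>C\<in>p. \<Phi> (insert (insert a C) (p - {C})))"
    using finP fin by (subst sum.Sigma) auto
  finally show ?thesis by (simp add: sum.distrib)
qed

section \<open>Exponentials on the extended half-line\<close>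

lemma measurable_exp_neg [measurable]: "exp_neg \<in> borel_measurable borel"
  unfolding exp_neg_def[abs_def] by measurable

lemma exp_neg_le_1: "exp_neg x \<le> 1"
  by (simp add: exp_neg_def)

lemma exp_neg_eq_0_iff: "exp_neg x = 0 \<longleftrightarrow> x = \<infinity>"
  by (simp add: exp_neg_def)

lemma exp_neg_ennreal: "0 \<le> x \<Longrightarrow> exp_neg (ennreal x) = ennreal (exp (- x))"
  by (simp add: exp_neg_def)

lemma exp_neg_add: "exp_neg (x + y) = exp_neg x * exp_neg y"
  by (cases x; cases y)
     (simp_all add: exp_neg_def exp_add[symmetric] ennreal_mult[symmetric] ennreal_plus[symmetric] del: ennreal_plus)

text \<open>One term of the exponential series at \<open>a * x\<close> is at most
  \<open>exp (a * x)\<close>. The bound trades powers for part of an exponential weight.\<close>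

lemma power_mult_exp_le:
  fixes x a :: real
  assumes "0 \<le> x" "0 < a"
  shows "x ^ k * exp (- a * x) \<le> fact k / a ^ k"
proof -
  have "(a * x) ^ k /\<^sub>R fact k \<le> (\<Sum>n. (a * x) ^ n /\<^sub>R fact n)"
    using assms by (intro sum_le_suminf[where I="{k}", simplified] summable_exp_generic) auto
  then have "(a * x) ^ k / fact k \<le> exp (a * x)"
    by (simp add: exp_def divide_inverse mult.commute)
  then have "a ^ k * x ^ k \<le> fact k * exp (a * x)"
    by (simp add: field_simps power_mult_distrib)
  then show ?thesis
    using assms by (simp add: exp_minus field_simps)
qed

text \<open>Allows one coordinate of a product over \<open>insert C p\<close> to be split off and
  added to \<open>N\<close> as an atom of its own.\<close>

lemma add_points_add_point:
  assumes "finite p" "C \<notin> p"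
  shows "add_points (add_point N x) p z = add_points N (insert C p) (z(C := x))"
proof (rule measure_eqI)
  fix A assume "A \<in> sets (add_points (add_point N x) p z)"
  then have A: "A \<in> sets N" by simp
  have "(\<Sum>D\<in>p. indicator A ((z(C := x)) D)) = (\<Sum>D\<in>p. indicator A (z D) :: ennreal)"
    using assms by (intro sum.cong) auto
  then show "emeasure (add_points (add_point N x) p z) A = emeasure (add_points N (insert C p) (z(C := x))) A"
    using assms A by (simp add: emeasure_add_points add_ac)
qed simp

text \<open>The setting without kernels: points in an arbitrary measurable space, weighted by a
  positive \<open>H\<close>. That \<open>\<nu>\<close> is \<sigma>-finite will be deduced from
  \<open>mass\<close>.\<close>

locale poisson_mass =
  fixes \<nu> :: "'c measure" and P :: "'c measure measure" and H :: "'c \<Rightarrow> real"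
  assumes prm: "poisson_random_measure_law \<nu> P"
    and H_meas [measurable]: "H \<in> borel_measurable \<nu>"
    and H_pos: "\<And>x. 0 < H x"
    and mass: "AE N in P. 0 < (\<integral>\<^sup>+x. ennreal (H x) \<partial>N) \<and> (\<integral>\<^sup>+x. ennreal (H x) \<partial>N) < \<infinity>"
begin

text \<open>In the paper's notation, with \<open>H(s,y) = h(s)\<close>: \<open>tilted v\<close> is \<open>e\<^sup>-\<^sup>v\<^sup>h\<rho> \<eta>\<close>, \<open>tilted_law v\<close> will turn out to be
  \<open>\<P>(dN|e\<^sup>-\<^sup>v\<^sup>h\<rho>,\<eta>)\<close>, \<open>lap v\<close> is \<open>E[e\<^sup>-\<^sup>v\<^sup>T]\<close> and \<open>moment m v\<close> is \<open>\<kappa>\<^sub>m(e\<^sup>-\<^sup>v\<^sup>h\<Omega>)\<close>.\<close>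

definition T :: "'c measure \<Rightarrow> ennreal" where "T N = (\<integral>\<^sup>+x. ennreal (H x) \<partial>N)"
definition lap :: "real \<Rightarrow> ennreal" where "lap v = (\<integral>\<^sup>+N. exp_neg (ennreal v * T N) \<partial>P)"
definition tilted_law :: "real \<Rightarrow> 'c measure measure" where
  "tilted_law v = density P (\<lambda>N. exp_neg (ennreal v * T N) / lap v)"
definition tilted :: "real \<Rightarrow> 'c measure" where
  "tilted v = density \<nu> (\<lambda>x. ennreal (exp (- v * H x)))"
definition moment :: "nat \<Rightarrow> real \<Rightarrow> ennreal" where
  "moment m v = (\<integral>\<^sup>+x. ennreal (H x ^ m) \<partial>tilted v)"
definition point_law :: "nat \<Rightarrow> real \<Rightarrow> 'c measure" where
  "point_law m v = density (tilted v) (\<lambda>x. ennreal (H x ^ m) / moment m v)"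

sublocale P: prob_space P by (rule prm_law_prob_space[OF prm])

lemmas sets_P [measurable_cong] = prm_law_sets[OF prm]
lemmas space_P = prm_law_space[OF prm]

lemma T_meas [measurable]: "T \<in> borel_measurable (measure_algebra \<nu>)"
  unfolding T_def[abs_def] by (rule borel_measurable_nn_integral_measure_algebra) measurable

lemma sets_tilted [simp, measurable_cong]: "sets (tilted v) = sets \<nu>"
  and sets_tilted_law [simp, measurable_cong]: "sets (tilted_law v) = sets (measure_algebra \<nu>)"
  and sets_point_law [simp, measurable_cong]: "sets (point_law m v) = sets \<nu>"
  by (simp_all add: tilted_def tilted_law_def point_law_def sets_P)

lemma T_finite: "AE N in P. T N < \<infinity>" and T_pos: "AE N in P. 0 < T N"
  using mass by (auto simp: T_def elim: eventually_mono)

lemma T_add_points: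
  assumes "finite p" "sets N = sets \<nu>" "\<And>C. C \<in> p \<Longrightarrow> z C \<in> space \<nu>"
  shows "T (add_points N p z) = T N + (\<Sum>C\<in>p. ennreal (H (z C)))"
  unfolding T_def using assms sets_eq_imp_space_eq[OF assms(2)]
  by (intro nn_integral_add_points) (auto cong: measurable_cong_sets)

section \<open>Nondegeneracy of the Laplace transform and of the intensity\<close>

lemma lap_le_1: "lap v \<le> 1"
proof -
  have "lap v \<le> (\<integral>\<^sup>+N. 1 \<partial>P)" unfolding lap_def by (intro nn_integral_mono exp_neg_le_1)
  then show ?thesis by (simp add: P.emeasure_space_1)
qed

lemma lap_neq_top: "lap v \<noteq> \<infinity>"
  using lap_le_1[of v] by (auto simp: top_unique)

text \<open>\<open>e^{-vT}\<close> can vanish only where \<open>T\<close> is infinite, that is, on a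
  null set.\<close>

lemma lap_neq_0: "lap v \<noteq> 0"
proof
  assume "lap v = 0"
  then have "AE N in P. exp_neg (ennreal v * T N) = 0"
    unfolding lap_def by (subst (asm) nn_integral_0_iff_AE) auto
  with T_finite have "AE N in P. False"
    by eventually_elim (auto simp: exp_neg_eq_0_iff ennreal_mult_eq_top_iff)
  then show False by (simp add: P.AE_False)
qed

text \<open>Otherwise this set would have infinite count almost surely, and \<open>T\<close> is at
  least \<open>\<epsilon>\<close> times that count.\<close>

lemma emeasure_H_gt_finite:
  assumes "0 < \<epsilon>"
  shows "emeasure \<nu> {x\<in>space \<nu>. \<epsilon> < H x} \<noteq> \<infinity>"
proof
  let ?A = "{x\<in>space \<nu>. \<epsilon> < H x}"
  have A: "?A \<in> sets \<nu>" by measurable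
  assume "emeasure \<nu> ?A = \<infinity>"
  then have "AE N in P. emeasure N ?A = \<infinity>"
    using prm_law_count[OF prm A] by (simp add: has_poisson_count_def)
  moreover have "AE N in P. ennreal \<epsilon> * emeasure N ?A \<le> T N"
  proof (rule AE_I2)
    fix N assume "N \<in> space P"
    then have N: "sets N = sets \<nu>" by (simp add: space_P)
    have "ennreal \<epsilon> * emeasure N ?A = (\<integral>\<^sup>+x. ennreal \<epsilon> * indicator ?A x \<partial>N)"
      using A N by (simp add: nn_integral_cmult_indicator)
    also have "\<dots> \<le> T N"
      unfolding T_def by (intro nn_integral_mono) (auto simp: indicator_def intro!: ennreal_leI)
    finally show "ennreal \<epsilon> * emeasure N ?A \<le> T N" .
  qed
  ultimately have "AE N in P. False"
    using T_finite by eventually_elim (use assms in \<open>auto simp: ennreal_mult_top top_unique\<close>)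
  then show False by (simp add: P.AE_False)
qed

text \<open>Positivity of \<open>H\<close> makes the sets \<open>{H > 1/(n+1)}\<close> exhaust the
  space.\<close>

lemma sigma_finite_intensity: "sigma_finite_measure \<nu>"
proof
  let ?A = "\<lambda>n::nat. {x\<in>space \<nu>. 1 / real (Suc n) < H x}"
  have "\<exists>n. 1 / real (Suc n) < H x" for x
    using reals_Archimedean[OF H_pos[of x]] by (simp add: inverse_eq_divide)
  then have "(\<Union>n. ?A n) = space \<nu>" by auto
  moreover have "range ?A \<subseteq> sets \<nu>" by auto
  moreover have "\<forall>a\<in>range ?A. emeasure \<nu> a \<noteq> \<infinity>" using emeasure_H_gt_finite by auto
  ultimately show "\<exists>A. countable A \<and> A \<subseteq> sets \<nu> \<and> \<Union>A = space \<nu> \<and> (\<forall>a\<in>A. emeasure \<nu> a \<noteq> \<infinity>)"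
    by (intro exI[of _ "range ?A"]) auto
qed

sublocale \<nu>: sigma_finite_measure \<nu> by (rule sigma_finite_intensity)

text \<open>A null intensity would give \<open>N = 0\<close>, hence \<open>T = 0\<close>, almost
  surely. This also excludes the null measure that stands in for an ill-defined intensity.\<close>

lemma intensity_neq_0: "emeasure \<nu> (space \<nu>) \<noteq> 0"
proof
  assume "emeasure \<nu> (space \<nu>) = 0"
  then have "measure P {N\<in>space P. emeasure N (space \<nu>) = of_nat 0} = 1"
    using prm_law_count[OF prm sets.top] by (auto simp: has_poisson_count_def dest!: spec[of _ 0])
  then have "AE N in P. emeasure N (space \<nu>) = 0"
    using prm_law_measurable_emeasure[OF prm sets.top]
    by (subst (asm) P.prob_Collect_eq_1) auto
  moreover have "AE N in P. N \<in> space P" by simp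
  ultimately have "AE N in P. False" using T_pos
  proof eventually_elim
    case (elim N)
    then have "emeasure N (space N) = 0" by (auto simp: space_P dest: sets_eq_imp_space_eq)
    then have "T N = 0" 
      using nn_integral_cong_AE[OF emeasure_0_AE, of N "\<lambda>x. ennreal (H x)" "\<lambda>_. 0"] by (simp add: T_def)
    then show False using elim by simp
  qed
  then show False by (simp add: P.AE_False)
qed

section \<open>The tilted law is Poisson with the tilted intensity\<close>

lemma nn_integral_tilted:
  assumes [measurable]: "f \<in> borel_measurable \<nu>"
  shows "(\<integral>\<^sup>+x. f x \<partial>tilted v) = (\<integral>\<^sup>+x. ennreal (exp (- v * H x)) * f x \<partial>\<nu>)"
  unfolding tilted_def by (subst nn_integral_density) auto

lemma nn_integral_tilted_law:
  assumes [measurable]: "f \<in> borel_measurable (measure_algebra \<nu>)"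
  shows "(\<integral>\<^sup>+N. f N \<partial>tilted_law v) = (\<integral>\<^sup>+N. exp_neg (ennreal v * T N) * f N \<partial>P) / lap v"
proof -
  have "(\<integral>\<^sup>+N. f N \<partial>tilted_law v) = (\<integral>\<^sup>+N. exp_neg (ennreal v * T N) / lap v * f N \<partial>P)"
    unfolding tilted_law_def by (subst nn_integral_density) auto
  also have "\<dots> = (\<integral>\<^sup>+N. exp_neg (ennreal v * T N) * f N / lap v \<partial>P)"
    by (simp add: divide_ennreal_def mult_ac)
  also have "\<dots> = (\<integral>\<^sup>+N. exp_neg (ennreal v * T N) * f N \<partial>P) / lap v"
    by (rule nn_integral_divide) measurable
  finally show ?thesis .
qed

lemma prob_space_tilted_law: "prob_space (tilted_law v)"
proof
  have "emeasure (tilted_law v) (space (tilted_law v)) = (\<integral>\<^sup>+N. 1 \<partial>tilted_law v)" by simp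
  also have "\<dots> = lap v / lap v"
    by (subst nn_integral_tilted_law) (auto simp: lap_def)
  also have "\<dots> = 1" using lap_neq_0 lap_neq_top by (simp add: ennreal_divide_self less_top)
  finally show "emeasure (tilted_law v) (space (tilted_law v)) = 1" .
qed

lemma sigma_finite_tilted: "sigma_finite_measure (tilted v)"
  unfolding tilted_def
  by (subst \<nu>.sigma_finite_iff_density_finite) auto

lemma mecke_tilted:
  assumes v: "0 < v"
  shows "mecke (tilted v) (tilted_law v)"
  unfolding mecke_def
proof (intro ballI)
  fix f :: "'c \<Rightarrow> ennreal" and G :: "'c measure \<Rightarrow> ennreal"
  assume "f \<in> borel_measurable (tilted v)" "G \<in> borel_measurable (measure_algebra (tilted v))"
  then have f[measurable]: "f \<in> borel_measurable \<nu>" and G[measurable]: "G \<in> borel_measurable (measure_algebra \<nu>)"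
    by (simp_all add: measure_algebra_cong[OF sets_tilted] cong: measurable_cong_sets)
  have Nf[measurable]: "(\<lambda>N. \<integral>\<^sup>+x. f x \<partial>N) \<in> borel_measurable (measure_algebra \<nu>)"
    by (rule borel_measurable_nn_integral_measure_algebra[OF f])
  let ?e = "\<lambda>N. exp_neg (ennreal v * T N)"
  have m: "(\<lambda>N. add_point N z) \<in> measurable (measure_algebra \<nu>) (measure_algebra \<nu>)" if "z \<in> space \<nu>" for z
    using that by (intro measurable_add_points) auto
  have "(\<integral>\<^sup>+N. (\<integral>\<^sup>+x. f x \<partial>N) * G N \<partial>tilted_law v) =
      (\<integral>\<^sup>+N. (\<integral>\<^sup>+x. f x \<partial>N) * (?e N * G N) \<partial>P) / lap v"
    by (subst nn_integral_tilted_law) (auto simp: mult_ac)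
  \<comment> \<open>The formula for \<open>P\<close> is applied to the functional
    \<open>e^{-vT} G\<close>. The added point then contributes the factor \<open>e^{-vH(z)}\<close>,
    which is the density of the tilted intensity.\<close>
  also have "(\<integral>\<^sup>+N. (\<integral>\<^sup>+x. f x \<partial>N) * (?e N * G N) \<partial>P) =
      (\<integral>\<^sup>+z. f z * (\<integral>\<^sup>+N. ?e (add_point N z) * G (add_point N z) \<partial>P) \<partial>\<nu>)"
    using prm_law_mecke[OF prm sigma_finite_intensity] f unfolding mecke_def by auto
  also have "\<dots> = (\<integral>\<^sup>+z. f z * (ennreal (exp (- v * H z)) * (\<integral>\<^sup>+N. ?e N * G (add_point N z) \<partial>P)) \<partial>\<nu>)"
  proof (intro nn_integral_cong arg_cong2[where f="(*)"] refl)
    fix z assume z: "z \<in> space \<nu>"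
    note [measurable] = m[OF z]
    have "(\<integral>\<^sup>+N. ?e (add_point N z) * G (add_point N z) \<partial>P) =
        (\<integral>\<^sup>+N. ennreal (exp (- v * H z)) * (?e N * G (add_point N z)) \<partial>P)"
    proof (rule nn_integral_cong)
      fix N assume "N \<in> space P"
      then have "T (add_point N z) = T N + ennreal (H z)"
        using z by (subst T_add_points) (auto simp: space_P)
      then have "?e (add_point N z) = ?e N * exp_neg (ennreal v * ennreal (H z))"
        by (simp add: distrib_left exp_neg_add)
      also have "exp_neg (ennreal v * ennreal (H z)) = ennreal (exp (- v * H z))"
        using v H_pos[of z] by (simp add: ennreal_mult[symmetric] exp_neg_ennreal)
      finally show "?e (add_point N z) * G (add_point N z) =
          ennreal (exp (- v * H z)) * (?e N * G (add_point N z))"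
        by (simp add: mult_ac)
    qed
    also have "\<dots> = ennreal (exp (- v * H z)) * (\<integral>\<^sup>+N. ?e N * G (add_point N z) \<partial>P)"
      by (rule nn_integral_cmult) measurable
    finally show "(\<integral>\<^sup>+N. ?e (add_point N z) * G (add_point N z) \<partial>P) = \<dots>" .
  qed
  also have "\<dots> / lap v = (\<integral>\<^sup>+z. ennreal (exp (- v * H z)) * (f z * ((\<integral>\<^sup>+N. ?e N * G (add_point N z) \<partial>P) / lap v)) \<partial>\<nu>)"
    by (subst nn_integral_divide[symmetric]) (auto simp: divide_ennreal_def mult_ac)
  also have "\<dots> = (\<integral>\<^sup>+z. ennreal (exp (- v * H z)) * (f z * (\<integral>\<^sup>+N. G (add_point N z) \<partial>tilted_law v)) \<partial>\<nu>)"
  proof (intro nn_integral_cong arg_cong2[where f="(*)"] refl)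
    fix z assume z: "z \<in> space \<nu>"
    note [measurable] = m[OF z]
    show "(\<integral>\<^sup>+N. ?e N * G (add_point N z) \<partial>P) / lap v = (\<integral>\<^sup>+N. G (add_point N z) \<partial>tilted_law v)"
      by (subst nn_integral_tilted_law) auto
  qed
  also have "\<dots> = (\<integral>\<^sup>+z. f z * (\<integral>\<^sup>+N. G (add_point N z) \<partial>tilted_law v) \<partial>tilted v)"
  proof -
    interpret Q: prob_space "tilted_law v" by (rule prob_space_tilted_law)
    show ?thesis by (subst nn_integral_tilted) auto
  qed
  finally show "(\<integral>\<^sup>+N. (\<integral>\<^sup>+x. f x \<partial>N) * G N \<partial>tilted_law v) =
      (\<integral>\<^sup>+z. f z * (\<integral>\<^sup>+N. G (add_point N z) \<partial>tilted_law v) \<partial>tilted v)" .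
qed

text \<open>Where \<open>H \<le> 1\<close> the tilting density is at least \<open>e^{-v}\<close>,
  and \<open>{H > 1}\<close> has finite intensity in any case. This is what allows integer counts to
  be taken over from \<open>P\<close>.\<close>

lemma emeasure_tilted_finiteD:
  assumes v: "0 < v" and A[measurable]: "A \<in> sets \<nu>" and fin: "emeasure (tilted v) A \<noteq> \<infinity>"
  shows "emeasure \<nu> A \<noteq> \<infinity>"
proof -
  let ?B = "{x\<in>space \<nu>. 1 < H x}"
  have B[measurable]: "?B \<in> sets \<nu>" by measurable
  have "emeasure \<nu> A = (\<integral>\<^sup>+x. indicator A x \<partial>\<nu>)" by simp
  also have "\<dots> \<le> (\<integral>\<^sup>+x. indicator ?B x + ennreal (exp v) * (ennreal (exp (- v * H x)) * indicator A x) \<partial>\<nu>)"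
  proof (rule nn_integral_mono)
    fix x assume x: "x \<in> space \<nu>"
    show "indicator A x \<le> indicator ?B x + ennreal (exp v) * (ennreal (exp (- v * H x)) * indicator A x)"
    proof (cases "1 < H x")
      case False
      then have "1 \<le> ennreal (exp v * exp (- v * H x))"
        using v by (simp add: exp_add[symmetric])
      then have "1 \<le> ennreal (exp v) * ennreal (exp (- v * H x))" by (simp add: ennreal_mult)
      then show ?thesis using False by (auto simp: indicator_def)
    qed (use x in \<open>auto simp: indicator_def\<close>)
  qed
  also have "\<dots> = emeasure \<nu> ?B + ennreal (exp v) * emeasure (tilted v) A"
    unfolding tilted_def by (subst nn_integral_add) (auto simp: nn_integral_cmult emeasure_density)
  also have "\<dots> < \<infinity>"
    using emeasure_H_gt_finite[of 1] fin by (auto simp: less_top[symmetric] ennreal_mult_eq_top_iff)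
  finally show ?thesis by simp
qed

lemma AE_tilted_law: "AE N in P. R N \<Longrightarrow> AE N in tilted_law v. R N"
  unfolding tilted_law_def by (subst AE_density) (auto elim: eventually_mono)

text \<open>For \<open>v > 0\<close> the same sets have finite intensity before and after tilting,
  and the tilted law is absolutely continuous with respect to \<open>P\<close>. So the almost sure
  statements about counts carry over, and the Mecke formula supplies the rest.\<close>

lemma prm_law_tilted:
  assumes v: "0 < v"
  shows "poisson_random_measure_law (tilted v) (tilted_law v)"
proof (rule prm_law_of_mecke)
  show "prob_space (tilted_law v)" by (rule prob_space_tilted_law)
  show "sets (tilted_law v) = sets (measure_algebra (tilted v))"
    by (simp add: measure_algebra_cong[OF sets_tilted])
  show "mecke (tilted v) (tilted_law v)" by (rule mecke_tilted[OF v])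
  show "AE N in tilted_law v. \<exists>k. emeasure N A = of_nat k"
    if "A \<in> sets (tilted v)" "emeasure (tilted v) A \<noteq> \<infinity>" for A
  proof (rule AE_tilted_law)
    from that have A: "A \<in> sets \<nu>" by simp
    show "AE N in P. \<exists>k. emeasure N A = of_nat k"
      using emeasure_tilted_finiteD[OF v A that(2)] A
      by (intro has_poisson_countD_AE[OF P.prob_space_axioms _ prm_law_count[OF prm A]])
         (auto intro: prm_law_measurable_emeasure[OF prm])
  qed
  show "AE N in tilted_law v. emeasure N A = \<infinity>"
    if "A \<in> sets (tilted v)" "emeasure (tilted v) A = \<infinity>" for A
  proof (rule AE_tilted_law)
    from that have A: "A \<in> sets \<nu>" by simp
    have "emeasure (tilted v) A = (\<integral>\<^sup>+x. ennreal (exp (- v * H x)) * indicator A x \<partial>\<nu>)"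
      unfolding tilted_def using A by (subst emeasure_density) auto
    also have "\<dots> \<le> (\<integral>\<^sup>+x. indicator A x \<partial>\<nu>)"
      using v H_pos by (intro nn_integral_mono) (auto simp: indicator_def less_imp_le)
    finally have "emeasure \<nu> A = \<infinity>" using that A by (simp add: top_unique)
    then show "AE N in P. emeasure N A = \<infinity>"
      using prm_law_count[OF prm A] by (simp add: has_poisson_count_def)
  qed
qed

end

subsection \<open>Partition expansion of the moments of the total mass\<close>

context poisson_mass
begin

section \<open>Moments of the tilted intensity and the laws of the extra points\<close>

lemma moment_altdef:
  "moment m v = (\<integral>\<^sup>+x. ennreal (exp (- v * H x)) * ennreal (H x ^ m) \<partial>\<nu>)"
  unfolding moment_def by (subst nn_integral_tilted) auto

lemma moment_neq_0: "moment m v \<noteq> 0"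
proof
  assume "moment m v = 0"
  then have "AE x in \<nu>. ennreal (exp (- v * H x)) * ennreal (H x ^ m) = 0"
    unfolding moment_altdef by (subst (asm) nn_integral_0_iff_AE) auto
  then have "AE x in \<nu>. False"
  proof eventually_elim
    case (elim x)
    have "0 < H x ^ m" using H_pos[of x] by simp
    with elim show ?case by (simp add: ennreal_eq_0_iff)
  qed
  then show False using intensity_neq_0 by (simp add: AE_iff_null null_sets_def)
qed

text \<open>By the Mecke formula with \<open>f = H\<close> and \<open>G = 1\<close> this is the mean
  of \<open>T\<close> under the tilted law, that is \<open>E[T e^{-vT}] / E[e^{-vT}]\<close>, and
  \<open>t e^{-vt} \<le> 1/v\<close>.\<close>

lemma moment_1_finite:
  assumes v: "0 < v"
  shows "moment 1 v \<noteq> \<infinity>"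
proof -
  interpret Q: prob_space "tilted_law v" by (rule prob_space_tilted_law)
  have "moment 1 v = (\<integral>\<^sup>+z. ennreal (H z) * (\<integral>\<^sup>+N. 1 \<partial>tilted_law v) \<partial>tilted v)"
    using Q.emeasure_space_1 by (simp add: moment_def)
  also have "\<dots> = (\<integral>\<^sup>+N. (\<integral>\<^sup>+x. ennreal (H x) \<partial>N) * 1 \<partial>tilted_law v)"
    using mecke_tilted[OF v, unfolded mecke_def, rule_format, of "\<lambda>x. ennreal (H x)" "\<lambda>_. 1"] by simp
  also have "\<dots> = (\<integral>\<^sup>+N. exp_neg (ennreal v * T N) * T N \<partial>P) / lap v"
    unfolding T_def[symmetric] by (subst nn_integral_tilted_law) auto
  also have "\<dots> \<le> (\<integral>\<^sup>+N. ennreal (1 / v) \<partial>P) / lap v"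
  proof (intro divide_right_mono_ennreal nn_integral_mono)
    fix N
    show "exp_neg (ennreal v * T N) * T N \<le> ennreal (1 / v)"
    proof (cases "T N")
      case (real t)
      then have "exp_neg (ennreal v * T N) * T N = ennreal (t ^ 1 * exp (- v * t))"
        using v by (simp add: ennreal_mult[symmetric] exp_neg_ennreal mult.commute)
      also have "\<dots> \<le> ennreal (fact 1 / v ^ 1)"
        using v real by (intro ennreal_leI power_mult_exp_le) auto
      finally show ?thesis by simp
    next
      case top
      then show ?thesis using v by (simp add: exp_neg_def ennreal_mult_top)
    qed
  qed
  also have "\<dots> < \<infinity>"
    using lap_neq_0[of v] by (simp add: P.emeasure_space_1 ennreal_divide_eq_top_iff less_top[symmetric])
  finally show ?thesis by simp
qed

text \<open>Half of the exponent absorbs \<open>H ^ (m - 1)\<close> at the price of the constant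
  \<open>c\<close>; the other half leaves a first moment at \<open>v / 2\<close>. The moment of
  order 0 is the mass of the tilted intensity and may be infinite.\<close>

lemma moment_finite:
  assumes v: "0 < v" and m: "0 < m"
  shows "moment m v \<noteq> \<infinity>"
proof -
  define c where "c = fact (m - 1) / (v / 2) ^ (m - 1)"
  have c: "0 \<le> c" using v by (simp add: c_def)
  have "moment m v \<le> (\<integral>\<^sup>+x. ennreal c * (ennreal (exp (- (v / 2) * H x)) * ennreal (H x ^ 1)) \<partial>\<nu>)"
    unfolding moment_altdef
  proof (rule nn_integral_mono)
    fix x
    have e: "exp (- v * H x) = exp (- (v / 2) * H x) * exp (- (v / 2) * H x)"
      by (simp add: exp_add[symmetric])
    have "exp (- v * H x) * H x ^ m = (H x ^ (m - 1) * exp (- (v / 2) * H x)) * (exp (- (v / 2) * H x) * H x)"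
      using m unfolding e by (cases m) simp_all
    also have "\<dots> \<le> c * (exp (- (v / 2) * H x) * H x)"
      unfolding c_def using H_pos[of x] v by (intro mult_right_mono power_mult_exp_le) auto
    finally have "ennreal (exp (- v * H x) * H x ^ m) \<le> ennreal (c * (exp (- (v / 2) * H x) * H x))"
      by (rule ennreal_leI)
    then show "ennreal (exp (- v * H x)) * ennreal (H x ^ m) \<le>
        ennreal c * (ennreal (exp (- (v / 2) * H x)) * ennreal (H x ^ 1))"
      using H_pos[of x] c by (simp add: ennreal_mult[symmetric] less_imp_le)
  qed
  also have "\<dots> = ennreal c * moment 1 (v / 2)"
    unfolding moment_altdef by (rule nn_integral_cmult) measurable
  also have "\<dots> < \<infinity>"
    using moment_1_finite[of "v / 2"] v by (simp add: ennreal_mult_eq_top_iff less_top[symmetric])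
  finally show ?thesis by simp
qed

text \<open>The moment is positive and finite, so multiplying by it undoes the normalisation and no
  division has to be carried through the recursion.\<close>

lemma nn_integral_point_law:
  assumes v: "0 < v" "0 < m" and [measurable]: "f \<in> borel_measurable \<nu>"
  shows "moment m v * (\<integral>\<^sup>+x. f x \<partial>point_law m v) = (\<integral>\<^sup>+x. ennreal (H x ^ m) * f x \<partial>tilted v)"
proof -
  have "(\<integral>\<^sup>+x. f x \<partial>point_law m v) = (\<integral>\<^sup>+x. ennreal (H x ^ m) / moment m v * f x \<partial>tilted v)"
    unfolding point_law_def by (subst nn_integral_density) auto
  also have "moment m v * \<dots> = (\<integral>\<^sup>+x. moment m v * (ennreal (H x ^ m) / moment m v * f x) \<partial>tilted v)"
    by (rule nn_integral_cmult[symmetric]) measurable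
  also have "\<dots> = (\<integral>\<^sup>+x. ennreal (H x ^ m) * f x \<partial>tilted v)"
  proof (rule nn_integral_cong)
    fix x
    have "moment m v * (ennreal (H x ^ m) / moment m v) = ennreal (H x ^ m)"
      using moment_neq_0[of m v] moment_finite[OF v]
      by (simp add: ennreal_times_divide mult.commute[of "moment m v"] ennreal_mult_divide_eq)
    then show "moment m v * (ennreal (H x ^ m) / moment m v * f x) = ennreal (H x ^ m) * f x"
      by (simp add: mult.assoc[symmetric])
  qed
  finally show ?thesis .
qed

lemma prob_space_point_law:
  assumes v: "0 < v" "0 < m"
  shows "prob_space (point_law m v)"
proof
  have "moment m v * emeasure (point_law m v) (space (point_law m v)) = moment m v * 1"
    using nn_integral_point_law[OF v, of "\<lambda>_. 1"] by (simp add: moment_def)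
  then show "emeasure (point_law m v) (space (point_law m v)) = 1"
    using moment_neq_0[of m v] moment_finite[OF v] by (simp only: ennreal_mult_cancel_left) simp
qed

text \<open>Valid for all \<open>m\<close> and \<open>v\<close>: the moment never vanishes, so the
  density is finite, and it is 0 where the moment is infinite. Product measures of point laws can
  thus be used without side conditions.\<close>

lemma sigma_finite_point_law: "sigma_finite_measure (point_law m v)"
  unfolding point_law_def
  using moment_neq_0[of m v]
  by (subst sigma_finite_measure.sigma_finite_iff_density_finite[OF sigma_finite_tilted])
     (auto simp: ennreal_divide_eq_top_iff)

lemma product_sigma_finite_point_law: "product_sigma_finite (\<lambda>i. point_law (m i) v)"
  by (rule product_sigma_finite.intro) (rule sigma_finite_point_law)

section \<open>The contribution of a single partition\<close>

lemma measurable_nn_integral_add_points: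
  fixes G :: "'c measure \<Rightarrow> ennreal"
  assumes p: "finite p" and G[measurable]: "G \<in> borel_measurable (measure_algebra \<nu>)"
  shows "(\<lambda>z. \<integral>\<^sup>+N. G (add_points N p z) \<partial>tilted_law v) \<in> borel_measurable (PiM p (\<lambda>_. \<nu>))"
    and "(\<lambda>(z, x). \<integral>\<^sup>+N. G (add_points (add_point N x) p z) \<partial>tilted_law v) \<in>
      borel_measurable (PiM p (\<lambda>_. \<nu>) \<Otimes>\<^sub>M \<nu>)"
proof -
  interpret Q: prob_space "tilted_law v" by (rule prob_space_tilted_law)
  have "(\<lambda>(z, N). add_points N p z) \<in> measurable (PiM p (\<lambda>_. \<nu>) \<Otimes>\<^sub>M measure_algebra \<nu>) (measure_algebra \<nu>)"
    unfolding split_beta' using p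
    by (intro measurable_add_points) (auto intro!: measurable_compose[OF measurable_fst measurable_component_singleton])
  from measurable_compose[OF this G]
  have "(\<lambda>(z, N). G (add_points N p z)) \<in> borel_measurable (PiM p (\<lambda>_. \<nu>) \<Otimes>\<^sub>M tilted_law v)"
    by (simp add: split_beta' cong: measurable_cong_sets)
  then show "(\<lambda>z. \<integral>\<^sup>+N. G (add_points N p z) \<partial>tilted_law v) \<in> borel_measurable (PiM p (\<lambda>_. \<nu>))"
    by (rule Q.borel_measurable_nn_integral)
  have "(\<lambda>((z, x), N). add_points (add_point N x) p z) \<in>
      measurable ((PiM p (\<lambda>_. \<nu>) \<Otimes>\<^sub>M \<nu>) \<Otimes>\<^sub>M measure_algebra \<nu>) (measure_algebra \<nu>)"
    unfolding split_beta' using p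
    by (intro measurable_add_points)
       (auto intro!: measurable_compose[OF measurable_fst measurable_compose[OF measurable_fst measurable_component_singleton]])
  from measurable_compose[OF this G]
  have "(\<lambda>(zx, N). G (add_points (add_point N (snd zx)) p (fst zx))) \<in>
      borel_measurable ((PiM p (\<lambda>_. \<nu>) \<Otimes>\<^sub>M \<nu>) \<Otimes>\<^sub>M tilted_law v)"
    by (simp add: split_beta' cong: measurable_cong_sets)
  from Q.borel_measurable_nn_integral[OF this]
  show "(\<lambda>(z, x). \<integral>\<^sup>+N. G (add_points (add_point N x) p z) \<partial>tilted_law v) \<in>
      borel_measurable (PiM p (\<lambda>_. \<nu>) \<Otimes>\<^sub>M \<nu>)"
    by (simp add: split_beta')
qed

lemma sets_PiM_point_law: "sets (PiM p (\<lambda>i. point_law (m i) v)) = sets (PiM p (\<lambda>_. \<nu>))"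
  by (intro sets_PiM_cong) auto

text \<open>The summand of \<open>p\<close> in the expansion of the mean of \<open>T^n G\<close>
  under the tilted law: the unnormalised weight of \<open>p\<close> times the mean of
  \<open>G\<close> after one independent point per cell has been added.\<close>

definition cell_term :: "('c measure \<Rightarrow> ennreal) \<Rightarrow> real \<Rightarrow> nat set set \<Rightarrow> ennreal" where
  "cell_term G v p = (\<Prod>C\<in>p. moment (card C) v) *
     (\<integral>\<^sup>+z. (\<integral>\<^sup>+N. G (add_points N p z) \<partial>tilted_law v) \<partial>PiM p (\<lambda>C. point_law (card C) v))"

text \<open>Fubini splits off the point of \<open>C\<close>. The weight \<open>u\<close> on that
  point is 1 when a cell is opened and \<open>H\<close> when a cell is enlarged.\<close>

lemma nn_integral_PiM_insert:
  assumes p: "finite p" "C \<notin> p" and G[measurable]: "G \<in> borel_measurable (measure_algebra \<nu>)"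
    and u[measurable]: "u \<in> borel_measurable \<nu>"
  shows "(\<integral>\<^sup>+z. u (z C) * (\<integral>\<^sup>+N. G (add_points N (insert C p) z) \<partial>tilted_law v)
        \<partial>PiM (insert C p) (\<lambda>C. point_law (card C) v)) =
    (\<integral>\<^sup>+z. (\<integral>\<^sup>+x. u x * (\<integral>\<^sup>+N. G (add_points (add_point N x) p z) \<partial>tilted_law v) \<partial>point_law (card C) v)
        \<partial>PiM p (\<lambda>C. point_law (card C) v))"
proof -
  interpret product_sigma_finite "\<lambda>C. point_law (card C) v" by (rule product_sigma_finite_point_law)
  have "(\<lambda>z. u (z C) * (\<integral>\<^sup>+N. G (add_points N (insert C p) z) \<partial>tilted_law v)) \<in>
      borel_measurable (PiM (insert C p) (\<lambda>C. point_law (card C) v))"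
    using p G measurable_nn_integral_add_points(1)[of "insert C p" G v]
      measurable_compose[OF measurable_component_singleton[of C "insert C p" "\<lambda>_. \<nu>"] u]
    by (subst measurable_cong_sets[OF sets_PiM_point_law refl]) auto
  then show ?thesis
    using p by (subst product_nn_integral_insert) (simp_all add: add_points_add_point)
qed

text \<open>The factor \<open>moment (card C) v\<close> cancels the normalisation of the point law
  of \<open>C\<close>. What remains is \<open>H ^ card C\<close> against the tilted intensity: with
  exponent 1 it is what the Mecke formula produces, and enlarging the cell raises the
  exponent.\<close>

lemma cell_term_insert:
  assumes p: "finite p" "C \<notin> p" and C: "finite C" "C \<noteq> {}" and v: "0 < v"
    and G[measurable]: "G \<in> borel_measurable (measure_algebra \<nu>)"
  shows "cell_term G v (insert C p) = (\<Prod>C\<in>p. moment (card C) v) *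
    (\<integral>\<^sup>+z. (\<integral>\<^sup>+x. ennreal (H x ^ card C) * (\<integral>\<^sup>+N. G (add_points (add_point N x) p z) \<partial>tilted_law v) \<partial>tilted v)
        \<partial>PiM p (\<lambda>C. point_law (card C) v))"
proof -
  let ?g = "\<lambda>z x. \<integral>\<^sup>+N. G (add_points (add_point N x) p z) \<partial>tilted_law v"
  let ?PC = "PiM p (\<lambda>C. point_law (card C) v)"
  have g[measurable]: "(\<lambda>(z, x). ?g z x) \<in> borel_measurable (PiM p (\<lambda>_. \<nu>) \<Otimes>\<^sub>M \<nu>)"
    by (rule measurable_nn_integral_add_points(2)[OF p(1) G])
  have g': "(\<lambda>x. ?g z x) \<in> borel_measurable \<nu>" if "z \<in> space ?PC" for z
    using that measurable_Pair_compose_split[OF g, of "\<lambda>_. z" \<nu> "\<lambda>x. x"]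
    by (simp add: sets_eq_imp_space_eq[OF sets_PiM_point_law])
  interpret W: sigma_finite_measure "point_law (card C) v" by (rule sigma_finite_point_law)
  have gm: "(\<lambda>z. \<integral>\<^sup>+x. ?g z x \<partial>point_law (card C) v) \<in> borel_measurable ?PC"
  proof (rule W.borel_measurable_nn_integral)
    show "(\<lambda>(z, x). ?g z x) \<in> borel_measurable (?PC \<Otimes>\<^sub>M point_law (card C) v)"
      using g by (subst measurable_cong_sets[OF sets_pair_measure_cong[OF sets_PiM_point_law sets_point_law] refl])
  qed
  have card: "0 < card C" using C by (simp add: card_gt_0_iff)
  have "cell_term G v (insert C p) = (\<Prod>C\<in>insert C p. moment (card C) v) *
      (\<integral>\<^sup>+z. (\<integral>\<^sup>+x. ?g z x \<partial>point_law (card C) v) \<partial>?PC)"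
    unfolding cell_term_def using nn_integral_PiM_insert[OF p G, of "\<lambda>_. 1" v] by simp
  also have "\<dots> = (\<Prod>C\<in>p. moment (card C) v) *
      (moment (card C) v * (\<integral>\<^sup>+z. (\<integral>\<^sup>+x. ?g z x \<partial>point_law (card C) v) \<partial>?PC))"
    using p by (simp add: mult_ac)
  also have "moment (card C) v * (\<integral>\<^sup>+z. (\<integral>\<^sup>+x. ?g z x \<partial>point_law (card C) v) \<partial>?PC) =
      (\<integral>\<^sup>+z. moment (card C) v * (\<integral>\<^sup>+x. ?g z x \<partial>point_law (card C) v) \<partial>?PC)"
    using gm by (rule nn_integral_cmult[symmetric])
  also have "\<dots> = (\<integral>\<^sup>+z. (\<integral>\<^sup>+x. ennreal (H x ^ card C) * ?g z x \<partial>tilted v) \<partial>?PC)"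
    using g' by (intro nn_integral_cong nn_integral_point_law v card)
  finally show ?thesis .
qed

text \<open>The total mass of \<open>N + \<Sum>\<^bsub>C\<in>p\<^esub> \<delta>\<^bsub>z C\<^esub>\<close> is \<open>T N + \<Sum>\<^bsub>C\<in>p\<^esub> H(z C)\<close>: the Mecke formula turns the first summand into
  a new cell \<open>{a}\<close>, and \<open>H(z C)\<close> raises the exponent of the cell \<open>C\<close>.\<close>

lemma cell_term_T:
  assumes p: "finite p" "\<And>C. C \<in> p \<Longrightarrow> finite C \<and> C \<noteq> {}" and a: "a \<notin> \<Union>p" and v: "0 < v"
    and G[measurable]: "G \<in> borel_measurable (measure_algebra \<nu>)"
  shows "cell_term (\<lambda>N. T N * G N) v p =
    cell_term G v (insert {a} p) + (\<Sum>C\<in>p. cell_term G v (insert (insert a C) (p - {C})))"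
proof -
  let ?K = "\<lambda>p. \<Prod>C\<in>p. moment (card C) v"
  let ?PC = "\<lambda>p. PiM p (\<lambda>C. point_law (card C) v)"
  let ?g = "\<lambda>z. \<integral>\<^sup>+N. G (add_points N p z) \<partial>tilted_law v"
  let ?g1 = "\<lambda>p z x. \<integral>\<^sup>+N. G (add_points (add_point N x) p z) \<partial>tilted_law v"
  interpret Q: prob_space "tilted_law v" by (rule prob_space_tilted_law)
  interpret tilted: sigma_finite_measure "tilted v" by (rule sigma_finite_tilted)
  have space_Q: "space (tilted_law v) = {N. sets N = sets \<nu>}"
    using sets_eq_imp_space_eq[OF sets_tilted_law] by (simp add: space_measure_algebra)
  have space_PC: "space (?PC p) = space (PiM p (\<lambda>_. \<nu>))" for p
    by (rule sets_eq_imp_space_eq[OF sets_PiM_point_law])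
  have aPC[measurable]: "(\<lambda>N. add_points N p z) \<in> measurable (measure_algebra \<nu>) (measure_algebra \<nu>)"
    if "z \<in> space (?PC p)" for z
    using that p(1)
    by (intro measurable_add_points measurable_const measurable_ident) (auto simp: space_PC space_PiM)
  have g[measurable]: "?g \<in> borel_measurable (PiM p (\<lambda>_. \<nu>))"
    by (rule measurable_nn_integral_add_points(1)[OF p(1) G])
  have gm1: "(\<lambda>z. \<integral>\<^sup>+x. ennreal (H x) * ?g1 p z x \<partial>tilted v) \<in> borel_measurable (?PC p)"
  proof (rule tilted.borel_measurable_nn_integral)
    have "(\<lambda>zx. ennreal (H (snd zx)) * (\<lambda>(z, x). ?g1 p z x) zx) \<in> borel_measurable (PiM p (\<lambda>_. \<nu>) \<Otimes>\<^sub>M \<nu>)"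
      using measurable_nn_integral_add_points(2)[OF p(1) G, of v] by measurable
    then show "(\<lambda>(z, x). ennreal (H x) * ?g1 p z x) \<in> borel_measurable (?PC p \<Otimes>\<^sub>M tilted v)"
      by (subst measurable_cong_sets[OF sets_pair_measure_cong[OF sets_PiM_point_law sets_tilted] refl])
         (simp add: split_beta')
  qed
  have gmC: "(\<lambda>z. ennreal (H (z C)) * ?g z) \<in> borel_measurable (?PC p)" if "C \<in> p" for C
    using that g measurable_compose[OF measurable_component_singleton[of C p "\<lambda>_. \<nu>"] H_meas]
    by (subst measurable_cong_sets[OF sets_PiM_point_law refl]) auto
  have inner: "(\<integral>\<^sup>+N. T (add_points N p z) * G (add_points N p z) \<partial>tilted_law v) =
      (\<integral>\<^sup>+x. ennreal (H x) * ?g1 p z x \<partial>tilted v) + (\<Sum>C\<in>p. ennreal (H (z C)) * ?g z)"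
    if z: "z \<in> space (?PC p)" for z
  proof -
    note [measurable] = aPC[OF z]
    have zC: "z C \<in> space \<nu>" if "C \<in> p" for C using z that by (auto simp: space_PC space_PiM)
    have "(\<integral>\<^sup>+N. T (add_points N p z) * G (add_points N p z) \<partial>tilted_law v) =
        (\<integral>\<^sup>+N. T N * G (add_points N p z) + (\<Sum>C\<in>p. ennreal (H (z C))) * G (add_points N p z) \<partial>tilted_law v)"
      using p zC by (intro nn_integral_cong) (simp add: space_Q T_add_points distrib_right)
    also have "\<dots> = (\<integral>\<^sup>+N. T N * G (add_points N p z) \<partial>tilted_law v) + (\<Sum>C\<in>p. ennreal (H (z C))) * ?g z"
      by (subst nn_integral_add) (auto simp: nn_integral_cmult)
    \<comment> \<open>The points of \<open>p\<close> are frozen and absorbed into the functional to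
      which the Mecke formula is applied.\<close>
    also have "(\<integral>\<^sup>+N. T N * G (add_points N p z) \<partial>tilted_law v) = (\<integral>\<^sup>+x. ennreal (H x) * ?g1 p z x \<partial>tilted v)"
      unfolding T_def using mecke_tilted[OF v, unfolded mecke_def, rule_format,
          of "\<lambda>x. ennreal (H x)" "\<lambda>N. G (add_points N p z)"]
      by (simp add: measure_algebra_cong[OF sets_tilted])
    finally show ?thesis by (simp only: sum_distrib_right)
  qed
  have "cell_term (\<lambda>N. T N * G N) v p =
      ?K p * (\<integral>\<^sup>+z. (\<integral>\<^sup>+x. ennreal (H x) * ?g1 p z x \<partial>tilted v) + (\<Sum>C\<in>p. ennreal (H (z C)) * ?g z) \<partial>?PC p)"
    unfolding cell_term_def by (simp add: inner cong: nn_integral_cong)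
  also have "(\<integral>\<^sup>+z. (\<integral>\<^sup>+x. ennreal (H x) * ?g1 p z x \<partial>tilted v) + (\<Sum>C\<in>p. ennreal (H (z C)) * ?g z) \<partial>?PC p) =
      (\<integral>\<^sup>+z. (\<integral>\<^sup>+x. ennreal (H x) * ?g1 p z x \<partial>tilted v) \<partial>?PC p) +
      (\<Sum>C\<in>p. \<integral>\<^sup>+z. ennreal (H (z C)) * ?g z \<partial>?PC p)"
    using gm1 gmC by (subst nn_integral_add) (auto simp: nn_integral_sum)
  also have "?K p * \<dots> = ?K p * (\<integral>\<^sup>+z. (\<integral>\<^sup>+x. ennreal (H x) * ?g1 p z x \<partial>tilted v) \<partial>?PC p) +
      (\<Sum>C\<in>p. ?K p * (\<integral>\<^sup>+z. ennreal (H (z C)) * ?g z \<partial>?PC p))"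
    by (simp add: distrib_left sum_distrib_left)
  also have "?K p * (\<integral>\<^sup>+z. (\<integral>\<^sup>+x. ennreal (H x) * ?g1 p z x \<partial>tilted v) \<partial>?PC p) = cell_term G v (insert {a} p)"
    using a p(1) v by (subst cell_term_insert) auto
  also have "(\<Sum>C\<in>p. ?K p * (\<integral>\<^sup>+z. ennreal (H (z C)) * ?g z \<partial>?PC p)) =
      (\<Sum>C\<in>p. cell_term G v (insert (insert a C) (p - {C})))"
  proof (rule sum.cong[OF refl])
    fix C assume C: "C \<in> p"
    let ?p = "p - {C}"
    have pC: "p = insert C ?p" "C \<notin> ?p" "finite ?p" using C p by auto
    have fC: "finite C" "C \<noteq> {}" "a \<notin> C" using p(2)[OF C] a C by auto
    have card: "0 < card C" using fC by (simp add: card_gt_0_iff)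
    have g1[measurable]: "(\<lambda>(z, x). ?g1 ?p z x) \<in> borel_measurable (PiM ?p (\<lambda>_. \<nu>) \<Otimes>\<^sub>M \<nu>)"
      by (rule measurable_nn_integral_add_points(2)[OF pC(3) G])
    have g1z: "(\<lambda>x. ennreal (H x) * ?g1 ?p z x) \<in> borel_measurable \<nu>" if "z \<in> space (?PC ?p)" for z
      using that measurable_Pair_compose_split[OF g1, of "\<lambda>_. z" \<nu> "\<lambda>x. x"]
      by (intro borel_measurable_times_ennreal) (simp_all add: space_PC)
    interpret W: sigma_finite_measure "point_law (card C) v" by (rule sigma_finite_point_law)
    have gm: "(\<lambda>z. \<integral>\<^sup>+x. ennreal (H x) * ?g1 ?p z x \<partial>point_law (card C) v) \<in> borel_measurable (?PC ?p)"
    proof (rule W.borel_measurable_nn_integral)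
      have "(\<lambda>zx. ennreal (H (snd zx)) * (\<lambda>(z, x). ?g1 ?p z x) zx) \<in> borel_measurable (PiM ?p (\<lambda>_. \<nu>) \<Otimes>\<^sub>M \<nu>)"
        by measurable
      then show "(\<lambda>(z, x). ennreal (H x) * ?g1 ?p z x) \<in> borel_measurable (?PC ?p \<Otimes>\<^sub>M point_law (card C) v)"
        by (subst measurable_cong_sets[OF sets_pair_measure_cong[OF sets_PiM_point_law sets_point_law] refl])
           (simp add: split_beta')
    qed
    have "?K p = moment (card C) v * ?K ?p" using pC by (metis prod.insert)
    moreover have "(\<integral>\<^sup>+z. ennreal (H (z C)) * ?g z \<partial>?PC p) =
        (\<integral>\<^sup>+z. (\<integral>\<^sup>+x. ennreal (H x) * ?g1 ?p z x \<partial>point_law (card C) v) \<partial>?PC ?p)"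
      using nn_integral_PiM_insert[OF pC(3,2) G, of "\<lambda>x. ennreal (H x)" v] pC(1) by simp
    ultimately have "?K p * (\<integral>\<^sup>+z. ennreal (H (z C)) * ?g z \<partial>?PC p) =
        ?K ?p * (moment (card C) v * (\<integral>\<^sup>+z. (\<integral>\<^sup>+x. ennreal (H x) * ?g1 ?p z x \<partial>point_law (card C) v) \<partial>?PC ?p))"
      by (simp only: mult_ac)
    also have "moment (card C) v * (\<integral>\<^sup>+z. (\<integral>\<^sup>+x. ennreal (H x) * ?g1 ?p z x \<partial>point_law (card C) v) \<partial>?PC ?p) =
        (\<integral>\<^sup>+z. moment (card C) v * (\<integral>\<^sup>+x. ennreal (H x) * ?g1 ?p z x \<partial>point_law (card C) v) \<partial>?PC ?p)"
      using gm by (rule nn_integral_cmult[symmetric])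
    also have "\<dots> = (\<integral>\<^sup>+z. (\<integral>\<^sup>+x. ennreal (H x ^ card C) * (ennreal (H x) * ?g1 ?p z x) \<partial>tilted v) \<partial>?PC ?p)"
      using g1z by (intro nn_integral_cong nn_integral_point_law v card)
    \<comment> \<open>Since \<open>a \<notin> C\<close>, the extra factor \<open>H x\<close>
      accounts exactly for the increase of the cardinality.\<close>
    also have "\<dots> = (\<integral>\<^sup>+z. (\<integral>\<^sup>+x. ennreal (H x ^ card (insert a C)) * ?g1 ?p z x \<partial>tilted v) \<partial>?PC ?p)"
      using fC H_pos by (intro nn_integral_cong)
        (simp add: mult.assoc[symmetric] ennreal_mult[symmetric] less_imp_le mult.commute)
    also have "?K ?p * \<dots> = cell_term G v (insert (insert a C) ?p)"
      using a fC pC v by (subst cell_term_insert) auto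
    finally show "?K p * (\<integral>\<^sup>+z. ennreal (H (z C)) * ?g z \<partial>?PC p) = cell_term G v (insert (insert a C) ?p)" .
  qed
  finally show ?thesis .
qed

text \<open>Each step moves one factor \<open>T\<close> into the functional, so the induction runs
  over all \<open>G\<close>; the recursion for cell terms is the one for partitions of a set with
  one more element. For \<open>n = 0\<close> the only partition is empty, and so are the products
  over it.\<close>

lemma nn_integral_T_power:
  assumes v: "0 < v" and "G \<in> borel_measurable (measure_algebra \<nu>)"
  shows "(\<integral>\<^sup>+N. T N ^ n * G N \<partial>tilted_law v) = (\<Sum>p\<in>{p. partition_on {1..n} p}. cell_term G v p)"
  using assms(2)
proof (induct n arbitrary: G)
  case 0
  have "{p. partition_on {1..0::nat} p} = {{}}" by (auto simp: partition_on_empty)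
  then show ?case
    by (simp add: cell_term_def PiM_empty)
next
  case (Suc n)
  note [measurable] = Suc.prems
  have "(\<integral>\<^sup>+N. T N ^ Suc n * G N \<partial>tilted_law v) = (\<integral>\<^sup>+N. T N ^ n * (T N * G N) \<partial>tilted_law v)"
    by (simp add: mult_ac)
  also have "\<dots> = (\<Sum>p\<in>{p. partition_on {1..n} p}. cell_term (\<lambda>N. T N * G N) v p)"
    by (rule Suc.hyps) measurable
  also have "\<dots> = (\<Sum>p\<in>{p. partition_on {1..n} p}. cell_term G v (insert {Suc n} p) +
      (\<Sum>C\<in>p. cell_term G v (insert (insert (Suc n) C) (p - {C}))))"
  proof (rule sum.cong[OF refl])
    fix p assume "p \<in> {p. partition_on {1..n} p}"
    then have p: "partition_on {1..n} p" by simp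
    then have U: "\<Union>p = {1..n}" "{} \<notin> p" by (auto simp: partition_on_def)
    show "cell_term (\<lambda>N. T N * G N) v p = cell_term G v (insert {Suc n} p) +
        (\<Sum>C\<in>p. cell_term G v (insert (insert (Suc n) C) (p - {C})))"
    proof (rule cell_term_T)
      show "finite p" using finite_elements[OF _ p] by simp
      show "finite C \<and> C \<noteq> {}" if "C \<in> p" for C
        using U that finite_subset[of C "{1..n}"] by auto
      show "Suc n \<notin> \<Union>p" using U by simp
    qed (use v in auto)
  qed
  also have "\<dots> = (\<Sum>q\<in>{q. partition_on {1..Suc n} q}. cell_term G v q)"
    by (subst sum_partition_on_insert[symmetric]) (auto simp: atLeastAtMostSuc_conv)
  finally show ?case .
qed

end

subsection \<open>Gamma mixtures\<close>

text \<open>Euler's integral under the substitution \<open>v \<mapsto> t * v\<close>, solved for the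
  scaled integral.\<close>

lemma nn_integral_Gamma_scaled:
  fixes s t :: real
  assumes s: "0 < s" and t: "0 < t"
  shows "(\<integral>\<^sup>+v. ennreal (v powr (s - 1)) * ennreal (exp (- v * t)) \<partial>restrict_space lborel {0<..}) =
    ennreal (Gamma s * t powr (- s))"
proof -
  let ?I = "\<integral>\<^sup>+v. ennreal (v powr (s - 1)) * ennreal (exp (- v * t)) \<partial>restrict_space lborel {0<..}"
  have "ennreal (Gamma s) = (\<integral>\<^sup>+v. ennreal (indicator {0..} v * v powr (s - 1) / exp v) \<partial>lborel)"
    by (rule Gamma_conv_nn_integral_real[OF s])
  also have "\<dots> = ennreal t * (\<integral>\<^sup>+v. ennreal (indicator {0..} (t * v) * (t * v) powr (s - 1) / exp (t * v)) \<partial>lborel)"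
    using t by (subst nn_integral_real_affine[where c=t and t=0]) auto
  also have "(\<integral>\<^sup>+v. ennreal (indicator {0..} (t * v) * (t * v) powr (s - 1) / exp (t * v)) \<partial>lborel) =
      (\<integral>\<^sup>+v. ennreal (t powr (s - 1)) * (ennreal (v powr (s - 1)) * ennreal (exp (- v * t)) * indicator {0<..} v) \<partial>lborel)"
  proof (rule nn_integral_cong)
    fix v :: real
    show "ennreal (indicator {0..} (t * v) * (t * v) powr (s - 1) / exp (t * v)) =
        ennreal (t powr (s - 1)) * (ennreal (v powr (s - 1)) * ennreal (exp (- v * t)) * indicator {0<..} v)"
    proof (cases "0 < v")
      case True
      then show ?thesis using t
        by (simp add: ennreal_mult[symmetric] powr_mult exp_minus divide_inverse mult_ac)
    next
      \<comment> \<open>At \<open>v = 0\<close> both integrands vanish because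
        \<open>0 powr (s - 1) = 0\<close> by convention, so the closed half-line can be replaced by
        the open one pointwise.\<close>
      case False
      then show ?thesis using t
        by (cases "v = 0") (auto simp: indicator_def zero_le_mult_iff)
    qed
  qed
  also have "\<dots> = ennreal (t powr (s - 1)) * ?I"
    by (subst nn_integral_restrict_space) (auto intro!: nn_integral_cmult)
  finally have "ennreal (Gamma s) = ennreal (t * t powr (s - 1)) * ?I"
    using t by (simp add: ennreal_mult mult.assoc)
  also have "t * t powr (s - 1) = t powr s"
    using t by (simp add: powr_diff)
  finally have "ennreal (t powr (- s)) * ennreal (Gamma s) = ennreal (t powr (- s)) * (ennreal (t powr s) * ?I)"
    by simp
  also have "\<dots> = ?I"
    using t by (simp add: mult.assoc[symmetric] ennreal_mult[symmetric] powr_add[symmetric])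
  finally show ?thesis
    using s Gamma_real_nonneg[of s] by (simp add: ennreal_mult[symmetric] mult.commute less_imp_le)
qed

lemma ennreal_mult_divide_cancel_left:
  fixes a b c :: ennreal
  assumes "a \<noteq> 0" "a \<noteq> \<infinity>" "c \<noteq> \<infinity>"
  shows "a * b / (a * c) = b / c"
proof -
  have "a * b / (a * c) = (a / a) * (b / c)"
    using assms by (simp add: divide_ennreal_def ennreal_inverse_mult less_top[symmetric] mult_ac)
  then show ?thesis using assms by (simp add: less_top[symmetric])
qed

text \<open>Both sides agree on rectangles. The point laws depend on \<open>v\<close> through their
  densities alone, and this pulls the dependence out of the product measure.\<close>

lemma PiM_density:
  assumes I: "finite I" and M: "product_sigma_finite M"
    and Mf: "product_sigma_finite (\<lambda>i. density (M i) (f i))"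
    and f: "\<And>i. i \<in> I \<Longrightarrow> f i \<in> borel_measurable (M i)"
  shows "PiM I (\<lambda>i. density (M i) (f i)) = density (PiM I M) (\<lambda>x. \<Prod>i\<in>I. f i (x i))"
proof -
  interpret M: product_sigma_finite M by fact
  interpret Mf: product_sigma_finite "\<lambda>i. density (M i) (f i)" by fact
  have fx: "(\<lambda>x. f i (x i)) \<in> borel_measurable (PiM I M)" if "i \<in> I" for i
    using that f by (intro measurable_compose[OF measurable_component_singleton]) auto
  show ?thesis
  proof (rule Mf.PiM_eqI[OF I, symmetric])
    show "sets (density (PiM I M) (\<lambda>x. \<Prod>i\<in>I. f i (x i))) = sets (PiM I (\<lambda>i. density (M i) (f i)))"
      by (simp cong: sets_PiM_cong)
    fix A assume "\<And>i. i \<in> I \<Longrightarrow> A i \<in> sets (density (M i) (f i))"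
    then have A: "A i \<in> sets (M i)" if "i \<in> I" for i using that by simp
    have "emeasure (density (PiM I M) (\<lambda>x. \<Prod>i\<in>I. f i (x i))) (Pi\<^sub>E I A) =
        (\<integral>\<^sup>+x. (\<Prod>i\<in>I. f i (x i)) * indicator (Pi\<^sub>E I A) x \<partial>PiM I M)"
    proof (rule emeasure_density)
      show "(\<lambda>x. \<Prod>i\<in>I. f i (x i)) \<in> borel_measurable (PiM I M)"
        using fx by (rule borel_measurable_prod_ennreal)
      show "Pi\<^sub>E I A \<in> sets (PiM I M)" using I A by (rule sets_PiM_I_finite)
    qed
    also have "\<dots> = (\<integral>\<^sup>+x. (\<Prod>i\<in>I. f i (x i) * indicator (A i) (x i)) \<partial>PiM I M)"
    proof (rule nn_integral_cong)
      fix x assume x: "x \<in> space (PiM I M)"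
      have "indicator (Pi\<^sub>E I A) x = (\<Prod>i\<in>I. indicator (A i) (x i) :: ennreal)"
      proof (cases "\<forall>i\<in>I. x i \<in> A i")
        case True
        then show ?thesis using x by (simp add: space_PiM PiE_iff)
      next
        case False
        then obtain i where "i \<in> I" "x i \<notin> A i" by auto
        then have "(\<Prod>i\<in>I. indicator (A i) (x i) :: ennreal) = 0"
          using I by (intro prod_zero bexI[of _ i]) auto
        then show ?thesis using \<open>i \<in> I\<close> \<open>x i \<notin> A i\<close> by (auto simp: indicator_def PiE_iff)
      qed
      then show "(\<Prod>i\<in>I. f i (x i)) * indicator (Pi\<^sub>E I A) x = (\<Prod>i\<in>I. f i (x i) * indicator (A i) (x i))"
        by (simp add: prod.distrib)
    qed
    also have "\<dots> = (\<Prod>i\<in>I. \<integral>\<^sup>+x. f i x * indicator (A i) x \<partial>M i)"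
      using A f I by (intro M.product_nn_integral_prod) auto
    also have "\<dots> = (\<Prod>i\<in>I. emeasure (density (M i) (f i)) (A i))"
      using A f by (intro prod.cong refl emeasure_density[symmetric]) auto
    finally show "emeasure (density (PiM I M) (\<lambda>x. \<Prod>i\<in>I. f i (x i))) (Pi\<^sub>E I A) = \<dots>" .
  qed
qed

context poisson_mass
begin

text \<open>At \<open>T = 0\<close> and \<open>T = \<infinity>\<close> the value is 0, by the
  conventions \<open>enn2real \<infinity> = 0\<close> and \<open>0 powr x = 0\<close>; these are
  null events.\<close>

definition T_inv :: "real \<Rightarrow> 'c measure \<Rightarrow> ennreal" where
  "T_inv \<theta> N = ennreal (enn2real (T N) powr (- \<theta>))"

definition E_inv :: "real \<Rightarrow> ennreal" where
  "E_inv \<theta> = (\<integral>\<^sup>+N. T_inv \<theta> N \<partial>P)"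

definition biased_law :: "real \<Rightarrow> 'c measure measure" where
  "biased_law \<theta> = density P (\<lambda>N. T_inv \<theta> N / E_inv \<theta>)"

lemma T_inv_meas [measurable]: "T_inv \<theta> \<in> borel_measurable (measure_algebra \<nu>)"
  unfolding T_inv_def[abs_def] by measurable

lemma E_inv_neq_0: "E_inv \<theta> \<noteq> 0"
proof
  assume "E_inv \<theta> = 0"
  then have "AE N in P. T_inv \<theta> N = 0"
    unfolding E_inv_def by (subst (asm) nn_integral_0_iff_AE) auto
  with T_finite T_pos have "AE N in P. False"
    by eventually_elim (auto simp: T_inv_def ennreal_eq_0_iff enn2real_eq_0_iff not_le)
  then show False by (simp add: P.AE_False)
qed

lemma nn_integral_biased_law:
  assumes [measurable]: "G \<in> borel_measurable (measure_algebra \<nu>)"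
  shows "(\<integral>\<^sup>+N. G N \<partial>biased_law \<theta>) = (\<integral>\<^sup>+N. T_inv \<theta> N * G N \<partial>P) / E_inv \<theta>"
proof -
  have "(\<integral>\<^sup>+N. G N \<partial>biased_law \<theta>) = (\<integral>\<^sup>+N. T_inv \<theta> N / E_inv \<theta> * G N \<partial>P)"
    unfolding biased_law_def by (subst nn_integral_density) auto
  also have "\<dots> = (\<integral>\<^sup>+N. T_inv \<theta> N * G N / E_inv \<theta> \<partial>P)"
    by (simp add: divide_ennreal_def mult_ac)
  also have "\<dots> = (\<integral>\<^sup>+N. T_inv \<theta> N * G N \<partial>P) / E_inv \<theta>"
    by (rule nn_integral_divide) measurable
  finally show ?thesis .
qed

lemma lap_mult_nn_integral_tilted_law:
  assumes "f \<in> borel_measurable (measure_algebra \<nu>)"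
  shows "lap v * (\<integral>\<^sup>+N. f N \<partial>tilted_law v) = (\<integral>\<^sup>+N. exp_neg (ennreal v * T N) * f N \<partial>P)"
  using lap_neq_0[of v] lap_neq_top[of v] unfolding nn_integral_tilted_law[OF assms]
  by (simp add: ennreal_times_divide mult.commute[of "lap v"] ennreal_mult_divide_eq)

lemma lap_meas [measurable]: "lap \<in> borel_measurable borel"
  unfolding lap_def[abs_def] by measurable

lemma moment_meas [measurable]: "(\<lambda>v. moment m v) \<in> borel_measurable borel"
  unfolding moment_altdef by measurable

section \<open>The Gamma integral over \<open>v\<close> and the mixture without partitions\<close>

abbreviation pos_half_line :: "real measure" where
  "pos_half_line \<equiv> restrict_space lborel {0<..}"

lemma Gamma_mixture_T:
  assumes s: "0 < \<theta> + real n" and T: "T N < \<infinity>" "0 < T N"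
  shows "(\<integral>\<^sup>+v. ennreal (v powr (\<theta> + real n - 1)) * (exp_neg (ennreal v * T N) * T N ^ n) \<partial>pos_half_line) =
    ennreal (Gamma (\<theta> + real n)) * T_inv \<theta> N"
proof -
  obtain t where t: "T N = ennreal t" "0 < t"
    using T by (cases "T N") auto
  have "(\<integral>\<^sup>+v. ennreal (v powr (\<theta> + real n - 1)) * (exp_neg (ennreal v * T N) * T N ^ n) \<partial>pos_half_line) =
      (\<integral>\<^sup>+v. ennreal (t ^ n) * (ennreal (v powr (\<theta> + real n - 1)) * ennreal (exp (- v * t))) \<partial>pos_half_line)"
  proof (rule nn_integral_cong)
    fix v assume "v \<in> space pos_half_line"
    then have "0 < v" by (simp add: space_restrict_space)
    then show "ennreal (v powr (\<theta> + real n - 1)) * (exp_neg (ennreal v * T N) * T N ^ n) =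
        ennreal (t ^ n) * (ennreal (v powr (\<theta> + real n - 1)) * ennreal (exp (- v * t)))"
      using t by (simp add: ennreal_mult[symmetric] exp_neg_ennreal ennreal_power mult_ac)
  qed
  also have "\<dots> = ennreal (t ^ n) * ennreal (Gamma (\<theta> + real n) * t powr (- (\<theta> + real n)))"
    unfolding nn_integral_Gamma_scaled[OF s t(2), symmetric]
    by (rule nn_integral_cmult) (auto intro!: measurable_restrict_space1)
  also have "\<dots> = ennreal (Gamma (\<theta> + real n) * (t ^ n * t powr (- (\<theta> + real n))))"
    using t s by (simp add: ennreal_mult[symmetric] less_imp_le mult_ac)
  also have "t ^ n * t powr (- (\<theta> + real n)) = t powr (- \<theta>)"
    using t by (simp add: powr_realpow[symmetric] powr_add[symmetric])
  finally show ?thesis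
    using t s by (simp add: T_inv_def ennreal_mult less_imp_le)
qed

text \<open>Multiplying by \<open>lap v\<close> replaces the tilted law by the weight
  \<open>e^{-vT}\<close> under \<open>P\<close>. Tonelli then exchanges \<open>v\<close> and
  \<open>N\<close>, and for almost every \<open>N\<close> the inner integral is a Gamma integral.
  Positivity is asked of \<open>\<theta> + n\<close>, so \<open>\<theta>\<close> may be
  negative.\<close>

lemma Gamma_mixture:
  assumes s: "0 < \<theta> + real n" and G[measurable]: "G \<in> borel_measurable (measure_algebra \<nu>)"
  shows "(\<integral>\<^sup>+v. ennreal (v powr (\<theta> + real n - 1)) *
      (lap v * (\<integral>\<^sup>+N. T N ^ n * G N \<partial>tilted_law v)) \<partial>pos_half_line) =
    ennreal (Gamma (\<theta> + real n)) * (\<integral>\<^sup>+N. T_inv \<theta> N * G N \<partial>P)"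
proof -
  interpret R: sigma_finite_measure pos_half_line
    by (intro sigma_finite_measure_restrict_space) (auto intro: lborel.sigma_finite_measure_axioms)
  interpret RP: pair_sigma_finite pos_half_line P ..
  let ?f = "\<lambda>v N. ennreal (v powr (\<theta> + real n - 1)) * (exp_neg (ennreal v * T N) * T N ^ n)"
  have id[measurable]: "(\<lambda>v. v) \<in> borel_measurable pos_half_line"
    by (intro measurable_restrict_space1) simp
  have f[measurable]: "(\<lambda>(v, N). ?f v N * G N) \<in> borel_measurable (pos_half_line \<Otimes>\<^sub>M P)"
    by measurable
  have f1: "(\<lambda>v. ?f v N) \<in> borel_measurable pos_half_line" for N
    by measurable
  have "(\<integral>\<^sup>+v. ennreal (v powr (\<theta> + real n - 1)) *
      (lap v * (\<integral>\<^sup>+N. T N ^ n * G N \<partial>tilted_law v)) \<partial>pos_half_line) =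
      (\<integral>\<^sup>+v. (\<integral>\<^sup>+N. ?f v N * G N \<partial>P) \<partial>pos_half_line)"
    by (subst lap_mult_nn_integral_tilted_law) (auto simp: nn_integral_cmult mult.assoc)
  also have "\<dots> = (\<integral>\<^sup>+N. (\<integral>\<^sup>+v. ?f v N * G N \<partial>pos_half_line) \<partial>P)"
    by (rule RP.Fubini'[symmetric, OF f])
  also have "\<dots> = (\<integral>\<^sup>+N. ennreal (Gamma (\<theta> + real n)) * (T_inv \<theta> N * G N) \<partial>P)"
  proof (rule nn_integral_cong_AE)
    show "AE N in P. (\<integral>\<^sup>+v. ?f v N * G N \<partial>pos_half_line) = ennreal (Gamma (\<theta> + real n)) * (T_inv \<theta> N * G N)"
      using T_finite T_pos
    proof eventually_elim
      case (elim N)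
      show ?case
        using f1 by (subst nn_integral_multc) (simp_all add: Gamma_mixture_T[OF s elim] mult.assoc)
    qed
  qed
  also have "\<dots> = ennreal (Gamma (\<theta> + real n)) * (\<integral>\<^sup>+N. T_inv \<theta> N * G N \<partial>P)"
    by (rule nn_integral_cmult) measurable
  finally show ?thesis .
qed

text \<open>\<open>bind\<close> needs a measurable kernel. The tilted probability of an event is a
  quotient of integrals over the fixed law \<open>P\<close> whose integrands are jointly measurable
  in \<open>v\<close> and \<open>N\<close>.\<close>

lemma measurable_tilted_law: "tilted_law \<in> measurable pos_half_line (subprob_algebra (measure_algebra \<nu>))"
proof (rule measurable_subprob_algebra)
  fix A assume [measurable]: "A \<in> sets (measure_algebra \<nu>)"
  have "emeasure (tilted_law v) A = (\<integral>\<^sup>+N. exp_neg (ennreal v * T N) * indicator A N \<partial>P) / lap v" for v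
    using nn_integral_tilted_law[of "indicator A" v] by simp
  moreover have "(\<lambda>v. (\<integral>\<^sup>+N. exp_neg (ennreal v * T N) * indicator A N \<partial>P) / lap v) \<in> borel_measurable borel"
    by measurable
  ultimately show "(\<lambda>v. emeasure (tilted_law v) A) \<in> borel_measurable pos_half_line"
    by (intro measurable_restrict_space1) simp
qed (auto intro: prob_space_imp_subprob_space prob_space_tilted_law)

text \<open>The counterpart of \<open>pi_mix\<close> in the abstract setting, as
  \<open>mixing_partition_law\<close> is that of \<open>pi_part\<close>.\<close>

definition mixing_law :: "real \<Rightarrow> real measure" where
  "mixing_law \<theta> = density pos_half_line
     (\<lambda>v. ennreal (v powr (\<theta> - 1)) * lap v / (ennreal (Gamma \<theta>) * E_inv \<theta>))"

lemma sets_mixing_law [simp, measurable_cong]: "sets (mixing_law \<theta>) = sets pos_half_line"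
  by (simp add: mixing_law_def)

text \<open>The Gamma mixture with \<open>n = 0\<close>; the factor \<open>Gamma \<theta>\<close> is
  positive and finite and cancels.\<close>

lemma nn_integral_mixing_law:
  assumes \<theta>: "0 < \<theta>" and E: "E_inv \<theta> < \<infinity>" and G[measurable]: "G \<in> borel_measurable (measure_algebra \<nu>)"
  shows "(\<integral>\<^sup>+v. (\<integral>\<^sup>+N. G N \<partial>tilted_law v) \<partial>mixing_law \<theta>) = (\<integral>\<^sup>+N. G N \<partial>biased_law \<theta>)"
proof -
  let ?c = "ennreal (Gamma \<theta>) * E_inv \<theta>"
  have g: "(\<lambda>v. \<integral>\<^sup>+N. G N \<partial>tilted_law v) \<in> borel_measurable pos_half_line"
    using measurable_compose[OF measurable_tilted_law nn_integral_measurable_subprob_algebra[OF G]] by simp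
  have [measurable]: "(\<lambda>v. ennreal (v powr (\<theta> - 1)) * lap v) \<in> borel_measurable pos_half_line"
    by (intro measurable_restrict_space1) measurable
  have "(\<integral>\<^sup>+v. (\<integral>\<^sup>+N. G N \<partial>tilted_law v) \<partial>mixing_law \<theta>) =
      (\<integral>\<^sup>+v. ennreal (v powr (\<theta> - 1)) * lap v / ?c * (\<integral>\<^sup>+N. G N \<partial>tilted_law v) \<partial>pos_half_line)"
    unfolding mixing_law_def using g by (subst nn_integral_density) auto
  also have "\<dots> = (\<integral>\<^sup>+v. ennreal (v powr (\<theta> - 1)) * (lap v * (\<integral>\<^sup>+N. G N \<partial>tilted_law v)) / ?c \<partial>pos_half_line)"
    by (simp add: divide_ennreal_def mult_ac)
  also have "\<dots> = (\<integral>\<^sup>+v. ennreal (v powr (\<theta> - 1)) * (lap v * (\<integral>\<^sup>+N. G N \<partial>tilted_law v)) \<partial>pos_half_line) / ?c"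
    using g by (intro nn_integral_divide) (auto simp: mult.assoc[symmetric])
  also have "(\<integral>\<^sup>+v. ennreal (v powr (\<theta> - 1)) * (lap v * (\<integral>\<^sup>+N. G N \<partial>tilted_law v)) \<partial>pos_half_line) =
      ennreal (Gamma \<theta>) * (\<integral>\<^sup>+N. T_inv \<theta> N * G N \<partial>P)"
    using Gamma_mixture[of \<theta> 0 G] \<theta> by simp
  also have "\<dots> / ?c = (\<integral>\<^sup>+N. T_inv \<theta> N * G N \<partial>P) / E_inv \<theta>"
    using \<theta> E_inv_neq_0[of \<theta>] E
    by (intro ennreal_mult_divide_cancel_left) (auto simp: ennreal_eq_0_iff not_le)
  finally show ?thesis unfolding nn_integral_biased_law[OF G] .
qed

lemma sets_biased_law [simp, measurable_cong]: "sets (biased_law \<theta>) = sets (measure_algebra \<nu>)"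
  by (simp add: biased_law_def sets_P)

lemma nn_integral_biased_law_1:
  assumes E: "E_inv \<theta> < \<infinity>"
  shows "(\<integral>\<^sup>+N. 1 \<partial>biased_law \<theta>) = 1"
  using E E_inv_neq_0[of \<theta>] nn_integral_biased_law[of "\<lambda>_. 1" \<theta>]
  by (simp add: E_inv_def[symmetric] ennreal_divide_self)

text \<open>The mixture identity with \<open>G = 1\<close> computes the total mass, so the
  normalisation needs no separate integral.\<close>

lemma prob_space_mixing_law:
  assumes "0 < \<theta>" "E_inv \<theta> < \<infinity>"
  shows "prob_space (mixing_law \<theta>)"
proof
  have "emeasure (mixing_law \<theta>) (space (mixing_law \<theta>)) =
      (\<integral>\<^sup>+v. (\<integral>\<^sup>+N. 1 \<partial>tilted_law v) \<partial>mixing_law \<theta>)"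
    using prob_space.emeasure_space_1[OF prob_space_tilted_law] by simp
  also have "\<dots> = 1"
    using nn_integral_mixing_law[OF assms, of "\<lambda>_. 1"] nn_integral_biased_law_1[OF assms(2)] by simp
  finally show "emeasure (mixing_law \<theta>) (space (mixing_law \<theta>)) = 1" .
qed

lemma biased_law_eq_bind:
  assumes "0 < \<theta>" "E_inv \<theta> < \<infinity>"
  shows "biased_law \<theta> = bind (mixing_law \<theta>) tilted_law"
proof (rule measure_eqI)
  interpret prob_space "mixing_law \<theta>" by (rule prob_space_mixing_law[OF assms])
  have m: "tilted_law \<in> measurable (mixing_law \<theta>) (subprob_algebra (measure_algebra \<nu>))"
    using measurable_tilted_law by measurable
  show "sets (biased_law \<theta>) = sets (bind (mixing_law \<theta>) tilted_law)"
    using sets_bind[OF _ not_empty, of tilted_law "measure_algebra \<nu>"] by simp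
  fix A assume "A \<in> sets (biased_law \<theta>)"
  then have A[measurable]: "A \<in> sets (measure_algebra \<nu>)" by simp
  have "emeasure (biased_law \<theta>) A = (\<integral>\<^sup>+v. (\<integral>\<^sup>+N. indicator A N \<partial>tilted_law v) \<partial>mixing_law \<theta>)"
    using A by (subst nn_integral_mixing_law[OF assms]) auto
  also have "\<dots> = emeasure (bind (mixing_law \<theta>) tilted_law) A"
    using A by (subst emeasure_bind[OF not_empty m A]) simp
  finally show "emeasure (biased_law \<theta>) A = emeasure (bind (mixing_law \<theta>) tilted_law) A" .
qed

text \<open>The counterpart of \<open>N_law\<close> for the tilted kernel: the added points are
  integrated out and only the resulting measure is kept.\<close>

definition added_law :: "real \<Rightarrow> nat set set \<Rightarrow> 'c measure measure" where
  "added_law v p = distr (tilted_law v \<Otimes>\<^sub>M PiM p (\<lambda>C. point_law (card C) v)) (measure_algebra \<nu>)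
     (\<lambda>(N, z). add_points N p z)"

lemma sets_added_law [simp, measurable_cong]: "sets (added_law v p) = sets (measure_algebra \<nu>)"
  by (simp add: added_law_def)

lemma measurable_add_points_pair:
  assumes p: "finite p" and "sets K = sets (measure_algebra \<nu>)" "sets L = sets (PiM p (\<lambda>_. \<nu>))"
  shows "(\<lambda>(N, z). add_points N p z) \<in> measurable (K \<Otimes>\<^sub>M L) (measure_algebra \<nu>)"
proof -
  have "(\<lambda>(N, z). add_points N p z) \<in> measurable (measure_algebra \<nu> \<Otimes>\<^sub>M PiM p (\<lambda>_. \<nu>)) (measure_algebra \<nu>)"
    unfolding split_beta' using p
    by (intro measurable_add_points) (auto intro!: measurable_compose[OF measurable_snd measurable_component_singleton])
  then show ?thesis
    by (subst measurable_cong_sets[OF sets_pair_measure_cong[OF assms(2,3)] refl])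
qed

lemma nn_integral_added_law:
  assumes p: "finite p" and G[measurable]: "G \<in> borel_measurable (measure_algebra \<nu>)"
  shows "(\<integral>\<^sup>+N. G N \<partial>added_law v p) =
    (\<integral>\<^sup>+z. (\<integral>\<^sup>+N. G (add_points N p z) \<partial>tilted_law v) \<partial>PiM p (\<lambda>C. point_law (card C) v))"
proof -
  interpret W: product_sigma_finite "\<lambda>C. point_law (card C) v" by (rule product_sigma_finite_point_law)
  interpret Q: prob_space "tilted_law v" by (rule prob_space_tilted_law)
  interpret PC: sigma_finite_measure "PiM p (\<lambda>C. point_law (card C) v)" by (rule W.sigma_finite[OF p])
  interpret QC: pair_sigma_finite "tilted_law v" "PiM p (\<lambda>C. point_law (card C) v)" ..
  have m: "(\<lambda>(N, z). add_points N p z) \<in>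
      measurable (tilted_law v \<Otimes>\<^sub>M PiM p (\<lambda>C. point_law (card C) v)) (measure_algebra \<nu>)"
    by (intro measurable_add_points_pair p sets_PiM_point_law) simp
  have "(\<integral>\<^sup>+N. G N \<partial>added_law v p) =
      (\<integral>\<^sup>+x. G (case x of (N, z) \<Rightarrow> add_points N p z) \<partial>(tilted_law v \<Otimes>\<^sub>M PiM p (\<lambda>C. point_law (card C) v)))"
    unfolding added_law_def using m by (subst nn_integral_distr) auto
  also have "\<dots> = (\<integral>\<^sup>+z. (\<integral>\<^sup>+N. G (add_points N p z) \<partial>tilted_law v) \<partial>PiM p (\<lambda>C. point_law (card C) v))"
    using measurable_compose[OF m G] by (subst QC.nn_integral_snd[symmetric]) auto
  finally show ?thesis .
qed

lemma cell_term_eq_added_law: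
  assumes "finite p" "G \<in> borel_measurable (measure_algebra \<nu>)"
  shows "cell_term G v p = (\<Prod>C\<in>p. moment (card C) v) * (\<integral>\<^sup>+N. G N \<partial>added_law v p)"
  by (simp add: cell_term_def nn_integral_added_law[OF assms])

lemma prob_space_added_law:
  assumes p: "finite p" "\<And>C. C \<in> p \<Longrightarrow> finite C \<and> C \<noteq> {}" and v: "0 < v"
  shows "prob_space (added_law v p)"
proof
  interpret Q: prob_space "tilted_law v" by (rule prob_space_tilted_law)
  have "prob_space (PiM p (\<lambda>C. point_law (card C) v))"
    using p(2) v by (intro prob_space_PiM prob_space_point_law) (auto simp: card_gt_0_iff)
  then have "(\<integral>\<^sup>+N. 1 \<partial>added_law v p) = 1"
    using Q.emeasure_space_1 by (subst nn_integral_added_law[OF p(1)]) (auto simp: prob_space.emeasure_space_1)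
  then show "emeasure (added_law v p) (space (added_law v p)) = 1" by simp
qed

text \<open>\<open>v\<close> enters through the tilted law and through every factor of the product
  of point laws. Both are rewritten as densities, against \<open>P\<close> and against a product of
  copies of \<open>\<nu>\<close>. The integrals then run over fixed \<sigma>-finite measures, and
  measurability in \<open>v\<close> follows from joint measurability of the integrands.\<close>

lemma measurable_nn_integral_added_law:
  assumes p: "finite p" and G[measurable]: "G \<in> borel_measurable (measure_algebra \<nu>)"
  shows "(\<lambda>v. \<integral>\<^sup>+N. G N \<partial>added_law v p) \<in> borel_measurable borel"
proof -
  interpret N: product_sigma_finite "\<lambda>_::nat set. \<nu>"
    by (rule product_sigma_finite.intro) (rule sigma_finite_intensity)
  interpret PN: sigma_finite_measure "PiM p (\<lambda>_. \<nu>)" by (rule N.sigma_finite[OF p])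
  let ?w = "\<lambda>v C x. ennreal (exp (- v * H x)) * (ennreal (H x ^ card C) / moment (card C) v)"
  let ?g = "\<lambda>v z. (\<integral>\<^sup>+N. exp_neg (ennreal v * T N) * G (add_points N p z) \<partial>P) / lap v"
  have pt: "point_law m v = density \<nu> (\<lambda>x. ennreal (exp (- v * H x)) * (ennreal (H x ^ m) / moment m v))" for m v
    unfolding point_law_def tilted_def by (subst density_density_eq) auto
  have PC: "PiM p (\<lambda>C. point_law (card C) v) = density (PiM p (\<lambda>_. \<nu>)) (\<lambda>z. \<Prod>C\<in>p. ?w v C (z C))" for v
    using product_sigma_finite_point_law[of card v] unfolding pt
    by (intro PiM_density p N.product_sigma_finite_axioms) auto
  have comp[measurable]: "(\<lambda>z. z C) \<in> measurable (PiM p (\<lambda>_. \<nu>)) \<nu>" if "C \<in> p" for C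
    using that by (rule measurable_component_singleton)
  have w: "(\<lambda>(v, z). \<Prod>C\<in>p. ?w v C (z C)) \<in> borel_measurable (borel \<Otimes>\<^sub>M PiM p (\<lambda>_. \<nu>))"
    unfolding split_beta' by (intro borel_measurable_prod_ennreal) measurable
  have "(\<lambda>((v, z), N). add_points N p z) \<in>
      measurable ((borel \<Otimes>\<^sub>M PiM p (\<lambda>_. \<nu>)) \<Otimes>\<^sub>M P) (measure_algebra \<nu>)"
    unfolding split_beta' by (intro measurable_add_points p) measurable
  from measurable_compose[OF this G]
  have [measurable]: "(\<lambda>x. G (add_points (snd x) p (snd (fst x)))) \<in>
      borel_measurable (((borel :: real measure) \<Otimes>\<^sub>M PiM p (\<lambda>_. \<nu>)) \<Otimes>\<^sub>M P)"
    by (simp add: split_beta')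
  have "(\<lambda>x. \<integral>\<^sup>+N. exp_neg (ennreal (fst x) * T N) * G (add_points N p (snd x)) \<partial>P) \<in>
      borel_measurable (borel \<Otimes>\<^sub>M PiM p (\<lambda>_. \<nu>))"
    by (rule P.borel_measurable_nn_integral) (simp add: split_beta')
  then have g: "(\<lambda>(v, z). ?g v z) \<in> borel_measurable (borel \<Otimes>\<^sub>M PiM p (\<lambda>_. \<nu>))"
    unfolding split_beta' by measurable
  have eq: "(\<integral>\<^sup>+N. G N \<partial>added_law v p) = (\<integral>\<^sup>+z. (\<Prod>C\<in>p. ?w v C (z C)) * ?g v z \<partial>PiM p (\<lambda>_. \<nu>))" for v
  proof -
    have "(\<integral>\<^sup>+N. G N \<partial>added_law v p) =
        (\<integral>\<^sup>+z. (\<Prod>C\<in>p. ?w v C (z C)) * (\<integral>\<^sup>+N. G (add_points N p z) \<partial>tilted_law v) \<partial>PiM p (\<lambda>_. \<nu>))"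
      unfolding nn_integral_added_law[OF p G] PC
      using measurable_nn_integral_add_points(1)[OF p G]
      by (intro nn_integral_density borel_measurable_prod_ennreal) measurable
    also have "\<dots> = (\<integral>\<^sup>+z. (\<Prod>C\<in>p. ?w v C (z C)) * ?g v z \<partial>PiM p (\<lambda>_. \<nu>))"
    proof (intro nn_integral_cong arg_cong2[where f="(*)"] refl)
      fix z assume "z \<in> space (PiM p (\<lambda>_. \<nu>))"
      then have "(\<lambda>N. add_points N p z) \<in> measurable (measure_algebra \<nu>) (measure_algebra \<nu>)"
        using p by (intro measurable_add_points measurable_const measurable_ident) (auto simp: space_PiM)
      then show "(\<integral>\<^sup>+N. G (add_points N p z) \<partial>tilted_law v) = ?g v z"
        by (subst nn_integral_tilted_law) auto
    qed
    finally show ?thesis .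
  qed
  show ?thesis unfolding eq
  proof (rule PN.borel_measurable_nn_integral)
    show "(\<lambda>(v, z). (\<Prod>C\<in>p. ?w v C (z C)) * ?g v z) \<in> borel_measurable (borel \<Otimes>\<^sub>M PiM p (\<lambda>_. \<nu>))"
      using borel_measurable_times_ennreal[OF w g] by (simp add: split_beta')
  qed
qed

section \<open>The mixture over \<open>v\<close> and the partitions\<close>

definition partitions :: "nat \<Rightarrow> nat set set set" where
  "partitions n = {p. partition_on {1..n} p}"

lemma partitionsD:
  assumes "p \<in> partitions n"
  shows "finite p" "\<And>C. C \<in> p \<Longrightarrow> finite C \<and> C \<noteq> {}"
proof -
  show "finite p" using assms finite_elements[of "{1..n}" p] by (simp add: partitions_def)
  fix C assume "C \<in> p"
  moreover have "\<Union>p = {1..n}" "{} \<notin> p" using assms by (auto simp: partition_on_def partitions_def)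
  ultimately show "finite C \<and> C \<noteq> {}" using finite_subset[of C "{1..n}"] by auto
qed

lemma finite_partitions: "finite (partitions n)"
  unfolding partitions_def by (intro finitely_many_partition_on) simp

text \<open>There are finitely many partitions and they carry the discrete \<sigma>-algebra, so
  measurability in \<open>v\<close> for each fixed partition suffices.\<close>

lemma measurable_pair_partitions:
  assumes "\<And>p. p \<in> partitions n \<Longrightarrow> (\<lambda>v. f v p) \<in> measurable K L"
  shows "(\<lambda>(v, p). f v p) \<in> measurable (K \<Otimes>\<^sub>M count_space (partitions n)) L"
proof -
  have "(\<lambda>x. f (fst x) (snd x)) \<in> measurable (K \<Otimes>\<^sub>M count_space (partitions n)) L"
  proof (rule measurable_compose_countable'[where I="partitions n" and f="\<lambda>p x. f (fst x) p" and g=snd])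
    show "(\<lambda>x. f (fst x) p) \<in> measurable (K \<Otimes>\<^sub>M count_space (partitions n)) L" if "p \<in> partitions n" for p
      by (rule measurable_compose[OF measurable_fst assms[OF that]])
  qed (simp_all add: finite_partitions countable_finite)
  then show ?thesis by (simp add: split_beta')
qed

lemma measurable_added_law:
  "(\<lambda>(v, p). added_law v p) \<in>
    measurable (pos_half_line \<Otimes>\<^sub>M count_space (partitions n)) (subprob_algebra (measure_algebra \<nu>))"
proof (rule measurable_pair_partitions, rule measurable_subprob_algebra)
  fix p assume p: "p \<in> partitions n"
  show "subprob_space (added_law v p)" if "v \<in> space pos_half_line" for v
    using that partitionsD[OF p]
    by (intro prob_space_imp_subprob_space prob_space_added_law) (auto simp: space_restrict_space)
  fix A assume A: "A \<in> sets (measure_algebra \<nu>)"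
  then have "(\<lambda>v. \<integral>\<^sup>+N. indicator A N \<partial>added_law v p) \<in> borel_measurable borel"
    using partitionsD[OF p] by (intro measurable_nn_integral_added_law) auto
  then show "(\<lambda>v. emeasure (added_law v p) A) \<in> borel_measurable pos_half_line"
    using A by (intro measurable_restrict_space1) simp
qed simp

definition mixing_partition_law :: "nat \<Rightarrow> real \<Rightarrow> (real \<times> nat set set) measure" where
  "mixing_partition_law n \<theta> = density (pos_half_line \<Otimes>\<^sub>M count_space (partitions n))
     (\<lambda>(v, p). (\<Prod>C\<in>p. moment (card C) v) * ennreal (v powr (\<theta> + real n - 1)) * lap v
        / (ennreal (Gamma (\<theta> + real n)) * E_inv \<theta>))"

lemma sets_mixing_partition_law [simp, measurable_cong]:
  "sets (mixing_partition_law n \<theta>) = sets (pos_half_line \<Otimes>\<^sub>M count_space (partitions n))"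
  by (simp add: mixing_partition_law_def)

text \<open>For fixed \<open>v\<close> the weights \<open>moment (card C) v\<close> turn the means
  under \<open>added_law\<close> into cell terms, whose sum is the mean of \<open>T^n G\<close>
  under the tilted law. The remaining integral over \<open>v\<close> is the Gamma mixture.\<close>

lemma nn_integral_mixing_partition_law:
  assumes \<theta>: "0 < \<theta> + real n" and E: "E_inv \<theta> < \<infinity>" and G[measurable]: "G \<in> borel_measurable (measure_algebra \<nu>)"
  shows "(\<integral>\<^sup>+(v, p). (\<integral>\<^sup>+N. G N \<partial>added_law v p) \<partial>mixing_partition_law n \<theta>) = (\<integral>\<^sup>+N. G N \<partial>biased_law \<theta>)"
proof -
  let ?c = "ennreal (Gamma (\<theta> + real n)) * E_inv \<theta>"
  let ?w = "\<lambda>v. ennreal (v powr (\<theta> + real n - 1))"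
  let ?K = "\<lambda>p v. \<Prod>C\<in>p. moment (card C) v"
  let ?M = "pos_half_line \<Otimes>\<^sub>M count_space (partitions n)"
  interpret S: sigma_finite_measure "count_space (partitions n)"
    by (intro sigma_finite_measure_count_space_finite finite_partitions)
  have a: "(\<lambda>(v, p). \<integral>\<^sup>+N. G N \<partial>added_law v p) \<in> borel_measurable ?M"
    by (intro measurable_pair_partitions)
       (auto intro!: measurable_restrict_space1 measurable_nn_integral_added_law partitionsD)
  have d: "(\<lambda>(v, p). ?K p v * ?w v * lap v / ?c) \<in> borel_measurable ?M"
    by (intro measurable_pair_partitions measurable_restrict_space1) measurable
  have "(\<integral>\<^sup>+(v, p). (\<integral>\<^sup>+N. G N \<partial>added_law v p) \<partial>mixing_partition_law n \<theta>) =
      (\<integral>\<^sup>+x. (\<lambda>(v, p). ?K p v * ?w v * lap v / ?c) x * (\<lambda>(v, p). \<integral>\<^sup>+N. G N \<partial>added_law v p) x \<partial>?M)"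
    unfolding mixing_partition_law_def by (rule nn_integral_density[OF d a])
  also have "\<dots> = (\<integral>\<^sup>+v. (\<integral>\<^sup>+p. ?K p v * ?w v * lap v / ?c * (\<integral>\<^sup>+N. G N \<partial>added_law v p)
      \<partial>count_space (partitions n)) \<partial>pos_half_line)"
    using borel_measurable_times_ennreal[OF d a] by (subst S.nn_integral_fst[symmetric]) auto
  also have "\<dots> = (\<integral>\<^sup>+v. ?w v * (lap v * (\<integral>\<^sup>+N. T N ^ n * G N \<partial>tilted_law v)) / ?c \<partial>pos_half_line)"
  proof (rule nn_integral_cong)
    fix v assume "v \<in> space pos_half_line"
    then have v: "0 < v" by (simp add: space_restrict_space)
    have "(\<integral>\<^sup>+p. ?K p v * ?w v * lap v / ?c * (\<integral>\<^sup>+N. G N \<partial>added_law v p) \<partial>count_space (partitions n)) =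
        (\<Sum>p\<in>partitions n. ?w v * lap v / ?c * cell_term G v p)"
      unfolding nn_integral_count_space_finite[OF finite_partitions]
    proof (rule sum.cong[OF refl])
      fix p assume "p \<in> partitions n"
      then have "cell_term G v p = ?K p v * (\<integral>\<^sup>+N. G N \<partial>added_law v p)"
        using G by (intro cell_term_eq_added_law partitionsD)
      then show "?K p v * ?w v * lap v / ?c * (\<integral>\<^sup>+N. G N \<partial>added_law v p) = ?w v * lap v / ?c * cell_term G v p"
        by (simp only: divide_ennreal_def mult_ac)
    qed
    also have "\<dots> = ?w v * lap v / ?c * (\<integral>\<^sup>+N. T N ^ n * G N \<partial>tilted_law v)"
      by (simp only: nn_integral_T_power[OF v G] sum_distrib_left partitions_def)
    finally show "(\<integral>\<^sup>+p. ?K p v * ?w v * lap v / ?c * (\<integral>\<^sup>+N. G N \<partial>added_law v p) \<partial>count_space (partitions n)) =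
        ?w v * (lap v * (\<integral>\<^sup>+N. T N ^ n * G N \<partial>tilted_law v)) / ?c"
      by (simp only: divide_ennreal_def mult_ac)
  qed
  also have "\<dots> = (\<integral>\<^sup>+v. ?w v * (lap v * (\<integral>\<^sup>+N. T N ^ n * G N \<partial>tilted_law v)) \<partial>pos_half_line) / ?c"
  proof (rule nn_integral_divide)
    have "(\<lambda>v. ?w v * (lap v * (\<integral>\<^sup>+N. T N ^ n * G N \<partial>tilted_law v))) \<in> borel_measurable borel"
      by (subst lap_mult_nn_integral_tilted_law) measurable
    then show "(\<lambda>v. ?w v * (lap v * (\<integral>\<^sup>+N. T N ^ n * G N \<partial>tilted_law v))) \<in> borel_measurable pos_half_line"
      by (intro measurable_restrict_space1) simp
  qed
  also have "\<dots> = ennreal (Gamma (\<theta> + real n)) * (\<integral>\<^sup>+N. T_inv \<theta> N * G N \<partial>P) / ?c"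
    by (simp only: Gamma_mixture[OF \<theta> G])
  also have "\<dots> = (\<integral>\<^sup>+N. T_inv \<theta> N * G N \<partial>P) / E_inv \<theta>"
    using \<theta> E_inv_neq_0[of \<theta>] E
    by (intro ennreal_mult_divide_cancel_left) (auto simp: ennreal_eq_0_iff not_le)
  finally show ?thesis unfolding nn_integral_biased_law[OF G] .
qed

text \<open>Again the identity with \<open>G = 1\<close>: the weights sum to one because their sum
  over the partitions expands \<open>E[T^n e^{-vT}]\<close>.\<close>

lemma prob_space_mixing_partition_law:
  assumes "0 < \<theta> + real n" "E_inv \<theta> < \<infinity>"
  shows "prob_space (mixing_partition_law n \<theta>)"
proof
  let ?L = "mixing_partition_law n \<theta>"
  have "emeasure ?L (space ?L) = (\<integral>\<^sup>+x. 1 \<partial>?L)" by simp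
  also have "\<dots> = (\<integral>\<^sup>+(v, p). (\<integral>\<^sup>+N. 1 \<partial>added_law v p) \<partial>?L)"
  proof (rule nn_integral_cong)
    fix x assume "x \<in> space ?L"
    then obtain v p where x: "x = (v, p)" "0 < v" "p \<in> partitions n"
      using sets_eq_imp_space_eq[OF sets_mixing_partition_law, of n \<theta>]
      by (auto simp: space_pair_measure space_restrict_space)
    have "emeasure (added_law v p) (space (added_law v p)) = 1"
      using x partitionsD[OF x(3)]
      by (intro prob_space.emeasure_space_1 prob_space_added_law) auto
    then show "1 = (case x of (v, p) \<Rightarrow> \<integral>\<^sup>+N. 1 \<partial>added_law v p)" by (simp add: x(1))
  qed
  also have "\<dots> = 1"
    using nn_integral_mixing_partition_law[OF assms, of "\<lambda>_. 1"] nn_integral_biased_law_1[OF assms(2)] by simp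
  finally show "emeasure ?L (space ?L) = 1" .
qed

lemma biased_law_eq_bind_partition:
  assumes "0 < \<theta> + real n" "E_inv \<theta> < \<infinity>"
  shows "biased_law \<theta> = bind (mixing_partition_law n \<theta>) (\<lambda>(v, p). added_law v p)"
proof (rule measure_eqI)
  let ?L = "mixing_partition_law n \<theta>"
  interpret prob_space ?L by (rule prob_space_mixing_partition_law[OF assms])
  have m: "(\<lambda>(v, p). added_law v p) \<in> measurable ?L (subprob_algebra (measure_algebra \<nu>))"
    using measurable_added_law by (subst measurable_cong_sets[OF sets_mixing_partition_law refl])
  show "sets (biased_law \<theta>) = sets (bind ?L (\<lambda>(v, p). added_law v p))"
    using sets_bind[OF _ not_empty, of "\<lambda>(v, p). added_law v p" "measure_algebra \<nu>"]
    by (simp add: split_beta')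
  fix A assume "A \<in> sets (biased_law \<theta>)"
  then have A[measurable]: "A \<in> sets (measure_algebra \<nu>)" by simp
  have "emeasure (biased_law \<theta>) A = (\<integral>\<^sup>+N. indicator A N \<partial>biased_law \<theta>)" using A by simp
  also have "\<dots> = (\<integral>\<^sup>+(v, p). (\<integral>\<^sup>+N. indicator A N \<partial>added_law v p) \<partial>?L)"
    by (rule nn_integral_mixing_partition_law[OF assms, symmetric]) measurable
  also have "\<dots> = emeasure (bind ?L (\<lambda>(v, p). added_law v p)) A"
    using A by (subst emeasure_bind[OF not_empty m A]) (simp add: split_beta')
  finally show "emeasure (biased_law \<theta>) A = emeasure (bind ?L (\<lambda>(v, p). added_law v p)) A" .
qed

end

subsection \<open>Kernels and their intensity measures\<close>

lemma sets_intensity: "sets (intensity \<rho> \<eta>) = sets (borel \<Otimes>\<^sub>M borel)"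
  using sets.sets_measure_of_eq[of "borel \<Otimes>\<^sub>M borel"] by (simp add: intensity_def space_pair_measure)

lemma space_intensity: "space (intensity \<rho> \<eta>) = UNIV"
  using sets_eq_imp_space_eq[OF sets_intensity, of \<rho> \<eta>] by (simp add: space_pair_measure)

text \<open>\<open>measure_of\<close> falls back to the null measure when its set function is not
  countably additive; a nonzero total mass excludes this.\<close>

lemma emeasure_intensity:
  assumes "emeasure (intensity \<rho> \<eta>) UNIV \<noteq> 0" and A: "A \<in> sets (borel \<Otimes>\<^sub>M borel)"
  shows "emeasure (intensity \<rho> \<eta>) A = (\<integral>\<^sup>+y. emeasure (\<rho> y) {s. (s, y) \<in> A} \<partial>\<eta>)"
proof -
  have "sigma_sets UNIV (sets (borel \<Otimes>\<^sub>M borel)) = sets (borel \<Otimes>\<^sub>M borel :: ('b \<times> 'a) measure)"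
    using sets.sigma_sets_eq[of "borel \<Otimes>\<^sub>M borel :: ('b \<times> 'a) measure"] by (simp add: space_pair_measure)
  with assms show ?thesis
    unfolding intensity_def by (auto simp: emeasure_measure_of_conv split: if_splits)
qed

lemma section_sets:
  assumes "A \<in> sets (borel \<Otimes>\<^sub>M borel)"
  shows "{s. (s, y) \<in> A} \<in> sets borel"
proof -
  have "(\<lambda>s. (s, y)) -` A \<inter> space borel \<in> sets borel"
    by (rule measurable_sets[OF _ assms]) measurable
  then show ?thesis by (simp add: vimage_def)
qed

text \<open>The kernel is only \<open>\<sigma>\<close>-finite for each fixed \<open>y\<close>, so sections need not depend measurably
  on \<open>y\<close>. The sets \<open>{h > 1/m}\<close> have finite intensity, and off an \<open>\<eta>\<close>-null set they exhaust the
  kernel by finite ones.\<close>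

lemma nn_integral_intensity:
  fixes \<rho> :: "'b::topological_space \<Rightarrow> 'a::topological_space measure"
  assumes \<eta>: "sets \<eta> = sets borel" and \<rho>: "sigma_finite_kernel \<rho>"
    and h[measurable]: "h \<in> borel_measurable borel" and h_pos: "\<And>s. 0 < h s"
    and \<nu>: "\<And>A. A \<in> sets (borel \<Otimes>\<^sub>M borel) \<Longrightarrow>
      emeasure (intensity \<rho> \<eta>) A = (\<integral>\<^sup>+y. emeasure (\<rho> y) {s. (s, y) \<in> A} \<partial>\<eta>)"
    and fin: "\<And>\<epsilon>::real. 0 < \<epsilon> \<Longrightarrow> emeasure (intensity \<rho> \<eta>) {x. \<epsilon> < h (fst x)} \<noteq> \<infinity>"
    and g: "g \<in> borel_measurable (borel \<Otimes>\<^sub>M borel)"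
  shows "(\<integral>\<^sup>+y. (\<integral>\<^sup>+s. g (s, y) \<partial>\<rho> y) \<partial>\<eta>) = (\<integral>\<^sup>+x. g x \<partial>intensity \<rho> \<eta>)"
proof -
  have sets_\<rho>: "sets (\<rho> y) = sets borel" for y using \<rho> by (simp add: sigma_finite_kernel_def)
  have \<rho>_meas: "(\<lambda>y. emeasure (\<rho> y) A) \<in> borel_measurable borel" if "A \<in> sets borel" for A
    using \<rho> that by (simp add: sigma_finite_kernel_def)
  define S where "S m = {s. 1 / real (Suc m) < h s}" for m
  have S[measurable]: "S m \<in> sets borel" for m
    using sets_Collect_mem[OF h, of "{1 / real (Suc m)<..}"] by (simp add: S_def)
  have S_UN: "(\<Union>m. S m) = UNIV"
  proof -
    have "\<exists>m. s \<in> S m" for s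
      using reals_Archimedean[OF h_pos[of s]] by (simp add: S_def inverse_eq_divide)
    then show ?thesis by auto
  qed
  have S_mono: "S m \<subseteq> S n" if "m \<le> n" for m n
  proof -
    have "1 / real (Suc n) \<le> 1 / real (Suc m)" using that by (simp add: frac_le)
    then show ?thesis unfolding S_def by (auto intro: le_less_trans)
  qed
  \<comment> \<open>The points \<open>y\<close> at which the kernel is finite on every
    \<open>S m\<close>. They have full measure: the integral of
    \<open>emeasure (\<rho> y) (S m)\<close> over \<open>y\<close> is the intensity of
    \<open>S m \<times> UNIV\<close>, which is finite.\<close>
  define Y0 where "Y0 = {y. \<forall>m. emeasure (\<rho> y) (S m) \<noteq> \<infinity>}"
  have Y0: "Y0 \<in> sets borel"
  proof -
    note [measurable] = \<rho>_meas[OF S]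
    have "{y\<in>space borel. \<forall>m. emeasure (\<rho> y) (S m) \<noteq> \<infinity>} \<in> sets borel" by measurable
    then show ?thesis by (simp add: Y0_def)
  qed
  have AE_Y0: "AE y in \<eta>. y \<in> Y0"
  proof -
    have "AE y in \<eta>. emeasure (\<rho> y) (S m) \<noteq> \<infinity>" for m
    proof (rule nn_integral_PInf_AE)
      show "(\<lambda>y. emeasure (\<rho> y) (S m)) \<in> borel_measurable \<eta>"
        using \<rho>_meas[OF S] by (subst measurable_cong_sets[OF \<eta> refl])
      have S_eq: "{x. 1 / real (Suc m) < h (fst x)} = S m \<times> UNIV" by (auto simp: S_def)
      have "S m \<times> UNIV \<in> sets (borel \<Otimes>\<^sub>M borel)" by (rule pair_measureI) auto
      from \<nu>[OF this] have "emeasure (intensity \<rho> \<eta>) {x. 1 / real (Suc m) < h (fst x)} = (\<integral>\<^sup>+y. emeasure (\<rho> y) (S m) \<partial>\<eta>)"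
        unfolding S_eq by simp
      then show "(\<integral>\<^sup>+y. emeasure (\<rho> y) (S m) \<partial>\<eta>) \<noteq> \<infinity>" using fin[of "1 / real (Suc m)"] by simp
    qed
    then have "AE y in \<eta>. \<forall>m. emeasure (\<rho> y) (S m) \<noteq> \<infinity>" by (simp add: AE_all_countable)
    then show ?thesis by (simp add: Y0_def)
  qed
  \<comment> \<open>Off \<open>Y0\<close> the kernel is replaced by zero. The result is finite on
    each \<open>S m\<close> for every \<open>y\<close>, so the complement case of the induction
    below may subtract, and it agrees with \<open>\<rho>\<close> almost everywhere.\<close>
  define \<rho>0 where "\<rho>0 y = (if y \<in> Y0 then \<rho> y else null_measure borel)" for y
  have sets_\<rho>0: "sets (\<rho>0 y) = sets borel" for y by (simp add: \<rho>0_def sets_\<rho>)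
  have space_\<rho>0: "space (\<rho>0 y) = UNIV" for y using sets_eq_imp_space_eq[OF sets_\<rho>0] by simp
  have \<rho>0_meas: "(\<lambda>y. emeasure (\<rho>0 y) A) \<in> borel_measurable borel" if "A \<in> sets borel" for A
  proof -
    have "(\<lambda>y. if y \<in> Y0 then emeasure (\<rho> y) A else 0) \<in> borel_measurable borel"
      using Y0 \<rho>_meas[OF that] by measurable
    also have "(\<lambda>y. if y \<in> Y0 then emeasure (\<rho> y) A else 0) = (\<lambda>y. emeasure (\<rho>0 y) A)"
      by (auto simp: \<rho>0_def)
    finally show ?thesis .
  qed
  have \<rho>0_fin: "emeasure (\<rho>0 y) (S m) \<noteq> \<infinity>" for y m by (simp add: \<rho>0_def Y0_def)
  have meas_m: "(\<lambda>y. emeasure (\<rho>0 y) (S m \<inter> {s. (s, y) \<in> A})) \<in> borel_measurable borel"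
    if "A \<in> sets (borel \<Otimes>\<^sub>M borel)" for A m
    using Int_stable_pair_measure_generator[of borel borel] pair_measure_closed[of borel borel] that
    unfolding sets_pair_measure
  proof (induct rule: sigma_sets_induct_disjoint)
    case (basic A)
    then obtain a b where A: "A = a \<times> b" "a \<in> sets borel" "b \<in> sets borel" by auto
    have "(\<lambda>y. emeasure (\<rho>0 y) (S m \<inter> a) * indicator b y) \<in> borel_measurable borel"
      using \<rho>0_meas[of "S m \<inter> a"] A by measurable
    also have "(\<lambda>y. emeasure (\<rho>0 y) (S m \<inter> a) * indicator b y) = (\<lambda>y. emeasure (\<rho>0 y) (S m \<inter> {s. (s, y) \<in> A}))"
      by (auto simp: A indicator_def intro!: arg_cong2[where f=emeasure])
    finally show ?case .
  next
    case empty
    then show ?case by simp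
  next
    case (compl A)
    then have A: "A \<in> sets (borel \<Otimes>\<^sub>M borel)" by (simp add: sets_pair_measure)
    have "emeasure (\<rho>0 y) (S m \<inter> {s. (s, y) \<in> space borel \<times> space borel - A}) =
        emeasure (\<rho>0 y) (S m) - emeasure (\<rho>0 y) (S m \<inter> {s. (s, y) \<in> A})" for y
    proof -
      have "S m \<inter> {s. (s, y) \<in> space borel \<times> space borel - A} = S m - (S m \<inter> {s. (s, y) \<in> A})" by auto
      moreover have "emeasure (\<rho>0 y) (S m \<inter> {s. (s, y) \<in> A}) \<noteq> \<infinity>"
        using \<rho>0_fin[of y m] emeasure_mono[of "S m \<inter> {s. (s, y) \<in> A}" "S m" "\<rho>0 y"] S
        by (auto simp: sets_\<rho>0 top_unique)
      ultimately show ?thesis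
        using section_sets[OF A, of y] by (simp add: emeasure_Diff sets_\<rho>0)
    qed
    then show ?case using compl \<rho>0_meas[OF S] by simp
  next
    case (union A)
    then have A: "A i \<in> sets (borel \<Otimes>\<^sub>M borel)" for i by (auto simp: sets_pair_measure)
    have "emeasure (\<rho>0 y) (S m \<inter> {s. (s, y) \<in> \<Union>(range A)}) =
        (\<Sum>i. emeasure (\<rho>0 y) (S m \<inter> {s. (s, y) \<in> A i}))" for y
    proof -
      have "S m \<inter> {s. (s, y) \<in> \<Union>(range A)} = (\<Union>i. S m \<inter> {s. (s, y) \<in> A i})" by auto
      moreover have "disjoint_family (\<lambda>i. S m \<inter> {s. (s, y) \<in> A i})"
        using union(1) by (auto simp: disjoint_family_on_def)
      moreover have "range (\<lambda>i. S m \<inter> {s. (s, y) \<in> A i}) \<subseteq> sets (\<rho>0 y)"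
        using section_sets[OF A] by (auto simp: sets_\<rho>0)
      ultimately show ?thesis by (simp add: suminf_emeasure)
    qed
    then show ?case using union by simp
  qed
  have meas: "(\<lambda>y. emeasure (\<rho>0 y) {s. (s, y) \<in> A}) \<in> borel_measurable borel"
    if A: "A \<in> sets (borel \<Otimes>\<^sub>M borel)" for A
  proof -
    have "emeasure (\<rho>0 y) {s. (s, y) \<in> A} = (SUP m. emeasure (\<rho>0 y) (S m \<inter> {s. (s, y) \<in> A}))" for y
    proof -
      have "(\<Union>m. S m \<inter> {s. (s, y) \<in> A}) = {s. (s, y) \<in> A}" using S_UN by auto
      moreover have "range (\<lambda>m. S m \<inter> {s. (s, y) \<in> A}) \<subseteq> sets (\<rho>0 y)"
        using section_sets[OF A] by (auto simp: sets_\<rho>0)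
      moreover have "incseq (\<lambda>m. S m \<inter> {s. (s, y) \<in> A})"
        using S_mono by (auto simp: incseq_def)
      ultimately show ?thesis by (simp add: SUP_emeasure_incseq)
    qed
    then show ?thesis using meas_m[OF A] by simp
  qed
  have sec: "(\<lambda>s. u (s, y)) \<in> borel_measurable (\<rho>0 y)"
    if "u \<in> borel_measurable (borel \<Otimes>\<^sub>M borel)" for u :: "'a \<times> 'b \<Rightarrow> ennreal" and y
    using measurable_compose[OF measurable_Pair2'[of y borel borel] that]
    by (subst measurable_cong_sets[OF sets_\<rho>0 refl]) simp
  have meas_\<eta>: "u \<in> borel_measurable \<eta>" if "u \<in> borel_measurable borel" for u :: "'b \<Rightarrow> ennreal"
    using that by (subst measurable_cong_sets[OF \<eta> refl])
  have u_\<nu>: "u \<in> borel_measurable (intensity \<rho> \<eta>)"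
    if "u \<in> borel_measurable (borel \<Otimes>\<^sub>M borel)" for u :: "'a \<times> 'b \<Rightarrow> ennreal"
    using that by (subst measurable_cong_sets[OF sets_intensity refl])
  have "(\<lambda>y. \<integral>\<^sup>+s. g (s, y) \<partial>\<rho>0 y) \<in> borel_measurable borel \<and>
      (\<integral>\<^sup>+y. (\<integral>\<^sup>+s. g (s, y) \<partial>\<rho>0 y) \<partial>\<eta>) = (\<integral>\<^sup>+x. g x \<partial>intensity \<rho> \<eta>)"
    using g
  proof induct
    case (cong f g)
    then have "f = g" by (auto simp: space_pair_measure)
    with cong show ?case by simp
  next
    case (set A)
    have *: "(\<integral>\<^sup>+s. indicator A (s, y) \<partial>\<rho>0 y) = emeasure (\<rho>0 y) {s. (s, y) \<in> A}" for y
    proof -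
      have "(\<integral>\<^sup>+s. indicator A (s, y) \<partial>\<rho>0 y) = (\<integral>\<^sup>+s. indicator {s. (s, y) \<in> A} s \<partial>\<rho>0 y)"
        by (intro nn_integral_cong) (simp add: indicator_def)
      then show ?thesis using section_sets[OF set] by (simp add: sets_\<rho>0)
    qed
    have "(\<integral>\<^sup>+y. emeasure (\<rho>0 y) {s. (s, y) \<in> A} \<partial>\<eta>) = (\<integral>\<^sup>+y. emeasure (\<rho> y) {s. (s, y) \<in> A} \<partial>\<eta>)"
      using AE_Y0 by (intro nn_integral_cong_AE) (auto elim!: eventually_mono simp: \<rho>0_def)
    then show ?case using set meas[OF set] by (simp add: * \<nu> sets_intensity)
  next
    case (mult u c)
    then have "(\<lambda>y. c * \<integral>\<^sup>+s. u (s, y) \<partial>\<rho>0 y) \<in> borel_measurable borel"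
      by (intro borel_measurable_times_ennreal) auto
    with mult show ?case by (simp add: sec nn_integral_cmult meas_\<eta> u_\<nu>)
  next
    case (add u v)
    then have "(\<lambda>y. (\<integral>\<^sup>+s. v (s, y) \<partial>\<rho>0 y) + (\<integral>\<^sup>+s. u (s, y) \<partial>\<rho>0 y)) \<in> borel_measurable borel"
      by (intro borel_measurable_add) auto
    with add show ?case by (simp add: sec nn_integral_add meas_\<eta> u_\<nu>)
  next
    case (seq U)
    have inc: "incseq (\<lambda>i s. U i (s, y))" for y
      using seq(4) by (auto simp: incseq_def le_fun_def)
    have *: "(\<integral>\<^sup>+s. (SUP i. U i) (s, y) \<partial>\<rho>0 y) = (SUP i. \<integral>\<^sup>+s. U i (s, y) \<partial>\<rho>0 y)" for y
      unfolding SUP_apply using inc seq(1) by (intro nn_integral_monotone_convergence_SUP sec)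
    have inc2: "incseq (\<lambda>i y. \<integral>\<^sup>+s. U i (s, y) \<partial>\<rho>0 y)"
      using seq(4) by (auto simp: incseq_def le_fun_def intro!: nn_integral_mono)
    have "(\<integral>\<^sup>+y. (SUP i. \<integral>\<^sup>+s. U i (s, y) \<partial>\<rho>0 y) \<partial>\<eta>) = (SUP i. \<integral>\<^sup>+y. (\<integral>\<^sup>+s. U i (s, y) \<partial>\<rho>0 y) \<partial>\<eta>)"
      using inc2 seq(3) by (intro nn_integral_monotone_convergence_SUP meas_\<eta>) auto
    also have "\<dots> = (SUP i. \<integral>\<^sup>+x. U i x \<partial>intensity \<rho> \<eta>)" using seq(3) by simp
    also have "\<dots> = (\<integral>\<^sup>+x. (SUP i. U i x) \<partial>intensity \<rho> \<eta>)"
      using seq by (intro nn_integral_monotone_convergence_SUP[symmetric] u_\<nu>) auto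
    finally have "(\<integral>\<^sup>+y. (SUP i. \<integral>\<^sup>+s. U i (s, y) \<partial>\<rho>0 y) \<partial>\<eta>) = (\<integral>\<^sup>+x. (SUP i. U i) x \<partial>intensity \<rho> \<eta>)"
      by (simp add: SUP_apply image_comp)
    moreover have "(\<lambda>y. SUP i. \<integral>\<^sup>+s. U i (s, y) \<partial>\<rho>0 y) \<in> borel_measurable borel"
      using seq(3) by (intro borel_measurable_SUP) auto
    ultimately show ?case unfolding * by simp
  qed
  moreover have "(\<integral>\<^sup>+y. (\<integral>\<^sup>+s. g (s, y) \<partial>\<rho>0 y) \<partial>\<eta>) = (\<integral>\<^sup>+y. (\<integral>\<^sup>+s. g (s, y) \<partial>\<rho> y) \<partial>\<eta>)"
    using AE_Y0 by (intro nn_integral_cong_AE) (auto elim!: eventually_mono simp: \<rho>0_def)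
  ultimately show ?thesis by simp
qed

section \<open>The total mass, and the three claims for kernels\<close>

lemma Tmass_eq_nn_integral:
  assumes N: "sets N = sets (borel \<Otimes>\<^sub>M borel)" and [measurable]: "h \<in> borel_measurable borel"
  shows "Tmass h N = (\<integral>\<^sup>+x. ennreal (h (fst x)) \<partial>N)"
proof -
  note [measurable_cong] = N
  have "snd -` UNIV \<inter> space (density N (\<lambda>(s, y). ennreal (h s))) = space N" by simp
  moreover have "snd \<in> measurable (density N (\<lambda>(s, y). ennreal (h s))) borel"
    using N by (simp cong: measurable_cong_sets)
  ultimately have "Tmass h N = emeasure (density N (\<lambda>(s, y). ennreal (h s))) (space N)"
    unfolding Tmass_def mu_def by (subst emeasure_distr) auto
  also have "\<dots> = (\<integral>\<^sup>+x. ennreal (h (fst x)) \<partial>N)"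
    by (subst emeasure_density) (auto simp: split_beta' intro!: nn_integral_cong)
  finally show ?thesis .
qed

theorem theorem5p1:
  fixes \<eta> :: "'b::polish_space measure"
    and \<rho> :: "'b \<Rightarrow> 'a::polish_space measure"
    and h :: "'a \<Rightarrow> real"
  assumes eta: "sets \<eta> = sets borel" "sigma_finite_measure \<eta>" "non_atomic \<eta>"
    and rho: "sigma_finite_kernel \<rho>"
    and h: "h \<in> borel_measurable borel" "\<And>s. 0 < h s"
    and prm_exists: "\<exists>P. poisson_random_measure_law (intensity \<rho> \<eta>) P"
    and T: "AE N in prm \<rho> \<eta>. 0 < Tmass h N \<and> Tmass h N < \<infinity>"
  shows
    "(\<forall>\<theta>>0. E_T_neg_powr h \<rho> \<eta> \<theta> < \<infinity> \<longrightarrow>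
        prob_space (pi_mix h \<rho> \<eta> \<theta>) \<and>
        prm_T h \<rho> \<eta> \<theta> = bind (pi_mix h \<rho> \<eta> \<theta>) (\<lambda>v. prm (tilt h v \<rho>) \<eta>) \<and>
        (\<forall>f \<in> borel_measurable (borel \<Otimes>\<^sub>M borel).
           laplace_functional f (prm_T h \<rho> \<eta> \<theta>)
             = (\<integral>\<^sup>+ v. laplace_functional f (prm (tilt h v \<rho>) \<eta>) \<partial>pi_mix h \<rho> \<eta> \<theta>)))
   \<and> (\<forall>n\<ge>1.
        prob_space (pi_part h \<rho> \<eta> n 0) \<and>
        prm \<rho> \<eta> = bind (pi_part h \<rho> \<eta> n 0) (\<lambda>(v, p). N_law h (tilt h v \<rho>) \<eta> p))
   \<and> (\<forall>n\<ge>1. \<forall>\<theta>. \<theta> + real n > 0 \<and> E_T_neg_powr h \<rho> \<eta> \<theta> < \<infinity>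
          \<and> E_T_neg_powr h \<rho> \<eta> (\<theta> + real n) < \<infinity> \<longrightarrow>
        prob_space (pi_part h \<rho> \<eta> n \<theta>) \<and>
        prm_T h \<rho> \<eta> \<theta> = bind (pi_part h \<rho> \<eta> n \<theta>) (\<lambda>(v, p). N_law h (tilt h v \<rho>) \<eta> p))"
proof -
  let ?\<nu> = "intensity \<rho> \<eta>" and ?P = "prm \<rho> \<eta>"
  let ?H = "\<lambda>x :: 'a \<times> 'b. h (fst x)"
  note [measurable] = h(1)
  \<comment> \<open>Existence is a hypothesis and uniqueness has been shown, so \<open>prm\<close>
    denotes a law with the required properties.\<close>
  have prm: "poisson_random_measure_law ?\<nu> ?P"
    using prm_exists prm_eqI by metis
  have space_P: "space ?P = {N. sets N = sets (borel \<Otimes>\<^sub>M borel)}"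
    using prm_law_space[OF prm] by (simp add: sets_intensity)
  have Tmass_eq: "Tmass h N = (\<integral>\<^sup>+x. ennreal (?H x) \<partial>N)" if "N \<in> space ?P" for N
    using that by (intro Tmass_eq_nn_integral h(1)) (simp add: space_P)
  interpret poisson_mass ?\<nu> ?P ?H
  proof
    show "?H \<in> borel_measurable ?\<nu>"
      by (subst measurable_cong_sets[OF sets_intensity refl]) measurable
    have "AE N in ?P. N \<in> space ?P" by simp
    with T show "AE N in ?P. 0 < (\<integral>\<^sup>+x. ennreal (?H x) \<partial>N) \<and> (\<integral>\<^sup>+x. ennreal (?H x) \<partial>N) < \<infinity>"
      by eventually_elim (simp add: Tmass_eq)
  qed (use prm h(2) in auto)
  have MA: "measure_algebra ?\<nu> = measure_algebra (borel \<Otimes>\<^sub>M borel)"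
    by (rule measure_algebra_cong[OF sets_intensity])
  have T_eq: "T N = Tmass h N" if "N \<in> space ?P" for N
    using that by (simp add: T_def Tmass_eq)
  have lap_eq: "E_exp_T h \<rho> \<eta> v = lap v" for v
    unfolding E_exp_T_def lap_def by (intro nn_integral_cong) (simp add: T_eq)
  have T_neg_eq: "T_neg_powr h \<theta> N = T_inv \<theta> N" if "N \<in> space ?P" for \<theta> N
    using that by (simp add: T_neg_powr_def T_inv_def T_eq)
  have E_eq: "E_T_neg_powr h \<rho> \<eta> \<theta> = E_inv \<theta>" for \<theta>
    unfolding E_T_neg_powr_def E_inv_def by (intro nn_integral_cong) (simp add: T_neg_eq)
  have biased: "prm_T h \<rho> \<eta> \<theta> = biased_law \<theta>" for \<theta>
  proof -
    have m: "(\<lambda>N. T_inv \<theta> N / E_inv \<theta>) \<in> borel_measurable ?P" by measurable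
    have "(\<lambda>N. T_neg_powr h \<theta> N / E_T_neg_powr h \<rho> \<eta> \<theta>) \<in> borel_measurable ?P"
      by (rule measurable_cong[THEN iffD1, OF _ m]) (simp add: T_neg_eq E_eq)
    then show ?thesis
      unfolding prm_T_def biased_law_def using m
      by (intro density_cong) (auto simp: T_neg_eq E_eq)
  qed
  \<comment> \<open>The locale has shown that the intensity is nonzero and finite on the sets
    \<open>{h > \<epsilon>}\<close>; with this it is known to be given by iterated
    integration.\<close>
  have nn_int: "(\<integral>\<^sup>+y. (\<integral>\<^sup>+s. g (s, y) \<partial>\<rho> y) \<partial>\<eta>) = (\<integral>\<^sup>+x. g x \<partial>?\<nu>)"
    if "g \<in> borel_measurable (borel \<Otimes>\<^sub>M borel)" for g
  proof (rule nn_integral_intensity[OF eta(1) rho h _ _ that])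
    show "emeasure ?\<nu> A = (\<integral>\<^sup>+y. emeasure (\<rho> y) {s. (s, y) \<in> A} \<partial>\<eta>)"
      if "A \<in> sets (borel \<Otimes>\<^sub>M borel)" for A
      using intensity_neq_0 by (intro emeasure_intensity that) (simp add: space_intensity)
    show "emeasure ?\<nu> {x. \<epsilon> < h (fst x)} \<noteq> \<infinity>" if "0 < \<epsilon>" for \<epsilon> :: real
      using emeasure_H_gt_finite[OF that] by (simp add: space_intensity)
  qed
  have sets_\<rho>: "sets (\<rho> y) = sets borel" for y using rho by (simp add: sigma_finite_kernel_def)
  note [measurable_cong] = sets_\<rho> sets_intensity
  have sets_tilt: "sets (tilt h v \<rho> y) = sets borel" for v y by (simp add: tilt_def sets_\<rho>)
  have nn_tilt: "(\<integral>\<^sup>+s. f s \<partial>tilt h v \<rho> y) = (\<integral>\<^sup>+s. ennreal (exp (- v * h s)) * f s \<partial>\<rho> y)"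
    if "f \<in> borel_measurable borel" for f v y
    unfolding tilt_def using that by (subst nn_integral_density) auto
  \<comment> \<open>The intensity of the tilted kernel is again given by \<open>measure_of\<close>.
    Its set function agrees with the measure \<open>tilted v\<close> on the \<sigma>-algebra, so
    countable additivity comes with the identification.\<close>
  have intensity_tilt: "intensity (tilt h v \<rho>) \<eta> = tilted v" for v
  proof -
    have sU: "sigma_sets UNIV (sets (borel \<Otimes>\<^sub>M borel)) = sets (borel \<Otimes>\<^sub>M borel :: ('a \<times> 'b) measure)"
      using sets.sigma_sets_eq[of "borel \<Otimes>\<^sub>M borel :: ('a \<times> 'b) measure"] by (simp add: space_pair_measure)
    have eq: "(\<integral>\<^sup>+y. emeasure (tilt h v \<rho> y) {s. (s, y) \<in> A} \<partial>\<eta>) = emeasure (tilted v) A"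
      if A[measurable]: "A \<in> sets (borel \<Otimes>\<^sub>M borel)" for A
    proof -
      have "emeasure (tilt h v \<rho> y) {s. (s, y) \<in> A} =
          (\<integral>\<^sup>+s. ennreal (exp (- v * ?H (s, y))) * indicator A (s, y) \<partial>\<rho> y)" for y
      proof -
        have "emeasure (tilt h v \<rho> y) {s. (s, y) \<in> A} = (\<integral>\<^sup>+s. indicator {s. (s, y) \<in> A} s \<partial>tilt h v \<rho> y)"
          using section_sets[OF A] by (simp add: sets_tilt)
        also have "\<dots> = (\<integral>\<^sup>+s. ennreal (exp (- v * h s)) * indicator {s. (s, y) \<in> A} s \<partial>\<rho> y)"
          using section_sets[OF A] by (intro nn_tilt) simp
        finally show ?thesis by (simp add: indicator_def)
      qed
      then have "(\<integral>\<^sup>+y. emeasure (tilt h v \<rho> y) {s. (s, y) \<in> A} \<partial>\<eta>) =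
          (\<integral>\<^sup>+x. ennreal (exp (- v * ?H x)) * indicator A x \<partial>?\<nu>)"
        using nn_int[of "\<lambda>x. ennreal (exp (- v * ?H x)) * indicator A x"] by simp
      also have "\<dots> = emeasure (tilted v) A"
        using A unfolding tilted_def by (subst emeasure_density) (auto simp: sets_intensity)
      finally show ?thesis .
    qed
    have "intensity (tilt h v \<rho>) \<eta> = measure_of UNIV (sets (borel \<Otimes>\<^sub>M borel)) (emeasure (tilted v))"
      unfolding intensity_def[of "tilt h v \<rho>"] using eq by (intro measure_of_eq) (auto simp: sU)
    also have "\<dots> = tilted v"
      using measure_of_of_measure[of "tilted v"]
      by (simp add: sets_intensity space_intensity sets_eq_imp_space_eq[OF sets_tilted])
    finally show ?thesis .
  qed
  have kappa_eq: "kappa_Omega h m (tilt h v \<rho>) \<eta> = moment m v" for m v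
  proof -
    have "kappa_Omega h m (tilt h v \<rho>) \<eta> =
        (\<integral>\<^sup>+y. (\<integral>\<^sup>+s. ennreal (exp (- v * ?H (s, y))) * ennreal (?H (s, y) ^ m) \<partial>\<rho> y) \<partial>\<eta>)"
      unfolding kappa_Omega_def kappa_def by (subst nn_tilt) auto
    also have "\<dots> = moment m v"
      unfolding moment_altdef
      using nn_int[of "\<lambda>x. ennreal (exp (- v * ?H x)) * ennreal (?H x ^ m)"] by simp
    finally show ?thesis .
  qed
  \<comment> \<open>Restricted to \<open>v > 0\<close>, which is all that mixing laws on the open
    half-line see.\<close>
  have tilted_law_eq: "prm (tilt h v \<rho>) \<eta> = tilted_law v" if "0 < v" for v
    using prm_law_tilted[OF that] by (intro prm_eqI) (simp add: intensity_tilt)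
  have mix_eq: "pi_mix h \<rho> \<eta> \<theta> = mixing_law \<theta>" for \<theta>
    by (simp only: pi_mix_def mixing_law_def lap_eq E_eq)
  have part_eq: "pi_part h \<rho> \<eta> n \<theta> = mixing_partition_law n \<theta>" for n \<theta>
    by (simp only: pi_part_def mixing_partition_law_def lap_eq E_eq kappa_eq partitions_def)
  have N_law_eq: "N_law h (tilt h v \<rho>) \<eta> p = added_law v p" if v: "0 < v" and p: "finite p" for v p
  proof -
    have pair: "pair_law h m (tilt h v \<rho>) \<eta> = point_law m v" for m
      unfolding pair_law_def point_law_def intensity_tilt kappa_eq by (simp add: split_beta')
    let ?L = "tilted_law v \<Otimes>\<^sub>M PiM p (\<lambda>C. point_law (card C) v)"
    have sPC: "sets (PiM p (\<lambda>C. point_law (card C) v)) = sets (PiM p (\<lambda>_. borel \<Otimes>\<^sub>M borel))"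
      by (intro sets_PiM_cong) (simp_all add: sets_intensity)
    have 1: "(\<lambda>(N, z). add_points N p z) \<in> measurable ?L (measure_algebra (borel \<Otimes>\<^sub>M borel))"
      unfolding MA[symmetric] by (intro measurable_add_points_pair p sets_PiM_point_law) simp
    have 2: "snd \<in> measurable ?L (PiM p (\<lambda>_. borel \<Otimes>\<^sub>M borel))"
      using sPC by (simp cong: measurable_cong_sets)
    have 3: "(\<lambda>(N, z). (add_points N p z, z)) \<in>
        measurable ?L (measure_algebra (borel \<Otimes>\<^sub>M borel) \<Otimes>\<^sub>M PiM p (\<lambda>_. borel \<Otimes>\<^sub>M borel))"
      using measurable_Pair[OF 1 2] by (simp add: split_beta')
    \<comment> \<open>The first marginal of the joint law forgets the points and leaves the image
      under their addition.\<close>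
    show ?thesis
      unfolding N_law_def joint_law_def pairs_law_def tilted_law_eq[OF v] pair added_law_def MA
      by (subst distr_distr[OF measurable_fst 3]) (simp add: comp_def split_beta')
  qed
  have part: "prob_space (pi_part h \<rho> \<eta> n \<theta>) \<and>
      biased_law \<theta> = bind (pi_part h \<rho> \<eta> n \<theta>) (\<lambda>(v, p). N_law h (tilt h v \<rho>) \<eta> p)"
    if "0 < \<theta> + real n" "E_inv \<theta> < \<infinity>" for n \<theta>
  proof
    show "prob_space (pi_part h \<rho> \<eta> n \<theta>)"
      unfolding part_eq by (rule prob_space_mixing_partition_law[OF that])
    have "bind (mixing_partition_law n \<theta>) (\<lambda>(v, p). added_law v p) =
        bind (mixing_partition_law n \<theta>) (\<lambda>(v, p). N_law h (tilt h v \<rho>) \<eta> p)"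
    proof (rule bind_cong_All, rule ballI)
      fix x assume "x \<in> space (mixing_partition_law n \<theta>)"
      then obtain v p where "x = (v, p)" "0 < v" "p \<in> partitions n"
        using sets_eq_imp_space_eq[OF sets_mixing_partition_law, of n \<theta>]
        by (auto simp: space_pair_measure space_restrict_space)
      then show "(case x of (v, p) \<Rightarrow> added_law v p) = (case x of (v, p) \<Rightarrow> N_law h (tilt h v \<rho>) \<eta> p)"
        using partitionsD(1) by (simp add: N_law_eq)
    qed
    then show "biased_law \<theta> = bind (pi_part h \<rho> \<eta> n \<theta>) (\<lambda>(v, p). N_law h (tilt h v \<rho>) \<eta> p)"
      unfolding part_eq by (simp add: biased_law_eq_bind_partition[OF that])
  qed
  \<comment> \<open>Only almost surely, because \<open>0 powr 0 = 0\<close>. It makes the biased law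
    with \<open>\<theta> = 0\<close> equal to the original one, which turns claim (ii) into an
    instance of \<open>part\<close>.\<close>
  have T_inv_0: "AE N in ?P. T_inv 0 N = 1"
    using T_finite T_pos by eventually_elim (auto simp: T_inv_def enn2real_eq_0_iff)
  have "E_inv 0 = (\<integral>\<^sup>+N. 1 \<partial>?P)"
    unfolding E_inv_def by (rule nn_integral_cong_AE[OF T_inv_0])
  then have E_inv_0: "E_inv 0 = 1" by (simp add: P.emeasure_space_1)
  have "biased_law 0 = density ?P (\<lambda>_. 1)"
    unfolding biased_law_def E_inv_0 using T_inv_0 by (intro density_cong) auto
  then have biased_0: "biased_law 0 = ?P" by (simp add: density_1)
  have i: "prob_space (pi_mix h \<rho> \<eta> \<theta>) \<and>
      prm_T h \<rho> \<eta> \<theta> = bind (pi_mix h \<rho> \<eta> \<theta>) (\<lambda>v. prm (tilt h v \<rho>) \<eta>) \<and>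
      (\<forall>f \<in> borel_measurable (borel \<Otimes>\<^sub>M borel).
         laplace_functional f (prm_T h \<rho> \<eta> \<theta>)
           = (\<integral>\<^sup>+ v. laplace_functional f (prm (tilt h v \<rho>) \<eta>) \<partial>pi_mix h \<rho> \<eta> \<theta>))"
    if \<theta>: "0 < \<theta>" and "E_T_neg_powr h \<rho> \<eta> \<theta> < \<infinity>" for \<theta>
  proof (intro conjI ballI)
    have E: "E_inv \<theta> < \<infinity>" using that by (simp add: E_eq)
    have pos: "0 < v" if "v \<in> space (mixing_law \<theta>)" for v
      using that sets_eq_imp_space_eq[OF sets_mixing_law, of \<theta>] by (simp add: space_restrict_space)
    show "prob_space (pi_mix h \<rho> \<eta> \<theta>)"
      unfolding mix_eq by (rule prob_space_mixing_law[OF \<theta> E])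
    have "bind (mixing_law \<theta>) tilted_law = bind (mixing_law \<theta>) (\<lambda>v. prm (tilt h v \<rho>) \<eta>)"
      by (intro bind_cong_All ballI) (simp add: tilted_law_eq pos)
    then show "prm_T h \<rho> \<eta> \<theta> = bind (pi_mix h \<rho> \<eta> \<theta>) (\<lambda>v. prm (tilt h v \<rho>) \<eta>)"
      unfolding mix_eq biased by (simp add: biased_law_eq_bind[OF \<theta> E])
    fix f :: "'a \<times> 'b \<Rightarrow> ennreal" assume f: "f \<in> borel_measurable (borel \<Otimes>\<^sub>M borel)"
    have "(\<lambda>N. exp_neg (\<integral>\<^sup>+x. f x \<partial>N)) \<in> borel_measurable (measure_algebra ?\<nu>)"
      unfolding MA by (rule measurable_compose[OF borel_measurable_nn_integral_measure_algebra[OF f] measurable_exp_neg])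
    note mix = nn_integral_mixing_law[OF \<theta> E this]
    have "(\<integral>\<^sup>+v. (\<integral>\<^sup>+N. exp_neg (\<integral>\<^sup>+x. f x \<partial>N) \<partial>prm (tilt h v \<rho>) \<eta>) \<partial>mixing_law \<theta>) =
        (\<integral>\<^sup>+v. (\<integral>\<^sup>+N. exp_neg (\<integral>\<^sup>+x. f x \<partial>N) \<partial>tilted_law v) \<partial>mixing_law \<theta>)"
      by (intro nn_integral_cong) (simp add: tilted_law_eq pos)
    with mix show "laplace_functional f (prm_T h \<rho> \<eta> \<theta>) =
        (\<integral>\<^sup>+ v. laplace_functional f (prm (tilt h v \<rho>) \<eta>) \<partial>pi_mix h \<rho> \<eta> \<theta>)"
      unfolding laplace_functional_def mix_eq biased by simp
  qed
  show ?thesis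
    using i part[of 0] part by (auto simp: E_eq biased biased_0 E_inv_0)
qed

end
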